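(* Let $\Lambda\subset\mathbb{R}^d$ be open and let $\{X_\mu\}_{\mu\in\Lambda}$ be a family of potential analytic differential systems $\dot x=y,\ \dot y=-V_\mu'(x)$ with a non-degenerate center at the origin, verifying hypothesis (H) and with energy level at the outer boundary $h_0(\mu)<+\infty$ for all $\mu\in\Lambda$. Assume that there exist $n\ge0$ continuous functions $\nu_1,\nu_2,\dots,\nu_n$ in a neighborhood of some fixed $\hat\mu\in\Lambda$ such that $$(\mathscr D_{\boldsymbol\nu_n(\mu)}\circ\mathcal P)\bigl[z\sqrt{h_0(\mu)}\,(g_\mu^{-1})''(z\sqrt{h_0(\mu)})\bigr]\sim_{z=1}a(\mu)(1-z)^{-\xi(\mu)}\quad\text{at }\hat\mu.$$ For each $i\in\mathbb{N}$, let $N_i(\mu)$ be the $i$-th momentum of $(\mathscr D_{\boldsymbol\nu_n(\mu)}\circ\mathcal P)\bigl[z\sqrt{h_0(\mu)}\,(g_\mu^{-1})''(z\sqrt{h_0(\mu)})\bigr]$, whenever it is well defined. If $\xi(\hat\mu)=\frac12-m$ for some $m\in\mathbb{N}\cup\{0\}$ and $N_1\equiv N_2\equiv\cdots\equiv N_m\equiv0$, then $\mathrm{Crit}\bigl((\Pi_{\hat\mu},X_{\hat\mu}),X_\mu\bigr)\le n$. (The assumption on the existence of the $\nu_i$ is void if $n=0$, and the assumption on the momenta is void if $m=0$.)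
   Context: Setting. $\{V_\mu\}_{\mu\in\Lambda}$ is a continuous family of analytic functions, $V_\mu$ defined on an open interval $I_\mu\ni0$, with $V_\mu(0)=V_\mu'(0)=0$ and $V_\mu''(0)>0$. The period annulus $\mathscr P_\mu$ is the largest punctured neighborhood of the origin foliated by periodic orbits surrounding it. Embedding it in $\mathbb{RP}^2$, the outer boundary is $\Pi_\mu:=\partial\mathscr P_\mu\setminus\{(0,0)\}$. With $H(x,y;\mu)=\frac{y^2}{2}+V_\mu(x)$ one has $H(\mathscr P_\mu)=(0,h_0(\mu))$, $h_0(\mu)\in\mathbb{R}^+\cup\{+\infty\}$ being the energy level of the outer boundary. The projection of $\mathscr P_\mu$ (with the origin) on the $x$-axis is $(x_\ell(\mu),x_r(\mu))$, $x_\ell(\mu)<0<x_r(\mu)$. Set $g_\mu(x):=\mathrm{sgn}(x)\sqrt{V_\mu(x)}$; its inverse $g_\mu^{-1}$ is defined on $(-\sqrt{h_0(\mu)},\sqrt{h_0(\mu)})$. Hypothesis (H): (a) for all $k\ge0$, $(x,\mu)\mapsto V_\mu^{(k)}(x)$ is continuous on $\{(x,\mu)\in\mathbb{R}\times\Lambda:x\in I_\mu\}$; (b) $\mu\mapsto x_r(\mu)$ is continuous on $\Lambda$ or $x_r(\mu)=+\infty$ for all $\mu\in\Lambda$; (c) $\mu\mapsto x_\ell(\mu)$ is continuous on $\Lambda$ or $x_\ell(\mu)=-\infty$ for all $\mu\in\Lambda$; (d) $\mu\mapsto h_0(\mu)$ is continuous on $\Lambda$ or $h_0(\mu)=+\infty$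 for all $\mu\in\Lambda$. Operators. For a function $f$ of $z\in(-1,1)$, $\mathcal P[f](z):=f(z)+f(-z)$. For $\boldsymbol\nu_n=(\nu_1,\dots,\nu_n)\in\mathbb{R}^n$ and $f$ analytic on $(0,1)$, $$\mathscr D_{\boldsymbol\nu_n}[f](x):=(x(1-x^2))^{\frac{n(n+1)}{2}}\,\frac{W[\psi_{\nu_1},\dots,\psi_{\nu_n},f](x)}{\prod_{i=1}^n\psi_{\nu_i}(x)},\qquad\psi_\nu(x):=\frac{1}{1-x^2}\left(\frac{x}{\sqrt{1-x^2}}\right)^{\nu},$$ where $W[f_0,\dots,f_{k-1}](x)=\det\bigl(f_j^{(i)}(x)\bigr)_{0\le i,j\le k-1}$, and $\mathscr D_{\boldsymbol\nu_0}:=\mathrm{id}$; $\boldsymbol\nu_n(\mu)=(\nu_1(\mu),\dots,\nu_n(\mu))$. The $i$-th momentum of a function $f$ on $[0,1)$ is $N_i[f]:=\int_0^1\frac{f(x)}{\sqrt{1-x^2}}\left(\frac{x}{\sqrt{1-x^2}}\right)^{2i-2}dx$, $i\in\mathbb{N}=\{1,2,\dots\}$. Quantification. For a continuous family $\{F_\mu\}$ of analytic functions on $(0,1)$, $F_\mu(z)\sim_{z=1}a(\mu)(1-z)^{-\xi(\mu)}$ at $\hat\mu$ means that there is an open neighborhood $U$ of $\hat\mu$ such that for each $\mu\in U$, $\lim_{z\to1^-}F_\mu(z)(1-z)^{\xi(\mu)}=a(\mu)\ne0$, and moreover $\lim_{(z,\mu)\to(1,\hat\mu)}F_\mu(z)(1-z)^{\xi(\mu)}=a(\hat\mu)\ne0$.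 Criticality. A critical periodic orbit is a periodic orbit in $\mathscr P_\mu$ whose energy is a zero of the derivative $T_\mu'(h)$ of the period function $T_\mu(h)$ (the minimal period of the periodic orbit in $\{H=h\}$). Let $d_H$ be the Hausdorff distance between compact subsets of $\mathbb{RP}^2$, and suppose the outer boundary varies continuously at $\hat\mu$ (for every $\varepsilon>0$ there is $\delta>0$ with $d_H(\Pi_\mu,\Pi_{\hat\mu})\le\varepsilon$ whenever $\|\mu-\hat\mu\|\le\delta$). With $$N(\delta,\varepsilon):=\sup\{\#\text{ critical periodic orbits }\gamma\text{ of }X_\mu\text{ in }\mathscr P_\mu\text{ with }d_H(\gamma,\Pi_{\hat\mu})\le\varepsilon\text{ and }\|\mu-\hat\mu\|\le\delta\},$$ $\mathrm{Crit}\bigl((\Pi_{\hat\mu},X_{\hat\mu}),X_\mu\bigr):=\inf_{\delta,\varepsilon}N(\delta,\varepsilon)$. *)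

theory Defs
  imports
    "HOL-Analysis.Analysis"
    "HOL-Library.Extended_Nat"
    "Jordan_Normal_Form.Determinant"
begin

section \<open>The real projective plane and the Hausdorff distance\<close>

quotient_type rp2 = "real \<times> real \<times> real" / partial:
  "\<lambda>u v. u \<noteq> 0 \<and> v \<noteq> 0 \<and> (\<exists>c. v = c *\<^sub>R u)"
proof (rule part_equivpI)
  show "\<exists>u::real \<times> real \<times> real. u \<noteq> 0 \<and> u \<noteq> 0 \<and> (\<exists>c. u = c *\<^sub>R u)"
    by (rule exI[of _ "(0, 0, 1)"]) (auto simp: zero_prod_def intro: exI[of _ 1])
next
  show "symp (\<lambda>u v::real \<times> real \<times> real. u \<noteq> 0 \<and> v \<noteq> 0 \<and> (\<exists>c. v = c *\<^sub>R u))"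
  proof (rule sympI)
    fix u v :: "real \<times> real \<times> real"
    assume h: "u \<noteq> 0 \<and> v \<noteq> 0 \<and> (\<exists>c. v = c *\<^sub>R u)"
    then obtain c where c: "v = c *\<^sub>R u" by blast
    with h have "u = inverse c *\<^sub>R v" by auto
    with h show "v \<noteq> 0 \<and> u \<noteq> 0 \<and> (\<exists>c. u = c *\<^sub>R v)" by blast
  qed
next
  show "transp (\<lambda>u v::real \<times> real \<times> real. u \<noteq> 0 \<and> v \<noteq> 0 \<and> (\<exists>c. v = c *\<^sub>R u))"
    by (rule transpI) (metis scaleR_scaleR)
qed

text \<open>
  A point of the projective plane is a pair of antipodal points of the unit sphere, and
  the distance of two such pairs is taken in the ambient Euclidean space.  This metric induces the
  quotient topology; the space being compact, any other compatible metric yields the same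
  notions of continuity of the outer boundary and of criticality.
\<close>

instantiation rp2 :: metric_space
begin

lift_definition dist_rp2 :: "rp2 \<Rightarrow> rp2 \<Rightarrow> real"
  is "\<lambda>u v. min (dist (sgn u) (sgn v)) (dist (sgn u) (- sgn v))"
proof -
  fix u u' v v' :: "real \<times> real \<times> real"
  assume u: "u \<noteq> 0 \<and> u' \<noteq> 0 \<and> (\<exists>c. u' = c *\<^sub>R u)"
    and v: "v \<noteq> 0 \<and> v' \<noteq> 0 \<and> (\<exists>c. v' = c *\<^sub>R v)"
  have *: "sgn w' = sgn w \<or> sgn w' = - sgn w"
    if "w \<noteq> 0 \<and> w' \<noteq> 0 \<and> (\<exists>c. w' = c *\<^sub>R w)" for w w' :: "real \<times> real \<times> real"
  proof -
    from that obtain c where c: "w' = c *\<^sub>R w" "c \<noteq> 0" by force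
    then show ?thesis by (cases "c > 0") (auto simp: sgn_scaleR)
  qed
  have d: "dist (- x) (- y) = dist x y" "dist (- x) y = dist x (- y)"
    for x y :: "real \<times> real \<times> real"
    by (auto simp: dist_norm norm_minus_commute) (metis add.commute norm_minus_cancel minus_add_distrib uminus_add_conv_diff)
  show "min (dist (sgn u) (sgn v)) (dist (sgn u) (- sgn v)) =
        min (dist (sgn u') (sgn v')) (dist (sgn u') (- sgn v'))"
    using *[OF u] *[OF v] by (auto simp: d min.commute)
qed

definition uniformity_rp2 :: "(rp2 \<times> rp2) filter" where
  "uniformity_rp2 = (INF e\<in>{0<..}. principal {(x, y). dist x y < e})"

definition open_rp2 :: "rp2 set \<Rightarrow> bool" where
  "open_rp2 S \<longleftrightarrow> (\<forall>x\<in>S. \<forall>\<^sub>F (x', y) in uniformity. x' = x \<longrightarrow> y \<in> S)"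

instance
proof
  fix x y z :: rp2
  show "dist x y = 0 \<longleftrightarrow> x = y"
  proof (transfer, goal_cases)
    case (1 u v)
    have "\<exists>c. v = c *\<^sub>R u" if "sgn u = s *\<^sub>R sgn v" "s = 1 \<or> s = -1" for s
    proof -
      have "v = (norm v * s * inverse (norm u)) *\<^sub>R u"
      proof -
        have "v = norm v *\<^sub>R sgn v" using 1 by (simp add: sgn_div_norm)
        also have "sgn v = s *\<^sub>R sgn u" using that by auto
        finally show ?thesis by (simp add: sgn_div_norm mult.assoc)
      qed
      then show ?thesis by blast
    qed
    from this[of 1] this[of "-1"]
    have A: "\<exists>c. v = c *\<^sub>R u" if "sgn u = sgn v \<or> sgn u = - sgn v" using that by auto
    have B: "sgn u = sgn v \<or> sgn u = - sgn v" if "\<exists>c. v = c *\<^sub>R u"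
    proof -
      from that obtain c where c: "v = c *\<^sub>R u" by blast
      with 1 have "c \<noteq> 0" by auto
      with c show ?thesis by (cases "c > 0") (auto simp: sgn_scaleR)
    qed
    have C: "min (dist (sgn u) (sgn v)) (dist (sgn u) (- sgn v)) = 0 \<longleftrightarrow>
        sgn u = sgn v \<or> sgn u = - sgn v"
      by (auto simp: min_def)
    show ?case unfolding C using A B 1 by blast
  qed
  show "dist x y \<le> dist x z + dist y z"
  proof (transfer, goal_cases)
    case (1 u v w)
    have m: "dist a (- b) = norm (a + b)" for a b :: "real \<times> real \<times> real"
      by (simp add: dist_norm)
    have "norm (a - b) \<le> norm (a - c) + norm (b - c)"
      "norm (a - b) \<le> norm (a + c) + norm (b + c)"
      "norm (a + b) \<le> norm (a - c) + norm (b + c)"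
      "norm (a + b) \<le> norm (a + c) + norm (b - c)" for a b c :: "real \<times> real \<times> real"
      using norm_triangle_ineq4[of "a - c" "b - c"] norm_triangle_ineq4[of "a + c" "b + c"]
        norm_triangle_ineq[of "a - c" "b + c"] norm_triangle_ineq[of "a + c" "b - c"]
      by (simp_all add: algebra_simps)
    from this[where a = "sgn u" and b = "sgn v" and c = "sgn w"]
    show ?case unfolding m unfolding dist_norm by linarith
  qed
qed (simp_all only: uniformity_rp2_def open_rp2_def)

end

lift_definition rp2_of :: "real \<times> real \<Rightarrow> rp2" is "\<lambda>(x, y). (x, y, 1)"
  by (auto simp: zero_prod_def intro: exI[of _ 1])

text \<open>Meaningful for nonempty bounded sets (every subset of \<^typ>\<open>rp2\<close> is bounded).\<close>

definition hausdorff_dist :: "'a::metric_space set \<Rightarrow> 'a set \<Rightarrow> real" where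
  "hausdorff_dist A B = max (SUP a\<in>A. infdist a B) (SUP b\<in>B. infdist b A)"


section \<open>Potential systems\<close>

definition real_analytic_on :: "(real \<Rightarrow> real) \<Rightarrow> real set \<Rightarrow> bool" where
  "real_analytic_on f S \<longleftrightarrow>
     (\<forall>x\<in>S. \<exists>r>0. \<exists>c. \<forall>y. \<bar>y - x\<bar> < r \<longrightarrow> (\<lambda>k. c k * (y - x) ^ k) sums f y)"

text \<open>
  A potential is a function \<open>V\<close> together with its open interval \<open>J\<close> of definition; the values of
  \<open>V\<close> outside \<open>J\<close> are irrelevant.  The phase space of the system is \<open>J \<times> \<real>\<close>.
\<close>

definition center_potential :: "(real \<Rightarrow> real) \<Rightarrow> real set \<Rightarrow> bool" where
  "center_potential V J \<longleftrightarrow>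
     open J \<and> is_interval J \<and> 0 \<in> J \<and> real_analytic_on V J \<and>
     V 0 = 0 \<and> deriv V 0 = 0 \<and> (deriv ^^ 2) V 0 > 0"

definition energy :: "(real \<Rightarrow> real) \<Rightarrow> real \<times> real \<Rightarrow> real" where
  "energy V = (\<lambda>(x, y). y\<^sup>2 / 2 + V x)"

definition solution :: "(real \<Rightarrow> real) \<Rightarrow> real set \<Rightarrow> (real \<Rightarrow> real \<times> real) \<Rightarrow> bool" where
  "solution V J u \<longleftrightarrow>
     (\<forall>t. fst (u t) \<in> J \<and>
          (u has_vector_derivative (snd (u t), - deriv V (fst (u t)))) (at t))"

definition periodic_solution :: "(real \<Rightarrow> real) \<Rightarrow> real set \<Rightarrow> (real \<Rightarrow> real \<times> real) \<Rightarrow> bool" where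
  "periodic_solution V J u \<longleftrightarrow>
     solution V J u \<and> (\<exists>T>0. \<forall>t. u (t + T) = u t) \<and> (\<exists>t. u t \<noteq> u 0)"

definition periodic_orbit :: "(real \<Rightarrow> real) \<Rightarrow> real set \<Rightarrow> (real \<times> real) set \<Rightarrow> bool" where
  "periodic_orbit V J \<gamma> \<longleftrightarrow> (\<exists>u. periodic_solution V J u \<and> \<gamma> = range u)"

text \<open>
  Punctured neighbourhoods are taken connected: otherwise one could adjoin annuli of periodic
  orbits that surround the origin together with further equilibria.  The union below is itself
  of the required form, so it is the largest such punctured neighbourhood.
\<close>

definition period_annulus :: "(real \<Rightarrow> real) \<Rightarrow> real set \<Rightarrow> (real \<times> real) set" where
  "period_annulus V J =
     \<Union>{A. (0, 0) \<notin> A \<and> open (insert (0, 0) A) \<and> connected (insert (0, 0) A) \<and>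
          (\<forall>p\<in>A. \<exists>\<gamma>. periodic_orbit V J \<gamma> \<and> p \<in> \<gamma> \<and> \<gamma> \<subseteq> A \<and> (0, 0) \<in> inside \<gamma>)}"

definition outer_boundary :: "(real \<Rightarrow> real) \<Rightarrow> real set \<Rightarrow> rp2 set" where
  "outer_boundary V J = frontier (rp2_of ` period_annulus V J) - {rp2_of (0, 0)}"

definition outer_energy :: "(real \<Rightarrow> real) \<Rightarrow> real set \<Rightarrow> ereal" where
  "outer_energy V J = (SUP p\<in>period_annulus V J. ereal (energy V p))"

definition x_left :: "(real \<Rightarrow> real) \<Rightarrow> real set \<Rightarrow> ereal" where
  "x_left V J = (INF p\<in>insert (0, 0) (period_annulus V J). ereal (fst p))"

definition x_right :: "(real \<Rightarrow> real) \<Rightarrow> real set \<Rightarrow> ereal" where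
  "x_right V J = (SUP p\<in>insert (0, 0) (period_annulus V J). ereal (fst p))"

definition g_fun :: "(real \<Rightarrow> real) \<Rightarrow> real \<Rightarrow> real" where
  "g_fun V x = sgn x * sqrt (V x)"

definition g_inv :: "(real \<Rightarrow> real) \<Rightarrow> real set \<Rightarrow> real \<Rightarrow> real" where
  "g_inv V J = the_inv_into {x. x_left V J < ereal x \<and> ereal x < x_right V J} (g_fun V)"

text \<open>Continuity is that of a real-valued function: a function that is infinite at some
  parameters only is excluded, even if it is continuous into the extended reals.\<close>

definition continuous_or_const :: "'p::topological_space set \<Rightarrow> ('p \<Rightarrow> ereal) \<Rightarrow> ereal \<Rightarrow> bool" where
  "continuous_or_const \<Lambda> e c \<longleftrightarrow>
     (\<forall>\<mu>\<in>\<Lambda>. \<bar>e \<mu>\<bar> \<noteq> \<infinity>) \<and> continuous_on \<Lambda> e \<or> (\<forall>\<mu>\<in>\<Lambda>. e \<mu> = c)"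

definition hypothesis_H ::
  "'p::topological_space set \<Rightarrow> ('p \<Rightarrow> real \<Rightarrow> real) \<Rightarrow> ('p \<Rightarrow> real set) \<Rightarrow> bool" where
  "hypothesis_H \<Lambda> V J \<longleftrightarrow>
     (\<forall>k. continuous_on {(x, \<mu>). \<mu> \<in> \<Lambda> \<and> x \<in> J \<mu>} (\<lambda>(x, \<mu>). (deriv ^^ k) (V \<mu>) x)) \<and>
     continuous_or_const \<Lambda> (\<lambda>\<mu>. x_right (V \<mu>) (J \<mu>)) \<infinity> \<and>
     continuous_or_const \<Lambda> (\<lambda>\<mu>. x_left (V \<mu>) (J \<mu>)) (- \<infinity>) \<and>
     continuous_or_const \<Lambda> (\<lambda>\<mu>. outer_energy (V \<mu>) (J \<mu>)) \<infinity>"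


section \<open>Operators, momenta and quantification\<close>

definition wronskian :: "(real \<Rightarrow> real) list \<Rightarrow> real \<Rightarrow> real" where
  "wronskian fs x =
     Determinant.det (Matrix.mat (length fs) (length fs) (\<lambda>(i, j). (deriv ^^ i) (fs ! j) x))"

definition psi :: "real \<Rightarrow> real \<Rightarrow> real" where
  "psi \<nu> x = 1 / (1 - x\<^sup>2) * (x / sqrt (1 - x\<^sup>2)) powr \<nu>"

text \<open>For the empty list of exponents this is the identity.\<close>

definition D_op :: "real list \<Rightarrow> (real \<Rightarrow> real) \<Rightarrow> real \<Rightarrow> real" where
  "D_op \<nu>s f x = (let n = length \<nu>s in
     (x * (1 - x\<^sup>2)) ^ (n * (n + 1) div 2) *
     (wronskian (map psi \<nu>s @ [f]) x / (\<Prod>\<nu>\<leftarrow>\<nu>s. psi \<nu> x)))"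

definition P_op :: "(real \<Rightarrow> real) \<Rightarrow> real \<Rightarrow> real" where
  "P_op f z = f z + f (- z)"

definition momentum_integrand :: "nat \<Rightarrow> (real \<Rightarrow> real) \<Rightarrow> real \<Rightarrow> real" where
  "momentum_integrand i f x = f x / sqrt (1 - x\<^sup>2) * (x / sqrt (1 - x\<^sup>2)) ^ (2 * i - 2)"

definition momentum_defined :: "nat \<Rightarrow> (real \<Rightarrow> real) \<Rightarrow> bool" where
  "momentum_defined i f \<longleftrightarrow> set_integrable lborel {0..<1} (momentum_integrand i f)"

definition momentum :: "nat \<Rightarrow> (real \<Rightarrow> real) \<Rightarrow> real" where
  "momentum i f = (LINT x:{0..<1}|lborel. momentum_integrand i f x)"

text \<open>
  \<open>F \<mu> z \<sim> a \<mu> * (1 - z) powr (- \<xi> \<mu>)\<close> at \<open>\<mu>0\<close>, for a family indexed by \<open>D\<close>.  In the joint limit \<open>\<mu>\<close> is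
  unrestricted near \<open>\<mu>0\<close>, with \<open>\<mu> = \<mu>0\<close> allowed.
\<close>

definition quantified_at_1 ::
  "'p::topological_space set \<Rightarrow> ('p \<Rightarrow> real \<Rightarrow> real) \<Rightarrow> ('p \<Rightarrow> real) \<Rightarrow> ('p \<Rightarrow> real) \<Rightarrow> 'p \<Rightarrow> bool" where
  "quantified_at_1 D F a \<xi> \<mu>0 \<longleftrightarrow>
     (\<exists>U. open U \<and> \<mu>0 \<in> U \<and> U \<subseteq> D \<and>
        (\<forall>\<mu>\<in>U. a \<mu> \<noteq> 0 \<and> ((\<lambda>z. F \<mu> z * (1 - z) powr \<xi> \<mu>) \<longlongrightarrow> a \<mu>) (at_left 1)) \<and>
        ((\<lambda>(z, \<mu>). F \<mu> z * (1 - z) powr \<xi> \<mu>) \<longlongrightarrow> a \<mu>0) (at_left 1 \<times>\<^sub>F nhds \<mu>0))"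

definition DP_function :: "(real \<Rightarrow> real) \<Rightarrow> real set \<Rightarrow> real list \<Rightarrow> real \<Rightarrow> real" where
  "DP_function V J \<nu>s = (let s = sqrt (real_of_ereal (outer_energy V J)) in
     D_op \<nu>s (P_op (\<lambda>z. z * s * (deriv ^^ 2) (g_inv V J) (z * s))))"


section \<open>Criticality at the outer boundary\<close>

definition minimal_period :: "(real \<Rightarrow> 'a) \<Rightarrow> real \<Rightarrow> bool" where
  "minimal_period u T \<longleftrightarrow>
     T > 0 \<and> (\<forall>t. u (t + T) = u t) \<and> (\<forall>S. 0 < S \<and> S < T \<longrightarrow> (\<exists>t. u (t + S) \<noteq> u t))"

definition period_function :: "(real \<Rightarrow> real) \<Rightarrow> real set \<Rightarrow> real \<Rightarrow> real" where
  "period_function V J h =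
     (THE T. \<exists>u. periodic_solution V J u \<and> range u \<subseteq> period_annulus V J \<and>
                 (\<forall>t. energy V (u t) = h) \<and> minimal_period u T)"

definition critical_periodic_orbit ::
  "(real \<Rightarrow> real) \<Rightarrow> real set \<Rightarrow> (real \<times> real) set \<Rightarrow> bool" where
  "critical_periodic_orbit V J \<gamma> \<longleftrightarrow>
     periodic_orbit V J \<gamma> \<and> \<gamma> \<subseteq> period_annulus V J \<and>
     (\<exists>h. (\<forall>p\<in>\<gamma>. energy V p = h) \<and> (period_function V J has_real_derivative 0) (at h))"

definition outer_boundary_continuous ::
  "'p::real_normed_vector set \<Rightarrow> ('p \<Rightarrow> real \<Rightarrow> real) \<Rightarrow> ('p \<Rightarrow> real set) \<Rightarrow> 'p \<Rightarrow> bool" where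
  "outer_boundary_continuous \<Lambda> V J \<mu>0 \<longleftrightarrow>
     (\<forall>\<epsilon>>0. \<exists>\<delta>>0. \<forall>\<mu>\<in>\<Lambda>. norm (\<mu> - \<mu>0) \<le> \<delta> \<longrightarrow>
        hausdorff_dist (outer_boundary (V \<mu>) (J \<mu>)) (outer_boundary (V \<mu>0) (J \<mu>0)) \<le> \<epsilon>)"

definition enat_card :: "'a set \<Rightarrow> enat" where
  "enat_card A = (if finite A then enat (card A) else \<infinity>)"

definition criticality_bound ::
  "'p::real_normed_vector set \<Rightarrow> ('p \<Rightarrow> real \<Rightarrow> real) \<Rightarrow> ('p \<Rightarrow> real set) \<Rightarrow> 'p \<Rightarrow>
     real \<Rightarrow> real \<Rightarrow> enat" where
  "criticality_bound \<Lambda> V J \<mu>0 \<delta> \<epsilon> =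
     (SUP \<mu>\<in>{\<mu>\<in>\<Lambda>. norm (\<mu> - \<mu>0) \<le> \<delta>}.
        enat_card {\<gamma>. critical_periodic_orbit (V \<mu>) (J \<mu>) \<gamma> \<and>
          hausdorff_dist (rp2_of ` \<gamma>) (outer_boundary (V \<mu>0) (J \<mu>0)) \<le> \<epsilon>})"

definition Crit ::
  "'p::real_normed_vector set \<Rightarrow> ('p \<Rightarrow> real \<Rightarrow> real) \<Rightarrow> ('p \<Rightarrow> real set) \<Rightarrow> 'p \<Rightarrow> enat" where
  "Crit \<Lambda> V J \<mu>0 = (INF \<delta>\<in>{0<..}. INF \<epsilon>\<in>{0<..}. criticality_bound \<Lambda> V J \<mu>0 \<delta> \<epsilon>)"

end

theory Submission
  imports Defs "HOL-Real_Asymp.Real_Asymp"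
begin

text \<open>
  In the coordinate \<open>u = x / \<surd>(1 - x\<^sup>2)\<close> put \<open>\<phi> u = (1 - x\<^sup>2) \<P>[f] x\<close>, where \<open>f\<close> is the function
  \<open>z \<surd>h\<^sub>0 (g\<^sup>-\<^sup>1)'' (z \<surd>h\<^sub>0)\<close>.  The energy \<open>h\<close> is critical iff \<open>E \<phi> t = \<integral>\<^sub>0\<^sup>\<pi>\<^sup>/\<^sup>2 \<phi> (t sin b) db\<close> vanishes
  at \<open>t = \<surd>(h / (h\<^sub>0 - h))\<close>.  In this coordinate the Wronskian operator is, up to the nonvanishing factor
  \<open>1 + u\<^sup>2\<close> and a Vandermonde determinant, the composition of the Euler operators \<open>u d/du - \<nu>\<^sub>i\<close>, and these
  commute with the average \<open>E\<close>.  By Rolle, \<open>E \<phi>\<close> has at most \<open>n\<close> zeros on every half line on which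
  the average \<open>E G\<close> of the transformed function \<open>G\<close> has none.

  Now \<open>G u\<close> behaves like \<open>u\<close> to the power \<open>2\<xi> - 2\<close>, and \<open>2\<xi> - 2 = - 1 - 2m\<close> at the base parameter.  Expanding
  \<open>1 / \<surd>(t\<^sup>2 - u\<^sup>2)\<close> in powers of \<open>u / t\<close>, the first \<open>m\<close> terms are momenta, hence reduce to tails of order
  \<open>t\<^sup>-\<^sup>1\<^sup>-\<^sup>2\<^sup>m\<close>, whereas the next term is larger by a factor \<open>log t\<close>.  So \<open>E G t \<noteq> 0\<close> for \<open>t \<ge> t\<^sub>0\<close>,
  uniformly in the parameter.  Finally, an orbit of energy \<open>h\<close> contains the point \<open>(0, \<surd>(2h))\<close>, so orbits
  that are Hausdorff close to the outer boundary have large \<open>t\<close>.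
\<close>

section \<open>Jointly smooth families of functions\<close>

text \<open>The exponent \<xi> is not assumed continuous. Near the base parameter e = 2\<xi> - 1 +
  2m may have either sign, and the logarithm of the overview becomes an integral of
  \<open>sin b powr (e - 1) * cos b\<close>. So continuity of \<xi> at the base parameter is
  extracted from the quantification itself, and positivity of the average is proved for all small e
  at once, with thresholds depending only on bounds for the function. The Vandermonde determinant is
  kept as a factor of G; it cannot vanish where \<open>E G\<close> does not. E commutes with the
  Euler operators because it averages over the dilations by sin b. On the dynamical side the annulus
  is given only as a union of sets filled by periodic orbits. That V' has the sign of x on its
  projection, which makes g invertible, has to be read off from these orbits; the period then
  becomes an integral over an angle in which every orbit is explicit. The formula for g hides its
  smoothness at the origin, which comes from V = x^2 w with w positive and smooth, jointly in the
  parameter.\<close>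

primrec Ck :: "nat \<Rightarrow> ('p::topological_space \<times> real) set \<Rightarrow> ('p \<Rightarrow> real \<Rightarrow> real) \<Rightarrow> bool" where
  "Ck 0 W f \<longleftrightarrow> continuous_on W (\<lambda>(\<mu>, x). f \<mu> x)"
| "Ck (Suc k) W f \<longleftrightarrow> continuous_on W (\<lambda>(\<mu>, x). f \<mu> x) \<and>
     (\<exists>f'. (\<forall>\<mu> x. (\<mu>, x) \<in> W \<longrightarrow> (f \<mu> has_real_derivative f' \<mu> x) (at x)) \<and> Ck k W f')"

text \<open>\<open>Ck\<close> asks for derivatives in x only and for their joint continuity, which
  is what hypothesis (H) provides; the parameter space needs no more than a topology. Openness of
  the slices makes the x-derivatives depend on the values in W alone, so a family may be exchanged
  for one that agrees with it on W.\<close>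

definition open_slices :: "('p::topological_space \<times> real) set \<Rightarrow> bool" where
  "open_slices W \<longleftrightarrow> (\<forall>\<mu>. open {x. (\<mu>, x) \<in> W})"

lemma open_slices_Times: "open S \<Longrightarrow> open_slices (D \<times> S)"
  unfolding open_slices_def
proof
  fix \<mu> assume "open S"
  then show "open {x. (\<mu>, x) \<in> D \<times> S}" by (cases "\<mu> \<in> D") auto
qed

lemma Ck_continuous: "Ck k W f \<Longrightarrow> continuous_on W (\<lambda>(\<mu>, x). f \<mu> x)"
  by (cases k) auto

lemma Ck_SucI:
  assumes "\<And>\<mu> x. (\<mu>, x) \<in> W \<Longrightarrow> (f \<mu> has_real_derivative f' \<mu> x) (at x)"
    "Ck k W f'" "continuous_on W (\<lambda>(\<mu>, x). f \<mu> x)"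
  shows "Ck (Suc k) W f"
  using assms by auto

lemma Ck_Suc_imp: "Ck (Suc k) W f \<Longrightarrow> Ck k W f"
proof (induction k arbitrary: f)
  case (Suc k)
  from Suc.prems obtain f' where "\<forall>\<mu> x. (\<mu>, x) \<in> W \<longrightarrow> (f \<mu> has_real_derivative f' \<mu> x) (at x)"
    "Ck (Suc k) W f'" "continuous_on W (\<lambda>(\<mu>, x). f \<mu> x)"
    unfolding Ck.simps(2)[of "Suc k"] by blast
  with Suc.IH[of f'] show ?case by (intro Ck_SucI[of _ _ f']) auto
qed auto

lemma Ck_subset: "Ck k W f \<Longrightarrow> W' \<subseteq> W \<Longrightarrow> Ck k W' f"
proof (induction k arbitrary: f)
  case 0 then show ?case by (auto intro: continuous_on_subset)
next
  case (Suc k)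
  from Suc.prems obtain f' where "\<forall>\<mu> x. (\<mu>, x) \<in> W \<longrightarrow> (f \<mu> has_real_derivative f' \<mu> x) (at x)"
    "Ck k W f'" "continuous_on W (\<lambda>(\<mu>, x). f \<mu> x)"
    unfolding Ck.simps(2) by blast
  with Suc show ?case by (intro Ck_SucI[of _ _ f']) (auto intro: continuous_on_subset)
qed

lemma Ck_cong:
  assumes os: "open_slices W"
  shows "Ck k W f \<Longrightarrow> (\<And>\<mu> x. (\<mu>, x) \<in> W \<Longrightarrow> f \<mu> x = g \<mu> x) \<Longrightarrow> Ck k W g"
proof (induction k arbitrary: f g)
  case 0
  then show ?case
    using continuous_on_eq[of W "\<lambda>(\<mu>, x). f \<mu> x" "\<lambda>(\<mu>, x). g \<mu> x"] by fastforce
next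
  case (Suc k)
  from Suc.prems obtain f' where f': "\<And>\<mu> x. (\<mu>, x) \<in> W \<Longrightarrow> (f \<mu> has_real_derivative f' \<mu> x) (at x)"
    "Ck k W f'" "continuous_on W (\<lambda>(\<mu>, x). f \<mu> x)"
    unfolding Ck.simps(2) by blast
  have "(g \<mu> has_real_derivative f' \<mu> x) (at x)" if "(\<mu>, x) \<in> W" for \<mu> x
  proof (rule has_field_derivative_transform_within_open[OF f'(1)[OF that]])
    show "open {x. (\<mu>, x) \<in> W}" using os by (auto simp: open_slices_def)
  qed (use that Suc.prems in auto)
  moreover have "continuous_on W (\<lambda>(\<mu>, x). g \<mu> x)"
    by (rule continuous_on_eq[OF f'(3)]) (use Suc.prems in auto)
  ultimately show ?case using f'(2) by (intro Ck_SucI[of _ _ f'])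
qed

lemma Ck_param: "continuous_on W (\<lambda>(\<mu>, x). c \<mu>) \<Longrightarrow> Ck k W (\<lambda>\<mu> x. c \<mu>)"
proof -
  have z: "Ck k W (\<lambda>\<mu> x. 0)" for k
    by (induction k) (auto intro!: exI[of _ "\<lambda>\<mu> x. 0"])
  assume "continuous_on W (\<lambda>(\<mu>, x). c \<mu>)"
  then show ?thesis using z by (cases k) (auto intro!: exI[of _ "\<lambda>\<mu> x. 0"])
qed

lemma Ck_const: "Ck k W (\<lambda>\<mu> x. c)"
  by (rule Ck_param[of W "\<lambda>_. c"]) (auto simp: case_prod_beta)

lemma Ck_ident: "Ck k W (\<lambda>\<mu> x. x)"
proof -
  have "continuous_on W (\<lambda>(\<mu>, x). x)" by (auto simp: case_prod_beta intro!: continuous_intros)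
  then show ?thesis using Ck_const[of _ W 1] by (cases k) (auto intro!: exI[of _ "\<lambda>\<mu> x. 1"])
qed

lemma Ck_add: "Ck k W f \<Longrightarrow> Ck k W g \<Longrightarrow> Ck k W (\<lambda>\<mu> x. f \<mu> x + g \<mu> x)"
proof (induction k arbitrary: f g)
  case 0 then show ?case by (auto simp: case_prod_beta intro!: continuous_intros)
next
  case (Suc k)
  from Suc.prems obtain f' where f': "\<forall>\<mu> x. (\<mu>, x) \<in> W \<longrightarrow> (f \<mu> has_real_derivative f' \<mu> x) (at x)"
    "Ck k W f'" "continuous_on W (\<lambda>(\<mu>, x). f \<mu> x)"
    unfolding Ck.simps(2) by blast
  from Suc.prems obtain g' where g': "\<forall>\<mu> x. (\<mu>, x) \<in> W \<longrightarrow> (g \<mu> has_real_derivative g' \<mu> x) (at x)"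
    "Ck k W g'" "continuous_on W (\<lambda>(\<mu>, x). g \<mu> x)"
    unfolding Ck.simps(2) by blast
  show ?case
    by (rule Ck_SucI[of _ _ "\<lambda>\<mu> x. f' \<mu> x + g' \<mu> x"])
      (use f' g' Suc.IH in \<open>auto simp: case_prod_beta intro!: derivative_eq_intros continuous_intros\<close>)
qed

lemma Ck_mult: "Ck k W f \<Longrightarrow> Ck k W g \<Longrightarrow> Ck k W (\<lambda>\<mu> x. f \<mu> x * g \<mu> x)"
proof (induction k arbitrary: f g)
  case 0 then show ?case by (auto simp: case_prod_beta intro!: continuous_intros)
next
  case (Suc k)
  from Suc.prems obtain f' where f': "\<forall>\<mu> x. (\<mu>, x) \<in> W \<longrightarrow> (f \<mu> has_real_derivative f' \<mu> x) (at x)"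
    "Ck k W f'" "continuous_on W (\<lambda>(\<mu>, x). f \<mu> x)"
    unfolding Ck.simps(2) by blast
  from Suc.prems obtain g' where g': "\<forall>\<mu> x. (\<mu>, x) \<in> W \<longrightarrow> (g \<mu> has_real_derivative g' \<mu> x) (at x)"
    "Ck k W g'" "continuous_on W (\<lambda>(\<mu>, x). g \<mu> x)"
    unfolding Ck.simps(2) by blast
  have "Ck k W (\<lambda>\<mu> x. f' \<mu> x * g \<mu> x + f \<mu> x * g' \<mu> x)"
    using Ck_add[OF Suc.IH[OF f'(2) Ck_Suc_imp] Suc.IH[OF Ck_Suc_imp g'(2)]] Suc.prems by simp
  then show ?case
    by (rule Ck_SucI[of _ _ "\<lambda>\<mu> x. f' \<mu> x * g \<mu> x + f \<mu> x * g' \<mu> x", rotated])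
      (use f' g' in \<open>auto simp: case_prod_beta intro!: derivative_eq_intros continuous_intros\<close>)
qed

lemma Ck_compose:
  assumes "\<And>\<mu> x. (\<mu>, x) \<in> W' \<Longrightarrow> (\<mu>, g \<mu> x) \<in> W"
  shows "Ck k W f \<Longrightarrow> Ck k W' g \<Longrightarrow> Ck k W' (\<lambda>\<mu> x. f \<mu> (g \<mu> x))"
proof (induction k arbitrary: f)
  case 0
  have "continuous_on W' (\<lambda>p. (fst p, g (fst p) (snd p)))"
    using 0 by (auto simp: case_prod_beta intro!: continuous_intros)
  then have "continuous_on W' (\<lambda>p. (\<lambda>(\<mu>, x). f \<mu> x) (fst p, g (fst p) (snd p)))"
    using 0 assms by (intro continuous_on_compose2[of W "\<lambda>(\<mu>, x). f \<mu> x" W']) auto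
  then show ?case by (auto simp: case_prod_beta)
next
  case (Suc k)
  from Suc.prems obtain f' where f': "\<forall>\<mu> x. (\<mu>, x) \<in> W \<longrightarrow> (f \<mu> has_real_derivative f' \<mu> x) (at x)"
    "Ck k W f'" "continuous_on W (\<lambda>(\<mu>, x). f \<mu> x)"
    unfolding Ck.simps(2) by blast
  from Suc.prems obtain g' where g': "\<forall>\<mu> x. (\<mu>, x) \<in> W' \<longrightarrow> (g \<mu> has_real_derivative g' \<mu> x) (at x)"
    "Ck k W' g'" "continuous_on W' (\<lambda>(\<mu>, x). g \<mu> x)"
    unfolding Ck.simps(2) by blast
  have "Ck k W' (\<lambda>\<mu> x. f' \<mu> (g \<mu> x) * g' \<mu> x)"
    using Ck_mult[OF Suc.IH[OF f'(2) Ck_Suc_imp[OF Suc.prems(2)]] g'(2)] .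
  moreover have "continuous_on W' (\<lambda>(\<mu>, x). f \<mu> (g \<mu> x))"
    using Suc.IH[OF Ck_Suc_imp Ck_Suc_imp, OF Suc.prems] by (rule Ck_continuous)
  moreover have "((\<lambda>x. f \<mu> (g \<mu> x)) has_real_derivative f' \<mu> (g \<mu> x) * g' \<mu> x) (at x)"
    if "(\<mu>, x) \<in> W'" for \<mu> x
    using DERIV_chain2[of "f \<mu>" "f' \<mu> (g \<mu> x)" "g \<mu>" x "g' \<mu> x" UNIV] f'(1) g'(1) assms that by auto
  ultimately show ?case
    by (intro Ck_SucI[of _ _ "\<lambda>\<mu> x. f' \<mu> (g \<mu> x) * g' \<mu> x"])
qed

text \<open>The derivative is a polynomial in the function itself, so the induction hypothesis
  closes the step. The square root below works alike, its derivative being half its own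
  inverse.\<close>

lemma Ck_inverse_fun: "Ck k (UNIV \<times> (- {0})) (\<lambda>(\<mu>::'p::topological_space) x. inverse x)"
proof (induction k)
  case 0 show ?case by (auto simp: case_prod_beta intro!: continuous_intros)
next
  case (Suc k)
  have "Ck k (UNIV \<times> (- {0})) (\<lambda>(\<mu>::'p) x. - 1 * (inverse x * inverse x))"
    by (intro Ck_mult Ck_const Suc)
  then show ?case
    by (rule Ck_SucI[rotated])
      (auto simp: case_prod_beta power2_eq_square intro!: derivative_eq_intros continuous_intros)
qed

lemma Ck_inverse:
  assumes "Ck k W f" "\<And>\<mu> x. (\<mu>, x) \<in> W \<Longrightarrow> f \<mu> x \<noteq> 0"
  shows "Ck k W (\<lambda>\<mu> x. inverse (f \<mu> x))"
  by (rule Ck_compose[where f = "\<lambda>\<mu>. inverse", OF _ Ck_inverse_fun assms(1)]) (use assms(2) in auto)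

lemma Ck_sqrt_fun: "Ck k (UNIV \<times> {0<..}) (\<lambda>(\<mu>::'p::topological_space) x. sqrt x)"
proof (induction k)
  case 0 show ?case by (auto simp: case_prod_beta intro!: continuous_intros)
next
  case (Suc k)
  have "Ck k (UNIV \<times> {0<..}) (\<lambda>(\<mu>::'p) x. 1/2 * inverse (sqrt x))"
    by (intro Ck_mult Ck_const Ck_inverse Suc) auto
  then show ?case
    by (rule Ck_SucI[rotated])
      (auto simp: case_prod_beta field_simps intro!: derivative_eq_intros continuous_intros)
qed

lemma Ck_sqrt:
  assumes "Ck k W f" "\<And>\<mu> x. (\<mu>, x) \<in> W \<Longrightarrow> f \<mu> x > 0"
  shows "Ck k W (\<lambda>\<mu> x. sqrt (f \<mu> x))"
  by (rule Ck_compose[where f = "\<lambda>\<mu>. sqrt", OF _ Ck_sqrt_fun assms(1)]) (use assms(2) in auto)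

lemma Ck_deriv:
  assumes os: "open_slices W" and C: "Ck (Suc k) W f"
  shows "Ck k W (\<lambda>\<mu>. deriv (f \<mu>))"
    "(\<mu>, x) \<in> W \<Longrightarrow> (f \<mu> has_real_derivative deriv (f \<mu>) x) (at x)"
proof -
  from C obtain f' where f': "\<forall>\<mu> x. (\<mu>, x) \<in> W \<longrightarrow> (f \<mu> has_real_derivative f' \<mu> x) (at x)" "Ck k W f'"
    by auto
  have "f' \<mu> x = deriv (f \<mu>) x" if "(\<mu>, x) \<in> W" for \<mu> x
    using f'(1) that by (metis DERIV_imp_deriv)
  with f' show "Ck k W (\<lambda>\<mu>. deriv (f \<mu>))"
    "(\<mu>, x) \<in> W \<Longrightarrow> (f \<mu> has_real_derivative deriv (f \<mu>) x) (at x)"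
    using Ck_cong[OF os] by auto
qed

text \<open>Freezes the parameter and puts a dummy one of arbitrary type in its place; single
  functions then enjoy the calculus of families.\<close>

lemma Ck_slice: "Ck k W f \<Longrightarrow> Ck k (UNIV \<times> {x. (\<mu>, x) \<in> W}) (\<lambda>_::'q::topological_space. f \<mu>)"
proof (induction k arbitrary: f)
  have *: "continuous_on (UNIV \<times> {x. (\<mu>, x) \<in> W}) (\<lambda>(_::'q, x). f \<mu> x)"
    if "continuous_on W (\<lambda>(\<mu>, x). f \<mu> x)" for f :: "'a \<Rightarrow> real \<Rightarrow> real"
  proof -
    have "continuous_on (UNIV \<times> {x. (\<mu>, x) \<in> W}) (\<lambda>z::'q \<times> real. (\<lambda>(\<mu>, x). f \<mu> x) (\<mu>, snd z))"
      by (rule continuous_on_compose2[OF that]) (auto intro!: continuous_intros)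
    then show ?thesis by (simp add: case_prod_beta)
  qed
  { case 0 then show ?case using * by simp }
  case (Suc k)
  from Suc.prems obtain f' where f': "\<forall>\<mu> x. (\<mu>, x) \<in> W \<longrightarrow> (f \<mu> has_real_derivative f' \<mu> x) (at x)"
    "Ck k W f'" "continuous_on W (\<lambda>(\<mu>, x). f \<mu> x)"
    unfolding Ck.simps(2) by blast
  show ?case
    by (rule Ck_SucI[of _ _ "\<lambda>_. f' \<mu>"]) (use f' Suc.IH * in auto)
qed

text \<open>Differentiation under the integral sign. The weight \<open>q\<close> is arbitrary
  because each derivative in x turns it into \<open>s * q s\<close>.\<close>

lemma Ck_integral_scaled:
  assumes star: "\<And>\<mu> x s. (\<mu>, x) \<in> W \<Longrightarrow> 0 \<le> s \<Longrightarrow> s \<le> 1 \<Longrightarrow> (\<mu>, s * x) \<in> W"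
    and os: "open_slices W"
  shows "Ck k W f \<Longrightarrow> continuous_on {0..1} q \<Longrightarrow>
    Ck k W (\<lambda>\<mu> x. integral {0..1} (\<lambda>s. q s * f \<mu> (s * x)))"
proof (induction k arbitrary: f q)
  have *: "continuous_on (W \<times> cbox 0 1) (\<lambda>(p, s). q s * f (fst p) (s * snd p))"
    if f: "continuous_on W (\<lambda>(\<mu>, x). f \<mu> x)" and q: "continuous_on {0..1} q"
    for f :: "'a \<Rightarrow> real \<Rightarrow> real" and q
  proof -
    have "continuous_on (W \<times> {0..1}) (\<lambda>z. (\<lambda>(\<mu>, x). f \<mu> x) (fst (fst z), snd z * snd (fst z)))"
      by (rule continuous_on_compose2[OF f]) (auto intro!: continuous_intros star)
    moreover have "continuous_on (W \<times> {0..1}) (\<lambda>z. q (snd z))"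
      by (rule continuous_on_compose2[OF q]) (auto intro!: continuous_intros)
    ultimately show ?thesis by (auto simp: case_prod_beta intro!: continuous_intros)
  qed
  have **: "continuous_on W (\<lambda>(\<mu>, x). integral {0..1} (\<lambda>s. q s * f \<mu> (s * x)))"
    if "continuous_on W (\<lambda>(\<mu>, x). f \<mu> x)" "continuous_on {0..1} q" for f :: "'a \<Rightarrow> real \<Rightarrow> real" and q
    using integral_continuous_on_param[OF *[OF that]] by (simp add: case_prod_beta)
  { case 0 then show ?case using ** by simp }
  case (Suc k)
  from Suc.prems obtain f' where f': "\<And>\<mu> x. (\<mu>, x) \<in> W \<Longrightarrow> (f \<mu> has_real_derivative f' \<mu> x) (at x)"
    "Ck k W f'" "continuous_on W (\<lambda>(\<mu>, x). f \<mu> x)"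
    unfolding Ck.simps(2) by blast
  note c' = Ck_continuous[OF f'(2)]
  have sq: "continuous_on {0..1} (\<lambda>s. s * q s)" using Suc.prems by (intro continuous_intros)
  have "Ck k W (\<lambda>\<mu> x. integral {0..1} (\<lambda>s. (s * q s) * f' \<mu> (s * x)))"
    by (rule Suc.IH[OF f'(2) sq])
  moreover have "((\<lambda>x. integral {0..1} (\<lambda>s. q s * f \<mu> (s * x))) has_real_derivative
      integral {0..1} (\<lambda>s. (s * q s) * f' \<mu> (s * x0))) (at x0)" if "(\<mu>, x0) \<in> W" for \<mu> x0
  proof -
    have "open {x. (\<mu>, x) \<in> W}" "x0 \<in> {x. (\<mu>, x) \<in> W}"
      using os that by (auto simp: open_slices_def)
    then obtain e where e: "e > 0" "ball x0 e \<subseteq> {x. (\<mu>, x) \<in> W}"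
      by (rule openE)
    have sl: "(\<mu>, x) \<in> W" if "x \<in> ball x0 e" for x using e that by auto
    have "((\<lambda>x. integral (cbox 0 1) (\<lambda>s. q s * f \<mu> (s * x))) has_field_derivative
      integral (cbox 0 1) (\<lambda>s. (s * q s) * f' \<mu> (s * x0))) (at x0 within ball x0 e)"
    proof (rule leibniz_rule_field_derivative)
      fix x s :: real assume xs: "x \<in> ball x0 e" "s \<in> cbox 0 1"
      have "(f \<mu> has_real_derivative f' \<mu> (s * x)) (at (s * x))"
        using xs sl star by (intro f') auto
      then have "((\<lambda>x. f \<mu> (s * x)) has_real_derivative f' \<mu> (s * x) * s) (at x)"
        by (rule DERIV_chain2) (auto intro!: derivative_eq_intros)
      then have "((\<lambda>x. q s * f \<mu> (s * x)) has_real_derivative q s * (f' \<mu> (s * x) * s)) (at x)"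
        by (rule DERIV_cmult)
      then show "((\<lambda>x. q s * f \<mu> (s * x)) has_field_derivative s * q s * f' \<mu> (s * x)) (at x within ball x0 e)"
        by (simp add: has_field_derivative_at_within mult_ac)
    next
      fix x assume x: "x \<in> ball x0 e"
      have "continuous_on (cbox 0 1) (\<lambda>s. (\<lambda>(p, s). q s * f (fst p) (s * snd p)) ((\<mu>, x), s))"
        by (rule continuous_on_compose2[OF *[OF f'(3) Suc.prems(2)]])
          (use x sl in \<open>auto intro!: continuous_intros\<close>)
      then show "(\<lambda>s. q s * f \<mu> (s * x)) integrable_on cbox 0 1"
        by (intro integrable_continuous) auto
    next
      have "continuous_on (ball x0 e \<times> cbox 0 1) (\<lambda>z. (\<lambda>(p, s). s * q s * f' (fst p) (s * snd p)) ((\<mu>, fst z), snd z))"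
        by (rule continuous_on_compose2[OF *[OF c' sq]])
          (use sl in \<open>auto intro!: continuous_intros\<close>)
      then show "continuous_on (ball x0 e \<times> cbox 0 1) (\<lambda>(x, s). s * q s * f' \<mu> (s * x))"
        by (simp add: case_prod_beta)
    qed (use e in auto)
    then show ?thesis using e by (simp add: at_within_open[OF _ open_ball])
  qed
  ultimately show ?case
    using **[OF f'(3) Suc.prems(2)]
    by (intro Ck_SucI[of _ _ "\<lambda>\<mu> x. integral {0..1} (\<lambda>s. (s * q s) * f' \<mu> (s * x))"])
qed

text \<open>Bootstrapping: the derivative of the inverse is 1 / g' composed with the inverse, so k
  derivatives of the inverse yield one more. Continuity starts the process.\<close>

lemma Ck_inverse_function:
  assumes der: "\<And>\<mu> z. (\<mu>, z) \<in> Z \<Longrightarrow> (kf \<mu> has_real_derivative inverse (g' \<mu> (kf \<mu> z))) (at z)"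
    and pos: "\<And>\<mu> x. (\<mu>, x) \<in> W \<Longrightarrow> g' \<mu> x \<noteq> 0"
    and maps: "\<And>\<mu> z. (\<mu>, z) \<in> Z \<Longrightarrow> (\<mu>, kf \<mu> z) \<in> W"
    and cont: "continuous_on Z (\<lambda>(\<mu>, z). kf \<mu> z)"
  shows "(\<And>j. Ck j W g') \<Longrightarrow> Ck k Z kf"
proof (induction k)
  case 0 then show ?case using cont by simp
next
  case (Suc k)
  have "Ck k Z (\<lambda>\<mu> z. inverse (g' \<mu> (kf \<mu> z)))"
    using Suc maps pos by (intro Ck_inverse Ck_compose[of Z kf W k g']) auto
  with der cont show ?case by (intro Ck_SucI)
qed

section \<open>Uniqueness for potential systems\<close>

text \<open>The product \<open>f t * exp (- C * t)\<close> is nonincreasing and starts at 0.\<close>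

lemma gronwall_zero_right:
  fixes f f' :: "real \<Rightarrow> real"
  assumes "\<And>t. (f has_real_derivative f' t) (at t)" "\<And>t. 0 \<le> f t" "f 0 = 0"
    and "\<And>t. 0 \<le> t \<Longrightarrow> t \<le> b \<Longrightarrow> \<bar>f' t\<bar> \<le> C * f t" "0 \<le> t" "t \<le> b"
  shows "f t = 0"
proof -
  have "f t * exp (- C * t) \<le> f 0 * exp (- C * 0)"
  proof (rule DERIV_nonpos_imp_nonincreasing[OF assms(5)])
    fix x assume x: "0 \<le> x" "x \<le> t"
    have "((\<lambda>t. f t * exp (- C * t)) has_real_derivative (f' x - C * f x) * exp (- C * x)) (at x)"
      by (auto intro!: derivative_eq_intros assms(1) simp: algebra_simps)
    moreover have "f' x - C * f x \<le> 0" using assms(4)[of x] x assms(6) by linarith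
    then have "(f' x - C * f x) * exp (- C * x) \<le> 0" by (simp add: mult_nonpos_nonneg)
    ultimately show "\<exists>y. ((\<lambda>t. f t * exp (- C * t)) has_real_derivative y) (at x) \<and> y \<le> 0" by blast
  qed
  then have "f t \<le> 0" using assms(3) by (simp add: mult_le_0_iff)
  with assms(2)[of t] show ?thesis by simp
qed

lemma gronwall_zero:
  fixes f f' :: "real \<Rightarrow> real"
  assumes der: "\<And>t. (f has_real_derivative f' t) (at t)" and nn: "\<And>t. 0 \<le> f t" and z: "f 0 = 0"
    and bd: "\<And>t. \<bar>t\<bar> \<le> b \<Longrightarrow> \<bar>f' t\<bar> \<le> C * f t" and t: "\<bar>t\<bar> \<le> b"
  shows "f t = 0"
proof (cases "t \<ge> 0")
  case True
  then show ?thesis using assms by (intro gronwall_zero_right[of f f' b C t]) auto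
next
  case False
  have "((\<lambda>t. f (- t)) has_real_derivative - f' (- t)) (at t)" for t
    using DERIV_chain2[of f "f' (- t)" uminus t "-1" UNIV] DERIV_minus[OF DERIV_ident, of t] der[of "- t"] by simp
  then have "f (- (- t)) = 0"
    by (rule gronwall_zero_right[of "\<lambda>t. f (- t)" "\<lambda>t. - f' (- t)" b C "- t"])
      (use assms False in auto)
  then show ?thesis by simp
qed

text \<open>The scalar factor \<open>c\<close> allows two uses: c = 1 for solutions in time, and c =
  dt/d\<theta> for solutions followed along an angle. A local Lipschitz bound is enough, since over
  a bounded time both first coordinates stay in a compact subinterval of \<open>J\<close>.\<close>

lemma potential_ode_unique:
  fixes u v :: "real \<Rightarrow> real \<times> real" and c dV d2V :: "real \<Rightarrow> real"
  assumes J: "is_interval J"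
    and dV: "\<And>x. x \<in> J \<Longrightarrow> (dV has_real_derivative d2V x) (at x)" and d2V: "continuous_on J d2V"
    and c: "continuous_on UNIV c"
    and u: "\<And>t. (u has_vector_derivative c t *\<^sub>R (snd (u t), - dV (fst (u t)))) (at t)" "\<And>t. fst (u t) \<in> J"
    and v: "\<And>t. (v has_vector_derivative c t *\<^sub>R (snd (v t), - dV (fst (v t)))) (at t)" "\<And>t. fst (v t) \<in> J"
    and eq0: "u 0 = v 0"
  shows "u t = v t"
proof -
  define b where "b = \<bar>t\<bar>"
  have comp: "((\<lambda>t. fst (w t)) has_real_derivative c t * snd (w t)) (at t)"
      "((\<lambda>t. snd (w t)) has_real_derivative - c t * dV (fst (w t))) (at t)"
    if "(w has_vector_derivative c t *\<^sub>R (snd (w t), - dV (fst (w t)))) (at t)" for w t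
    using bounded_linear.has_vector_derivative[OF bounded_linear_fst that]
      bounded_linear.has_vector_derivative[OF bounded_linear_snd that]
    by (simp_all add: has_real_derivative_iff_has_vector_derivative)
  have contw: "continuous_on A (\<lambda>t. fst (w t))"
    if "\<And>t. (w has_vector_derivative c t *\<^sub>R (snd (w t), - dV (fst (w t)))) (at t)" for w A
    using comp(1)[OF that] by (meson DERIV_isCont continuous_at_imp_continuous_on)
  \<comment> \<open>The hull [l, r] of both projections lies in the interval \<open>J\<close>; on it
    \<open>d2V\<close> is bounded and hence \<open>dV\<close> is Lipschitz.\<close>
  define X where "X = (\<lambda>t. fst (u t)) ` {-b..b} \<union> (\<lambda>t. fst (v t)) ` {-b..b}"
  have X: "compact X" "X \<noteq> {}"
    unfolding X_def using contw[OF u(1)] contw[OF v(1)]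
    by (auto intro!: compact_Un compact_continuous_image simp: b_def)
  obtain l where l: "l \<in> X" "\<And>x. x \<in> X \<Longrightarrow> l \<le> x" using compact_attains_inf[OF X] by blast
  obtain r where r: "r \<in> X" "\<And>x. x \<in> X \<Longrightarrow> x \<le> r" using compact_attains_sup[OF X] by blast
  have XJ: "X \<subseteq> J" using u(2) v(2) by (auto simp: X_def)
  then have lr: "{l..r} \<subseteq> J" using l(1) r(1) J unfolding is_interval_1 by (meson atLeastAtMost_iff subset_iff)
  have "bounded (d2V ` {l..r})"
    by (intro compact_imp_bounded compact_continuous_image continuous_on_subset[OF d2V lr]) auto
  then obtain B where B: "B > 0" "\<And>x. x \<in> {l..r} \<Longrightarrow> \<bar>d2V x\<bar> \<le> B"
    unfolding bounded_pos by auto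
  have "bounded (c ` {-b..b})"
    by (intro compact_imp_bounded compact_continuous_image continuous_on_subset[OF c]) auto
  then obtain K where K: "K > 0" "\<And>x. x \<in> {-b..b} \<Longrightarrow> \<bar>c x\<bar> \<le> K"
    unfolding bounded_pos by auto
  have lip: "\<bar>dV x - dV y\<bar> \<le> B * \<bar>x - y\<bar>" if "x \<in> {l..r}" "y \<in> {l..r}" for x y
  proof -
    have "(dV has_real_derivative d2V z) (at z within {l..r})" if "z \<in> {l..r}" for z
      using dV lr that by (blast intro: has_field_derivative_at_within)
    then show ?thesis
      using field_differentiable_bound[of "{l..r}" dV d2V B x y] that B by auto
  qed
  define d where "d t = (fst (u t) - fst (v t))\<^sup>2 + (snd (u t) - snd (v t))\<^sup>2" for t
  define d' where "d' t = 2 * (fst (u t) - fst (v t)) * (c t * (snd (u t) - snd (v t)))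
      - 2 * (snd (u t) - snd (v t)) * (c t * (dV (fst (u t)) - dV (fst (v t))))" for t
  have "d t = 0"
  proof (rule gronwall_zero[of d d' b "K * (1 + B)"])
    show "(d has_real_derivative d' t) (at t)" for t
      unfolding d_def d'_def
      by (auto intro!: derivative_eq_intros comp u v simp: algebra_simps)
    show "0 \<le> d t" for t by (simp add: d_def)
    show "d 0 = 0" by (simp add: d_def eq0)
    show "\<bar>t\<bar> \<le> b" by (simp add: b_def)
    show "\<bar>d' t\<bar> \<le> K * (1 + B) * d t" if "\<bar>t\<bar> \<le> b" for t
    proof -
      define p q z where "p = fst (u t) - fst (v t)" "q = snd (u t) - snd (v t)"
        "z = dV (fst (u t)) - dV (fst (v t))"
      have "fst (u t) \<in> {l..r}" "fst (v t) \<in> {l..r}"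
        using that l(2) r(2) by (auto simp: X_def abs_le_iff)
      then have z: "\<bar>z\<bar> \<le> B * \<bar>p\<bar>" unfolding p_q_z_def by (rule lip)
      have ct: "\<bar>c t\<bar> \<le> K" using that by (intro K) auto
      have pq: "2 * (\<bar>p\<bar> * \<bar>q\<bar>) \<le> p\<^sup>2 + q\<^sup>2"
        using zero_le_power2[of "\<bar>p\<bar> - \<bar>q\<bar>"] by (simp add: power2_diff)
      have "\<bar>d' t\<bar> = \<bar>c t\<bar> * \<bar>2 * p * q - 2 * q * z\<bar>"
        unfolding d'_def p_q_z_def abs_mult[symmetric] by (simp add: algebra_simps)
      also have "\<dots> \<le> K * (2 * \<bar>p\<bar> * \<bar>q\<bar> + 2 * \<bar>q\<bar> * (B * \<bar>p\<bar>))"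
      proof (rule mult_mono[OF ct])
        have "\<bar>2 * p * q - 2 * q * z\<bar> \<le> \<bar>2 * p * q\<bar> + \<bar>2 * q * z\<bar>" by (rule abs_triangle_ineq4)
        also have "\<dots> = 2 * \<bar>p\<bar> * \<bar>q\<bar> + 2 * \<bar>q\<bar> * \<bar>z\<bar>" by (simp add: abs_mult)
        also have "\<dots> \<le> 2 * \<bar>p\<bar> * \<bar>q\<bar> + 2 * \<bar>q\<bar> * (B * \<bar>p\<bar>)"
          using z by (intro add_left_mono mult_left_mono) auto
        finally show "\<bar>2 * p * q - 2 * q * z\<bar> \<le> 2 * \<bar>p\<bar> * \<bar>q\<bar> + 2 * \<bar>q\<bar> * (B * \<bar>p\<bar>)" .
      qed (use K in auto)
      also have "\<dots> = K * (1 + B) * (2 * (\<bar>p\<bar> * \<bar>q\<bar>))" by (simp add: algebra_simps)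
      also have "\<dots> \<le> K * (1 + B) * (p\<^sup>2 + q\<^sup>2)"
        using pq K B by (intro mult_left_mono) auto
      finally show ?thesis by (simp add: d_def p_q_z_def)
    qed
  qed
  then have "(fst (u t) - fst (v t))\<^sup>2 = 0 \<and> (snd (u t) - snd (v t))\<^sup>2 = 0"
    unfolding d_def using sum_power2_eq_zero_iff by fastforce
  then show ?thesis by (simp add: prod_eq_iff)
qed

text \<open>The first point \<open>c\<close> with \<open>V' c \<le> 0\<close> would have to be the point provided for its own level \<open>V c\<close>.\<close>

lemma derivative_pos_from_levels:
  fixes V dV :: "real \<Rightarrow> real"
  assumes dV: "\<And>x. x \<in> {0..b0} \<Longrightarrow> (V has_real_derivative dV x) (at x)" and cdV: "continuous_on {0..b0} dV"
    and V0: "V 0 = 0" and e: "e > 0" and small: "\<And>x. 0 < x \<Longrightarrow> x < e \<Longrightarrow> dV x > 0"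
    and top: "\<And>x. 0 \<le> x \<Longrightarrow> x < b0 \<Longrightarrow> V x < V b0"
    and lev: "\<And>h. 0 < h \<Longrightarrow> h \<le> V b0 \<Longrightarrow> \<exists>b>0. V b = h \<and> (\<forall>x. 0 \<le> x \<and> x < b \<longrightarrow> V x < h) \<and> dV b > 0"
    and x: "0 < x" "x \<le> b0"
  shows "dV x > 0"
proof (rule ccontr)
  assume neg: "\<not> dV x > 0"
  define C where "C = {y \<in> {e..b0}. dV y \<le> 0}"
  have "C = {e..b0} \<inter> dV -` {..0}" by (auto simp: C_def)
  moreover have "closed ({e..b0} \<inter> dV -` {..0})"
    using e by (intro continuous_closed_preimage continuous_on_subset[OF cdV]) auto
  ultimately have "compact C"
    by (simp add: compact_eq_bounded_closed) (metis bounded_Int bounded_closed_interval)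
  moreover have "x \<in> C" using neg small[of x] x by (force simp: C_def)
  ultimately obtain c where c: "c \<in> C" "\<And>y. y \<in> C \<Longrightarrow> c \<le> y" using compact_attains_inf[of C] by blast
  have c0: "0 < c" "c \<le> b0" "dV c \<le> 0" using c(1) e by (auto simp: C_def)
  have pos: "dV y > 0" if "0 < y" "y < c" for y
    using c(2)[of y] small[of y] that c0 by (force simp: C_def)
  have mono: "V y < V c" if "0 \<le> y" "y < c" for y
  proof (rule DERIV_pos_imp_increasing_open[OF that(2)])
    show "\<exists>w. (V has_real_derivative w) (at z) \<and> w > 0" if "y < z" "z < c" for z
      using dV[of z] pos[of z] that c0 \<open>0 \<le> y\<close> by (intro exI[of _ "dV z"]) auto
    show "continuous_on {y..c} V"
    proof (intro continuous_at_imp_continuous_on ballI)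
      fix z assume "z \<in> {y..c}"
      then have "z \<in> {0..b0}" using that c0 by auto
      from dV[OF this] show "isCont V z" by (rule DERIV_isCont)
    qed
  qed
  have "0 < V c" using mono[of 0] V0 c0 by simp
  moreover have "V c \<le> V b0" using top[of c] c0 by (cases "c = b0") auto
  ultimately obtain b where b: "b > 0" "V b = V c" "\<And>x. 0 \<le> x \<Longrightarrow> x < b \<Longrightarrow> V x < V c" "dV b > 0"
    using lev[of "V c"] by blast
  have "b = c" using b(3)[of c] mono[of b] b c0 by force
  with b c0 show False by simp
qed

section \<open>Derivatives of real analytic functions\<close>

lemma real_analytic_deriv:
  assumes "real_analytic_on f S" "open S"
  shows "\<And>x. x \<in> S \<Longrightarrow> (f has_real_derivative deriv f x) (at x)" "real_analytic_on (deriv f) S"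
proof -
  \<comment> \<open>One radius serves both claims: on the whole interval of convergence the termwise
    derivative is the derivative, so the differentiated series represents \<open>deriv f\<close>
    there.\<close>
  have *: "\<exists>r>0. \<exists>c. \<forall>y. \<bar>y - x\<bar> < r \<longrightarrow> (f has_real_derivative deriv f y) (at y) \<and>
     (\<lambda>k. c k * (y - x) ^ k) sums deriv f y" if xS: "x \<in> S" for x
  proof -
    obtain r c where r: "r > 0" and c: "\<And>y. \<bar>y - x\<bar> < r \<Longrightarrow> (\<lambda>k. c k * (y - x) ^ k) sums f y"
      using bspec[OF assms(1)[unfolded real_analytic_on_def] xS] by metis
    have sm: "summable (\<lambda>n. c n * z ^ n)" if "norm z < r" for z
      using c[of "x + z"] that by (auto simp: sums_iff)
    have "(f has_real_derivative (\<Sum>n. diffs c n * (y - x) ^ n)) (at y) \<and>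
      (\<lambda>k. diffs c k * (y - x) ^ k) sums (\<Sum>n. diffs c n * (y - x) ^ n)" if y: "\<bar>y - x\<bar> < r" for y
    proof
      have "((\<lambda>z. \<Sum>n. c n * z ^ n) has_real_derivative (\<Sum>n. diffs c n * (y - x) ^ n)) (at (y - x))"
        by (rule termdiffs_strong'[of r]) (use sm y in auto)
      then have "((\<lambda>z. \<Sum>n. c n * (z - x) ^ n) has_real_derivative (\<Sum>n. diffs c n * (y - x) ^ n) * 1) (at y)"
        by (rule DERIV_chain2[where g = "\<lambda>z. z - x"]) (auto intro!: derivative_eq_intros)
      then have D: "((\<lambda>z. \<Sum>n. c n * (z - x) ^ n) has_real_derivative (\<Sum>n. diffs c n * (y - x) ^ n)) (at y)"
        by simp
      show "(f has_real_derivative (\<Sum>n. diffs c n * (y - x) ^ n)) (at y)"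
        by (rule has_field_derivative_transform_within_open[OF D, of "ball x r"])
          (use y c in \<open>auto simp: dist_real_def abs_minus_commute sums_iff\<close>)
      show "(\<lambda>k. diffs c k * (y - x) ^ k) sums (\<Sum>n. diffs c n * (y - x) ^ n)"
        using termdiff_converges[of "y - x" r c] sm y by (auto intro: summable_sums)
    qed
    with r show ?thesis by (metis DERIV_imp_deriv)
  qed
  show "\<And>x. x \<in> S \<Longrightarrow> (f has_real_derivative deriv f x) (at x)" using *
    by (metis abs_zero cancel_comm_monoid_add_class.diff_cancel)
  show "real_analytic_on (deriv f) S"
    unfolding real_analytic_on_def using * by blast
qed

lemma real_analytic_iterated_deriv:
  assumes "real_analytic_on f S" "open S" "x \<in> S"
  shows "((deriv ^^ k) f has_real_derivative (deriv ^^ Suc k) f x) (at x)"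
proof -
  have "real_analytic_on ((deriv ^^ k) f) S"
    by (induction k) (use assms real_analytic_deriv(2) in auto)
  from real_analytic_deriv(1)[OF this assms(2,3)] show ?thesis by simp
qed

section \<open>The period annulus\<close>

text \<open>Otherwise the ray from the origin in direction \<sigma> would be a connected unbounded
  set in the complement of \<gamma>, while the component of the origin is bounded.\<close>

lemma inside_meets_axis:
  fixes \<gamma> :: "(real \<times> real) set"
  assumes "(0, 0) \<in> inside \<gamma>" "\<sigma> \<noteq> 0"
  shows "\<exists>x>0. (\<sigma> * x, 0) \<in> \<gamma>"
proof (rule ccontr)
  assume no: "\<not> ?thesis"
  define R where "R = (\<lambda>x::real. (\<sigma> * x, 0::real)) ` {0..}"
  have n0: "(0, 0) \<notin> \<gamma>" and bd: "bounded (connected_component_set (- \<gamma>) (0, 0))"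
    using assms(1) by (auto simp: inside_def)
  have "R \<subseteq> - \<gamma>"
  proof
    fix p assume "p \<in> R"
    then obtain x where "p = (\<sigma> * x, 0)" "x \<ge> 0" by (auto simp: R_def)
    then show "p \<in> - \<gamma>" using no n0 by (cases "x = 0") auto
  qed
  moreover have "connected R"
    unfolding R_def by (intro connected_continuous_image continuous_intros) auto
  moreover have "(0, 0) \<in> R" by (auto simp: R_def intro!: image_eqI[of _ _ 0])
  ultimately have "R \<subseteq> connected_component_set (- \<gamma>) (0, 0)"
    by (intro connected_component_maximal)
  with bd have "bounded R" by (rule bounded_subset)
  then obtain B where B: "\<And>p. p \<in> R \<Longrightarrow> norm p \<le> B" unfolding bounded_iff by blast
  define x where "x = (\<bar>B\<bar> + 1) / \<bar>\<sigma>\<bar>"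
  have "x \<ge> 0" by (simp add: x_def)
  then have "(\<sigma> * x, 0) \<in> R" unfolding R_def by blast
  from B[OF this] have "\<bar>\<sigma> * x\<bar> \<le> B" by (simp add: norm_Pair)
  then show False using assms(2) by (simp add: x_def abs_mult)
qed

lemma solution_components:
  assumes "solution V J u"
  shows "((\<lambda>t. fst (u t)) has_real_derivative snd (u t)) (at t)"
    "((\<lambda>t. snd (u t)) has_real_derivative - deriv V (fst (u t))) (at t)"
    "fst (u t) \<in> J"
proof -
  have v: "(u has_vector_derivative (snd (u t), - deriv V (fst (u t)))) (at t)"
    using assms by (simp add: solution_def)
  show "((\<lambda>t. fst (u t)) has_real_derivative snd (u t)) (at t)"
    "((\<lambda>t. snd (u t)) has_real_derivative - deriv V (fst (u t))) (at t)"
    using bounded_linear.has_vector_derivative[OF bounded_linear_fst v]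
      bounded_linear.has_vector_derivative[OF bounded_linear_snd v]
    by (simp_all add: has_real_derivative_iff_has_vector_derivative)
  show "fst (u t) \<in> J" using assms by (simp add: solution_def)
qed

section \<open>Orbits of a single potential system\<close>

locale potential =
  fixes V :: "real \<Rightarrow> real" and J :: "real set"
  assumes cp: "center_potential V J"
begin

lemma J: "open J" "is_interval J" "0 \<in> J" and V0: "V 0 = 0" and dV0: "deriv V 0 = 0"
  and d2V0: "deriv (deriv V) 0 > 0" and an: "real_analytic_on V J"
  using cp by (auto simp: center_potential_def numeral_2_eq_2)

lemma V_der: "x \<in> J \<Longrightarrow> (V has_real_derivative deriv V x) (at x)"
  and dV_der: "x \<in> J \<Longrightarrow> (deriv V has_real_derivative deriv (deriv V) x) (at x)"
  and d2V_der: "x \<in> J \<Longrightarrow> (deriv (deriv V) has_real_derivative deriv (deriv (deriv V)) x) (at x)"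
  using real_analytic_iterated_deriv[OF an J(1), of x 0] real_analytic_iterated_deriv[OF an J(1), of x 1]
    real_analytic_iterated_deriv[OF an J(1), of x 2]
  by (auto simp: numeral_2_eq_2)

lemma V_cont: "continuous_on J V" and dV_cont: "continuous_on J (deriv V)"
  and d2V_cont: "continuous_on J (deriv (deriv V))"
  using V_der dV_der d2V_der by (meson DERIV_isCont continuous_at_imp_continuous_on)+

lemma energy_constant:
  assumes "solution V J u"
  shows "energy V (u t) = energy V (u s)"
proof -
  note c = solution_components[OF assms]
  have "((\<lambda>t. energy V (u t)) has_real_derivative 0) (at t)" for t
  proof -
    have "((\<lambda>t. V (fst (u t))) has_real_derivative deriv V (fst (u t)) * snd (u t)) (at t)"
      by (rule DERIV_chain2[OF V_der c(1)]) (rule c(3))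
    then have "((\<lambda>t. (snd (u t))\<^sup>2 / 2 + V (fst (u t))) has_real_derivative 0) (at t)"
      by (auto intro!: derivative_eq_intros c)
    then show ?thesis by (simp add: energy_def case_prod_beta)
  qed
  then show ?thesis using DERIV_isconst_all by blast
qed

lemma solution_unique:
  assumes "solution V J u" "solution V J v" "u 0 = v 0"
  shows "u = v"
proof
  fix t show "u t = v t"
    by (rule potential_ode_unique[of J "deriv V" "deriv (deriv V)" "\<lambda>_. 1" u v t])
      (use assms J dV_der d2V_cont in \<open>auto simp: solution_def\<close>)
qed

lemma solution_shift: "solution V J u \<Longrightarrow> solution V J (\<lambda>t. u (t + s))"
  unfolding solution_def
proof (intro allI conjI)
  fix t
  assume *: "\<forall>t. fst (u t) \<in> J \<and> (u has_vector_derivative (snd (u t), - deriv V (fst (u t)))) (at t)"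
  show "fst (u (t + s)) \<in> J" using * by blast
  have "((\<lambda>t. t + s) has_vector_derivative 1) (at t)"
    by (auto intro!: derivative_eq_intros)
  from vector_diff_chain_at[OF this, of u "(snd (u (t + s)), - deriv V (fst (u (t + s))))"] *
  show "((\<lambda>t. u (t + s)) has_vector_derivative (snd (u (t + s)), - deriv V (fst (u (t + s))))) (at t)"
    by (simp add: o_def)
qed

text \<open>A zero of V' at (x, 0) would make the constant solution and the periodic one coincide,
  by uniqueness.\<close>

lemma no_equilibrium_on_orbit:
  assumes "periodic_solution V J u" "u t = (x, 0)"
  shows "deriv V x \<noteq> 0"
proof
  assume z: "deriv V x = 0"
  have s: "solution V J u" using assms by (simp add: periodic_solution_def)
  have xJ: "x \<in> J" using solution_components(3)[OF s, of t] assms(2) by simp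
  have "solution V J (\<lambda>_. (x, 0))"
    unfolding solution_def using xJ z by (auto simp: zero_prod_def[symmetric])
  from solution_unique[OF solution_shift[OF s, of t] this] assms(2)
  have "u (s + t) = (x, 0)" for s by (metis add_0)
  from this[of "_ - t"] have "u s = (x, 0)" for s by simp
  then show False using assms(1) by (simp add: periodic_solution_def)
qed

lemma crossing_upwards:
  assumes s: "solution V J u" and ab: "a < 0" "0 < b" "fst (u ta) = a" "fst (u tb) = b" "ta \<le> tb"
    and e: "energy V (u 0) = h"
  shows "(0, sqrt (2 * h)) \<in> range u"
proof -
  note c = solution_components[OF s]
  have cont: "continuous_on A (\<lambda>t. fst (u t))" for A
    using c(1) by (meson DERIV_isCont continuous_at_imp_continuous_on)
  \<comment> \<open>At the last zero of x(t) before \<open>tb\<close> the velocity cannot be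
    negative, since x is positive afterwards. This selects the root + sqrt (2 h) of the energy
    equation.\<close>
  define Z where "Z = {ta..tb} \<inter> (\<lambda>t. fst (u t)) -` {0}"
  have "closed Z" unfolding Z_def by (intro continuous_closed_preimage cont) auto
  then have "compact Z"
    unfolding compact_eq_bounded_closed by (auto simp: Z_def intro: bounded_Int)
  moreover have "\<exists>t. ta \<le> t \<and> t \<le> tb \<and> fst (u t) = 0"
    using IVT'[of "\<lambda>t. fst (u t)" ta 0 tb] ab cont by auto
  then have "Z \<noteq> {}" by (auto simp: Z_def)
  ultimately obtain t0 where t0: "t0 \<in> Z" "\<And>t. t \<in> Z \<Longrightarrow> t \<le> t0"
    using compact_attains_sup[of Z] by metis
  have t0': "ta \<le> t0" "t0 \<le> tb" "fst (u t0) = 0" using t0(1) by (auto simp: Z_def)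
  with ab have "t0 < tb" by (cases "t0 = tb") auto
  have pos: "fst (u t) > 0" if tt: "t0 < t" "t \<le> tb" for t
  proof (rule ccontr)
    assume "\<not> fst (u t) > 0"
    then obtain t' where "t \<le> t'" "t' \<le> tb" "fst (u t') = 0"
      using IVT'[of "\<lambda>t. fst (u t)" t 0 tb] ab cont tt by auto
    then show False using t0(2)[of t'] tt t0' by (auto simp: Z_def)
  qed
  have "snd (u t0) \<ge> 0"
  proof (rule ccontr)
    assume "\<not> snd (u t0) \<ge> 0"
    then obtain d where d: "d > 0" "\<And>h. h > 0 \<Longrightarrow> h < d \<Longrightarrow> fst (u (t0 + h)) < fst (u t0)"
      using DERIV_neg_dec_right[OF c(1)[of t0]] by auto
    define h where "h = min (d / 2) (tb - t0)"
    have "0 < h" "h < d" "t0 + h \<le> tb" using d \<open>t0 < tb\<close> by (auto simp: h_def min_def)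
    then show False using d(2)[of h] pos[of "t0 + h"] t0' by simp
  qed
  moreover have "(snd (u t0))\<^sup>2 / 2 = h"
    using energy_constant[OF s, of t0 0] e t0' V0 by (simp add: energy_def case_prod_beta)
  ultimately have "snd (u t0) = sqrt (2 * h)" by (metis field_sum_of_halves mult_2 real_sqrt_unique)
  with t0' have "u t0 = (0, sqrt (2 * h))" by (simp add: prod_eq_iff)
  then show ?thesis by (metis rangeI)
qed

text \<open>The projection of the orbit is an interval on which V \<le> h. An interior point with V
  = h would be a local maximum of V, hence an equilibrium lying on the orbit. So V < h inside, the
  two points on the axis are the ends of the projection, and V' does not vanish there.\<close>

lemma orbit_shape:
  assumes ps: "periodic_solution V J u" and ins: "(0, 0) \<in> inside (range u)" and h: "h = energy V (u 0)"
  obtains a b where "a < 0" "0 < b" "{a..b} \<subseteq> J" "V a = h" "V b = h" "\<And>x. a < x \<Longrightarrow> x < b \<Longrightarrow> V x < h"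
    "deriv V b > 0" "deriv V a < 0" "\<And>t. a \<le> fst (u t)" "\<And>t. fst (u t) \<le> b"
    "(a, 0) \<in> range u" "(b, 0) \<in> range u" "(0, sqrt (2 * h)) \<in> range u"
proof -
  have s: "solution V J u" using ps by (simp add: periodic_solution_def)
  note c = solution_components[OF s]
  have cont: "continuous_on A (\<lambda>t. fst (u t))" for A
    using c(1) by (meson DERIV_isCont continuous_at_imp_continuous_on)
  have en: "(snd (u t))\<^sup>2 / 2 + V (fst (u t)) = h" for t
    using energy_constant[OF s, of t 0] h by (simp add: energy_def case_prod_beta)
  obtain b where b: "b > 0" "(b, 0) \<in> range u" using inside_meets_axis[OF ins, of 1] by auto
  obtain a where a: "a < 0" "(a, 0) \<in> range u"
    using inside_meets_axis[OF ins, of "-1"] by (metis mult_minus1 neg_less_0_iff_less zero_neq_neg_one)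
  obtain tb where tb: "u tb = (b, 0)" using b by auto
  obtain ta where ta: "u ta = (a, 0)" using a by auto
  define X where "X = range (\<lambda>t. fst (u t))"
  have "connected X" unfolding X_def by (intro connected_continuous_image cont) auto
  moreover have "a \<in> X" "b \<in> X" unfolding X_def using ta tb by (metis fst_conv rangeI)+
  ultimately have abX: "{a..b} \<subseteq> X" by (rule connected_contains_Icc)
  have XJ: "X \<subseteq> J" using c(3) by (auto simp: X_def)
  have VX: "V x \<le> h" if xX: "x \<in> X" for x
  proof -
    obtain t where t: "x = fst (u t)" using xX by (auto simp: X_def)
    show ?thesis using en[of t] zero_le_power2[of "snd (u t)"] unfolding t by linarith
  qed
  have ne: "deriv V x \<noteq> 0" if xX: "x \<in> X" "V x = h" for x
  proof -
    obtain t where t: "x = fst (u t)" using xX(1) by (auto simp: X_def)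
    then have "snd (u t) = 0" using en[of t] xX by simp
    with t have "u t = (x, 0)" by (simp add: prod_eq_iff)
    from no_equilibrium_on_orbit[OF ps this] show ?thesis .
  qed
  have interior: "V x < h" if "l < x" "x < r" "{l..r} \<subseteq> X" for l x r
  proof (rule ccontr)
    assume "\<not> V x < h"
    moreover have xX: "x \<in> X" using that by auto
    ultimately have Vx: "V x = h" using VX[OF xX] by simp
    have "deriv V x = 0"
    proof (rule DERIV_local_max[OF V_der, of x "min (x - l) (r - x)"])
      show "x \<in> J" using xX XJ by blast
      show "0 < min (x - l) (r - x)" using that by simp
      show "\<forall>y. \<bar>x - y\<bar> < min (x - l) (r - x) \<longrightarrow> V y \<le> V x"
      proof (intro allI impI)
        fix y assume "\<bar>x - y\<bar> < min (x - l) (r - x)"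
        then have "y \<in> {l..r}" by auto
        then show "V y \<le> V x" using VX Vx that by auto
      qed
    qed
    with ne[OF xX Vx] show False by simp
  qed
  have Vb: "V b = h" and Va: "V a = h" using en[of tb] en[of ta] tb ta by auto
  have bmax: "fst (u t) \<le> b" for t
  proof (rule ccontr)
    assume "\<not> fst (u t) \<le> b"
    moreover have "{a..fst (u t)} \<subseteq> X"
      by (rule connected_contains_Icc[OF \<open>connected X\<close> \<open>a \<in> X\<close>]) (auto simp: X_def)
    ultimately have "V b < h" using a b by (intro interior[of a b "fst (u t)"]) auto
    with Vb show False by simp
  qed
  have amin: "a \<le> fst (u t)" for t
  proof (rule ccontr)
    assume "\<not> a \<le> fst (u t)"
    moreover have "{fst (u t)..b} \<subseteq> X"
      by (rule connected_contains_Icc[OF \<open>connected X\<close> _ \<open>b \<in> X\<close>]) (auto simp: X_def)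
    ultimately have "V a < h" using a b by (intro interior[of "fst (u t)" a b]) auto
    with Va show False by simp
  qed
  have in1: "V x < h" if "a < x" "x < b" for x using interior[OF that abX] .
  have "b \<in> J" "a \<in> J" using \<open>a \<in> X\<close> \<open>b \<in> X\<close> XJ by auto
  have "\<not> deriv V b < 0"
  proof
    assume "deriv V b < 0"
    from DERIV_neg_dec_left[OF V_der[OF \<open>b \<in> J\<close>] this]
    obtain d where d: "d > 0" "\<And>k. k > 0 \<Longrightarrow> k < d \<Longrightarrow> V b < V (b - k)" by blast
    define k where "k = min (d / 2) b"
    have "0 < k" "k < d" "a < b - k" "b - k < b" using d a b by (auto simp: k_def min_def)
    then show False using d(2)[of k] in1[of "b - k"] Vb by simp
  qed
  moreover have "\<not> deriv V a > 0"
  proof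
    assume "deriv V a > 0"
    from DERIV_pos_inc_right[OF V_der[OF \<open>a \<in> J\<close>] this]
    obtain d where d: "d > 0" "\<And>k. k > 0 \<Longrightarrow> k < d \<Longrightarrow> V a < V (a + k)" by blast
    define k where "k = min (d / 2) (- a)"
    have "0 < k" "k < d" "a < a + k" "a + k < b" using d a b by (auto simp: k_def min_def)
    then show False using d(2)[of k] in1[of "a + k"] Va by simp
  qed
  ultimately have "deriv V b > 0" "deriv V a < 0"
    using ne[OF \<open>a \<in> X\<close> Va] ne[OF \<open>b \<in> X\<close> Vb] by auto
  moreover have "(0, sqrt (2 * h)) \<in> range u"
  proof -
    \<comment> \<open>Adding periods moves the passage through \<open>b\<close> behind the one
      through \<open>a\<close>, as \<open>crossing_upwards\<close> requires.\<close>
    obtain T where T: "T > 0" "\<And>t. u (t + T) = u t" using ps by (auto simp: periodic_solution_def)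
    have per: "u (t + real n * T) = u t" for t n
    proof (induction n)
      case (Suc n)
      have "u (t + real (Suc n) * T) = u (t + real n * T + T)" by (simp add: algebra_simps)
      with Suc T(2) show ?case by simp
    qed simp
    obtain n where n: "ta - tb < real n * T" using reals_Archimedean3[OF T(1)] by blast
    show ?thesis
    proof (rule crossing_upwards[OF s a(1) b(1), of ta "tb + real n * T"])
      show "fst (u (tb + real n * T)) = b" by (simp add: per tb)
    qed (use ta n h in auto)
  qed
  ultimately show thesis using that[of a b] a b Va Vb in1 bmax amin abX XJ by blast
qed

end

section \<open>The period annulus of a center with finite outer energy\<close>

locale annulus = potential +
  fixes h0 :: real
  assumes h0: "outer_energy V J = ereal h0"
begin

abbreviation "P \<equiv> period_annulus V J"

definition I :: "real set" where
  "I = {x. x_left V J < ereal x \<and> ereal x < x_right V J}"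

lemma annulus_orbit:
  assumes "p \<in> P"
  shows "\<exists>u. periodic_solution V J u \<and> p \<in> range u \<and> range u \<subseteq> P \<and> (0, 0) \<in> inside (range u)"
proof -
  obtain A where A: "(0, 0) \<notin> A" "open (insert (0, 0) A)" "connected (insert (0, 0) A)"
    "\<forall>p\<in>A. \<exists>\<gamma>. periodic_orbit V J \<gamma> \<and> p \<in> \<gamma> \<and> \<gamma> \<subseteq> A \<and> (0, 0) \<in> inside \<gamma>" "p \<in> A"
    using assms unfolding period_annulus_def by blast
  then have "A \<subseteq> P" unfolding period_annulus_def by blast
  with A(4,5) show ?thesis unfolding periodic_orbit_def by (metis subset_trans)
qed

text \<open>The supremum over an empty annulus would be -\<infinity>. Nonemptiness makes the family
  in the next proof nonempty, so that adjoining the origin commutes with its union.\<close>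

lemma annulus_nonempty: "P \<noteq> {}"
  using h0 by (auto simp: outer_energy_def bot_ereal_def)

lemma annulus_open: "open (insert (0, 0) P)" and annulus_connected: "connected (insert (0, 0) P)"
  and zero_notin_annulus: "(0, 0) \<notin> P"
proof -
  define F where "F = {A. (0, 0) \<notin> A \<and> open (insert (0, 0) A) \<and> connected (insert (0, 0) A) \<and>
          (\<forall>p\<in>A. \<exists>\<gamma>. periodic_orbit V J \<gamma> \<and> p \<in> \<gamma> \<and> \<gamma> \<subseteq> A \<and> (0, 0) \<in> inside \<gamma>)}"
  have PF: "P = \<Union>F" by (simp add: period_annulus_def F_def)
  with annulus_nonempty have "F \<noteq> {}" by auto
  then have Q: "insert (0, 0) P = (\<Union>A\<in>F. insert (0, 0) A)" unfolding PF by blast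
  show "open (insert (0, 0) P)" unfolding Q by (rule open_UN) (simp add: F_def)
  show "connected (insert (0, 0) P)" unfolding Q
    by (rule connected_Union) (auto simp: F_def)
  show "(0, 0) \<notin> P" unfolding PF by (auto simp: F_def)
qed

lemma point_shape:
  assumes "p \<in> P"
  obtains a b where "a < 0" "0 < b" "{a..b} \<subseteq> J" "V a = energy V p" "V b = energy V p"
    "\<And>x. a < x \<Longrightarrow> x < b \<Longrightarrow> V x < energy V p"
    "deriv V b > 0" "deriv V a < 0" "a \<le> fst p" "fst p \<le> b"
    "(a, 0) \<in> P" "(b, 0) \<in> P"
proof -
  obtain u where u: "periodic_solution V J u" "p \<in> range u" "range u \<subseteq> P" "(0, 0) \<in> inside (range u)"
    using annulus_orbit[OF assms] by blast
  obtain t where t: "p = u t" using u(2) by blast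
  have s: "solution V J u" using u(1) by (simp add: periodic_solution_def)
  have e: "energy V p = energy V (u 0)" unfolding t by (rule energy_constant[OF s])
  show thesis
    by (rule orbit_shape[OF u(1,4) e]) (rule that, use u(3) t in auto)
qed

lemma annulus_subset: "insert (0, 0) P \<subseteq> J \<times> UNIV"
proof
  fix p assume "p \<in> insert (0, 0) P"
  then consider "p = (0, 0)" | "p \<in> P" by blast
  then have "fst p \<in> J"
  proof cases
    case 2 then show ?thesis by (rule point_shape) auto
  qed (use J in auto)
  then show "p \<in> J \<times> UNIV" by (simp add: mem_Times_iff)
qed

lemma energy_pos: "p \<in> P \<Longrightarrow> 0 < energy V p"
  by (erule point_shape) (use V0 in force)

text \<open>Moving a point vertically away from the x-axis raises its energy and, for a small step,
  stays in the open annulus; so the supremum is not attained.\<close>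

lemma energy_less: 
  assumes "p \<in> P" shows "energy V p < h0"
proof -
  obtain e where e: "e > 0" "ball p e \<subseteq> insert (0, 0) P" 
    using annulus_open assms openE by (metis insertI2)
  define q where "q = (fst p, if snd p \<ge> 0 then snd p + e / 2 else snd p - e / 2)"
  have "dist p q = e / 2"
    using e(1) by (cases p) (auto simp: q_def dist_Pair_Pair dist_real_def real_sqrt_abs)
  then have "q \<in> ball p e" using e(1) by simp
  then have "q \<in> insert (0, 0) P" using e(2) by blast
  moreover have *: "energy V p < energy V q"
  proof -
    have "\<bar>snd p\<bar> < \<bar>snd q\<bar>" using e(1) by (auto simp: q_def)
    then have "(snd p)\<^sup>2 < (snd q)\<^sup>2" by (meson abs_le_square_iff not_le)
    then show ?thesis by (simp add: energy_def case_prod_beta) (simp add: q_def)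
  qed
  moreover have "q \<noteq> (0, 0)"
    using * energy_pos[OF assms] V0 by (auto simp: energy_def)
  ultimately have "q \<in> P" by blast
  then have "ereal (energy V q) \<le> outer_energy V J"
    unfolding outer_energy_def by (rule SUP_upper)
  with * h0 show ?thesis by simp
qed

lemma h0_pos: "h0 > 0"
  using annulus_nonempty energy_pos energy_less by (metis ex_in_conv less_trans)

text \<open>The annulus together with the origin is connected, and the origin has energy 0.\<close>

lemma energy_attained:
  assumes "0 < h" "h < h0" shows "\<exists>p\<in>P. energy V p = h"
proof -
  have "ereal h < (SUP p\<in>P. ereal (energy V p))"
    using assms h0 by (simp add: outer_energy_def)
  then obtain p where p: "p \<in> P" "h < energy V p" by (auto simp: less_SUP_iff)
  have "continuous_on (J \<times> UNIV) (energy V)"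
    unfolding energy_def case_prod_beta
    by (intro continuous_intros continuous_on_compose2[OF V_cont]) auto
  then have "connected (energy V ` insert (0, 0) P)"
    by (intro connected_continuous_image annulus_connected) (use annulus_subset continuous_on_subset in blast)
  moreover have "energy V (0, 0) = 0" by (simp add: energy_def V0)
  then have "0 \<in> energy V ` insert (0, 0) P" by (metis image_eqI insertI1)
  ultimately have "{0..energy V p} \<subseteq> energy V ` insert (0, 0) P"
    using p(1) by (intro connected_contains_Icc) auto
  then have "h \<in> energy V ` insert (0, 0) P" using assms p by (meson atLeastAtMost_iff less_imp_le subsetD)
  with \<open>energy V (0, 0) = 0\<close> assms show ?thesis by auto
qed

lemma levels:
  assumes "0 < h" "h < h0"
  obtains a b where "a < 0" "0 < b" "{a..b} \<subseteq> J" "V a = h" "V b = h"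
    "\<And>x. a < x \<Longrightarrow> x < b \<Longrightarrow> V x < h"
    "deriv V b > 0" "deriv V a < 0" "(a, 0) \<in> P" "(b, 0) \<in> P"
proof -
  obtain p where p: "p \<in> P" "energy V p = h" using energy_attained[OF assms] by blast
  show thesis by (rule point_shape[OF p(1)], unfold p(2)) (rule that)
qed

text \<open>Near 0 the slope is positive because V''(0) > 0. Further out
  \<open>derivative_pos_from_levels\<close> applies: each level in (0, V b] is carried by an orbit
  of the annulus, whose right end has positive slope.\<close>

lemma slopes:
  assumes "0 < b" "{0..b} \<subseteq> J" "\<And>x. 0 \<le> x \<Longrightarrow> x < b \<Longrightarrow> V x < V b" "V b < h0" "0 < x" "x \<le> b"
  shows "deriv V x > 0"
proof -
  obtain e where e: "e > 0" "\<And>y. 0 < y \<Longrightarrow> y < e \<Longrightarrow> deriv V 0 < deriv V (0 + y)"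
    using DERIV_pos_inc_right[OF dV_der[OF J(3)] d2V0] by blast
  show ?thesis
  proof (rule derivative_pos_from_levels[of b V "deriv V" e])
    show "(V has_real_derivative deriv V x) (at x)" if "x \<in> {0..b}" for x using that assms(2) by (intro V_der) auto
    show "continuous_on {0..b} (deriv V)" using dV_cont assms(2) continuous_on_subset by blast
    show "0 < deriv V x" if "0 < x" "x < e" for x using e(2)[of x] that dV0 by simp
    show "\<exists>b>0. V b = h \<and> (\<forall>x. 0 \<le> x \<and> x < b \<longrightarrow> V x < h) \<and> 0 < deriv V b" if h: "0 < h" "h \<le> V b" for h
    proof -
      have "h < h0" using h assms(4) by simp
      from levels[OF h(1) this] obtain a b where "a < 0" "0 < b" "V b = h"
        "\<And>x. a < x \<Longrightarrow> x < b \<Longrightarrow> V x < h" "deriv V b > 0" by metis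
      then show ?thesis by (intro exI[of _ b]) auto
    qed
  qed (use assms e V0 in auto)
qed

text \<open>Reflection in the origin; now the left ends of the orbits supply the levels.\<close>

lemma slopes_left:
  assumes "a < 0" "{a..0} \<subseteq> J" "\<And>x. x \<le> 0 \<Longrightarrow> a < x \<Longrightarrow> V x < V a" "V a < h0" "x < 0" "a \<le> x"
  shows "deriv V x < 0"
proof -
  obtain e where e: "e > 0" "\<And>y. 0 < y \<Longrightarrow> y < e \<Longrightarrow> deriv V (0 - y) < deriv V 0"
    using DERIV_pos_inc_left[OF dV_der[OF J(3)] d2V0] by blast
  have "- deriv V (- (- x)) > 0"
  proof (rule derivative_pos_from_levels[of "- a" "\<lambda>x. V (- x)" "\<lambda>x. - deriv V (- x)" e])
    show "((\<lambda>x. V (- x)) has_real_derivative - deriv V (- x)) (at x)" if "x \<in> {0..- a}" for x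
    proof -
      have "(V has_real_derivative deriv V (- x)) (at (- x))" using that assms(2) by (intro V_der) auto
      from DERIV_chain2[of V _ uminus, OF this DERIV_minus[OF DERIV_ident]] show ?thesis by simp
    qed
    show "continuous_on {0..- a} (\<lambda>x. - deriv V (- x))"
      using assms(2) by (intro continuous_intros continuous_on_compose2[OF dV_cont]) auto
    show "0 < - deriv V (- x)" if "0 < x" "x < e" for x using e(2)[of x] that dV0 by simp
    show "\<exists>b>0. V (- b) = h \<and> (\<forall>x. 0 \<le> x \<and> x < b \<longrightarrow> V (- x) < h) \<and> 0 < - deriv V (- b)"
      if h: "0 < h" "h \<le> V (- (- a))" for h
    proof -
      have "h < h0" using h assms(4) by simp
      from levels[OF h(1) this] obtain a b where "a < 0" "0 < b" "V a = h"
        "\<And>x. a < x \<Longrightarrow> x < b \<Longrightarrow> V x < h" "deriv V a < 0" by metis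
      then show ?thesis by (intro exI[of _ "- a"]) auto
    qed
  qed (use assms e V0 in auto)
  then show ?thesis by simp
qed

text \<open>Openness of the annulus leaves room e / 2 on both sides of each point, so the projection
  does not attain its extremes.\<close>

lemma I_zero: "0 \<in> I" and axis_in_I: "(x, 0) \<in> P \<Longrightarrow> x \<in> I"
proof -
  have r: "ereal x < x_right V J" "x_left V J < ereal x" if xy: "(x, y) \<in> P" for x y
  proof -
    obtain e where e: "e > 0" "ball (x, y) e \<subseteq> insert (0, 0) P" 
      using annulus_open xy openE by (metis insertI2)
    have "dist (x, y) (x + e / 2, y) < e" "dist (x, y) (x - e / 2, y) < e"
      using e(1) by (auto simp: dist_Pair_Pair dist_real_def)
    then have q: "(x + e / 2, y) \<in> insert (0, 0) P" "(x - e / 2, y) \<in> insert (0, 0) P" using e by auto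
    have "ereal (fst (x + e / 2, y)) \<le> x_right V J" unfolding x_right_def by (rule SUP_upper[OF q(1)])
    then show "ereal x < x_right V J" using e(1) less_le_trans[of "ereal x" "ereal (x + e / 2)"] by simp
    have "x_left V J \<le> ereal (fst (x - e / 2, y))" unfolding x_left_def by (rule INF_lower[OF q(2)])
    then show "x_left V J < ereal x" using e(1) le_less_trans[of _ "ereal (x - e / 2)" "ereal x"] by simp
  qed
  show "x \<in> I" if "(x, 0) \<in> P" using r[OF that] by (simp add: I_def)
  obtain p where "p \<in> P" using annulus_nonempty by blast
  then obtain a b where "a < 0" "0 < b" "(a, 0) \<in> P" "(b, 0) \<in> P" by (rule point_shape)
  then have "x_left V J < ereal 0" "ereal 0 < x_right V J"
    using r(2)[of a 0] r(1)[of b 0] less_trans[of "x_left V J" "ereal a" "ereal 0"]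
      less_trans[of "ereal 0" "ereal b" "x_right V J"] by simp_all
  then show "0 \<in> I" by (simp add: I_def)
qed

text \<open>Some point of the annulus lies further right than x. The projection of its orbit
  contains x, and V is below the energy of that orbit there.\<close>

lemma I_pos:
  assumes "x \<in> I" "x > 0"
  shows "x \<in> J" "V x < h0" "deriv V x > 0"
proof -
  obtain p where p: "p \<in> insert (0, 0) P" "x < fst p"
    using assms unfolding I_def x_right_def less_SUP_iff by auto
  with assms have "p \<in> P" by auto
  from point_shape[OF this] obtain a b where ab: "a < 0" "0 < b" "{a..b} \<subseteq> J" "V b = energy V p"
    "\<And>x. a < x \<Longrightarrow> x < b \<Longrightarrow> V x < energy V p" "fst p \<le> b" by metis
  have e: "energy V p < h0" using energy_less[OF \<open>p \<in> P\<close>] .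
  show "x \<in> J" "V x < h0" using ab p assms e by (auto intro: less_trans[OF ab(5)])
  show "deriv V x > 0" by (rule slopes[of b]) (use ab p assms e in auto)
qed

lemma I_neg:
  assumes "x \<in> I" "x < 0"
  shows "x \<in> J" "V x < h0" "deriv V x < 0"
proof -
  obtain p where p: "p \<in> insert (0, 0) P" "fst p < x"
    using assms unfolding I_def x_left_def INF_less_iff by auto
  with assms have "p \<in> P" by auto
  from point_shape[OF this] obtain a b where ab: "a < 0" "0 < b" "{a..b} \<subseteq> J" "V a = energy V p"
    "\<And>x. a < x \<Longrightarrow> x < b \<Longrightarrow> V x < energy V p" "a \<le> fst p" by metis
  have e: "energy V p < h0" using energy_less[OF \<open>p \<in> P\<close>] .
  show "x \<in> J" "V x < h0" using ab p assms e by (auto intro: less_trans[OF ab(5)])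
  show "deriv V x < 0" by (rule slopes_left[of a]) (use ab p assms e in auto)
qed

lemma I_J: "I \<subseteq> J"
  using I_pos(1) I_neg(1) J(3) by (metis linorder_neqE_linordered_idom subsetI)

lemma I_interval: "a \<in> I \<Longrightarrow> b \<in> I \<Longrightarrow> {a..b} \<subseteq> I"
  unfolding I_def using less_le_trans[of "x_left V J" "ereal a"] le_less_trans[of _ "ereal b" "x_right V J"]
  by fastforce

lemma I_open: "open I"
proof -
  have "I = ereal -` {x_left V J<..<x_right V J}" by (auto simp: I_def)
  then show ?thesis by (simp add: open_ereal_vimage)
qed

lemma V_mono_pos:
  assumes "y \<in> I" "0 \<le> x" "x < y" shows "V x < V y"
proof (rule DERIV_pos_imp_increasing_open[OF assms(3)])
  have sub: "{0..y} \<subseteq> I" using assms I_zero by (intro I_interval)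
  show "\<exists>w. (V has_real_derivative w) (at z) \<and> w > 0" if "x < z" "z < y" for z
  proof -
    have "z \<in> I" using that assms sub by auto
    then show ?thesis using V_der[OF I_pos(1)] I_pos(3) that assms by (intro exI[of _ "deriv V z"]) auto
  qed
  show "continuous_on {x..y} V"
    by (rule continuous_on_subset[OF V_cont]) (rule order.trans[OF order.trans[OF _ sub] I_J], use assms in auto)
qed

lemma V_mono_neg:
  assumes "x \<in> I" "y \<le> 0" "x < y" shows "V y < V x"
proof (rule DERIV_neg_imp_decreasing_open[OF assms(3)])
  have sub: "{x..0} \<subseteq> I" using assms I_zero by (intro I_interval)
  show "\<exists>w. (V has_real_derivative w) (at z) \<and> w < 0" if "x < z" "z < y" for z
  proof -
    have "z \<in> I" using that assms sub by auto
    then show ?thesis using V_der[OF I_neg(1)] I_neg(3) that assms by (intro exI[of _ "deriv V z"]) auto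
  qed
  show "continuous_on {x..y} V"
    by (rule continuous_on_subset[OF V_cont]) (rule order.trans[OF order.trans[OF _ sub] I_J], use assms in auto)
qed

lemma V_pos: "x \<in> I \<Longrightarrow> x \<noteq> 0 \<Longrightarrow> V x > 0"
  using V_mono_pos[of x 0] V_mono_neg[of x 0] V0 by (cases "x > 0") auto

lemma g_sgn: "x \<in> I \<Longrightarrow> 0 < x \<Longrightarrow> g_fun V x > 0" "x \<in> I \<Longrightarrow> x < 0 \<Longrightarrow> g_fun V x < 0" "g_fun V 0 = 0"
  using V_pos[of x] by (auto simp: g_fun_def)

lemma g_mono:
  assumes "x \<in> I" "y \<in> I" "x < y" shows "g_fun V x < g_fun V y"
proof -
  consider "x \<ge> 0" | "y \<le> 0" | "x < 0" "0 < y" by linarith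
  then show ?thesis
  proof cases
    case 1
    then show ?thesis using V_mono_pos[OF assms(2) 1 assms(3)] assms g_sgn
      by (cases "x = 0") (auto simp: g_fun_def)
  next
    case 2
    then show ?thesis using V_mono_neg[OF assms(1) 2 assms(3)] assms g_sgn
      by (cases "y = 0") (auto simp: g_fun_def)
  next
    case 3
    with assms g_sgn show ?thesis by (meson less_trans)
  qed
qed

lemma g_inj: "inj_on (g_fun V) I"
  using g_mono by (metis inj_onI linorder_neqE_linordered_idom order_less_irrefl)

lemma g_square: "x \<in> I \<Longrightarrow> (g_fun V x)\<^sup>2 = V x"
  using V_pos[of x] V0 by (cases "x = 0") (auto simp: g_fun_def power_mult_distrib sgn_if)

text \<open>Onto because every level z^2 in (0, h0) has an orbit that crosses the axis on both sides
  of the origin.\<close>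

lemma g_image: "g_fun V ` I = {- sqrt h0<..<sqrt h0}"
proof
  show "g_fun V ` I \<subseteq> {- sqrt h0<..<sqrt h0}"
  proof
    fix z assume "z \<in> g_fun V ` I"
    then obtain x where x: "x \<in> I" "z = g_fun V x" by blast
    have "V x < h0" using x I_pos(2)[of x] I_neg(2)[of x] V0 h0_pos by (cases "x = 0"; cases "x > 0") auto
    then have "z\<^sup>2 < h0" using x g_square by simp
    then have "\<bar>z\<bar> < sqrt h0" by (metis real_sqrt_abs real_sqrt_less_iff)
    then show "z \<in> {- sqrt h0<..<sqrt h0}" by auto
  qed
  show "{- sqrt h0<..<sqrt h0} \<subseteq> g_fun V ` I"
  proof
    fix z assume z: "z \<in> {- sqrt h0<..<sqrt h0}"
    then have "\<bar>z\<bar> < sqrt h0" by auto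
    then have z2: "z\<^sup>2 < h0" using h0_pos by (metis abs_ge_zero power2_abs power_strict_mono pos2 real_sqrt_pow2 less_imp_le)
    show "z \<in> g_fun V ` I"
    proof (cases "z = 0")
      case True then show ?thesis using g_sgn(3) I_zero by (metis image_eqI)
    next
      case False
      then have "0 < z\<^sup>2" by simp
      from levels[OF this z2] obtain a b where ab: "a < 0" "0 < b" "V a = z\<^sup>2" "V b = z\<^sup>2" "(a, 0) \<in> P" "(b, 0) \<in> P"
        by metis
      have "g_fun V a = - \<bar>z\<bar>" "g_fun V b = \<bar>z\<bar>" using ab by (auto simp: g_fun_def)
      then show ?thesis using axis_in_I ab False by (cases "z > 0") (auto intro: image_eqI[of _ _ a] image_eqI[of _ _ b])
    qed
  qed
qed

lemma g_inv_eq: "g_inv V J = the_inv_into I (g_fun V)"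
  by (simp add: g_inv_def I_def)

lemma g_inv_in: "\<bar>z\<bar> < sqrt h0 \<Longrightarrow> g_inv V J z \<in> I"
  and g_g_inv: "\<bar>z\<bar> < sqrt h0 \<Longrightarrow> g_fun V (g_inv V J z) = z"
  and g_inv_g: "x \<in> I \<Longrightarrow> g_inv V J (g_fun V x) = x"
proof -
  assume "\<bar>z\<bar> < sqrt h0"
  then have "z \<in> g_fun V ` I" by (auto simp: g_image)
  then show "g_inv V J z \<in> I" "g_fun V (g_inv V J z) = z"
    unfolding g_inv_eq using the_inv_into_into[OF g_inj] f_the_inv_into_f[OF g_inj] by auto
next
  show "x \<in> I \<Longrightarrow> g_inv V J (g_fun V x) = x" unfolding g_inv_eq by (rule the_inv_into_f_f[OF g_inj])
qed

lemma V_g_inv: "\<bar>z\<bar> < sqrt h0 \<Longrightarrow> V (g_inv V J z) = z\<^sup>2"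
  using g_square[OF g_inv_in] g_g_inv by simp

end

section \<open>The period function\<close>

text \<open>Regularity of the inverse coordinate is assumed here with a named derivative. It is
  established later, for whole families, from the continuity hypotheses.\<close>

locale annulus_coordinate = annulus +
  fixes k' :: "real \<Rightarrow> real"
  assumes k'_der: "\<bar>z\<bar> < sqrt h0 \<Longrightarrow> (g_inv V J has_real_derivative k' z) (at z)"
    and k'_cont: "continuous_on {- sqrt h0<..<sqrt h0} k'"
    and k'_pos: "\<bar>z\<bar> < sqrt h0 \<Longrightarrow> k' z > 0"
begin

text \<open>Polar form of the level curve: g(x) = sqrt h sin \<theta> and y / sqrt 2 = sqrt h cos
  \<theta>. The angle starts on the positive y-axis, at the point that later measures the distance
  to the outer boundary.\<close>

definition orbit_curve :: "real \<Rightarrow> real \<Rightarrow> real \<times> real" where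
  "orbit_curve h \<theta> = (g_inv V J (sqrt h * sin \<theta>), sqrt (2 * h) * cos \<theta>)"

text \<open>This is dt/d\<theta>, the time spent per unit of angle.\<close>

definition speed :: "real \<Rightarrow> real \<Rightarrow> real" where
  "speed h \<theta> = k' (sqrt h * sin \<theta>) / sqrt 2"

lemma sin_bound:
  assumes "0 < h" "h < h0" shows "\<bar>sqrt h * sin \<theta>\<bar> < sqrt h0"
proof -
  have "\<bar>sqrt h * sin \<theta>\<bar> \<le> sqrt h * 1"
    unfolding abs_mult using assms by (intro mult_mono) auto
  also have "\<dots> < sqrt h0" using assms by simp
  finally show ?thesis .
qed

lemma speed_cont: "0 < h \<Longrightarrow> h < h0 \<Longrightarrow> continuous_on A (speed h)"
  unfolding speed_def using sin_bound
  by (intro continuous_intros continuous_on_compose2[OF k'_cont]) (auto simp: abs_less_iff minus_less_iff)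

lemma speed_pos: "0 < h \<Longrightarrow> h < h0 \<Longrightarrow> speed h \<theta> > 0"
  unfolding speed_def using k'_pos[OF sin_bound] by simp

text \<open>Differentiate the identity V(g^(-1)(z)) = z^2.\<close>

lemma dV_k':
  assumes "\<bar>z\<bar> < sqrt h0"
  shows "deriv V (g_inv V J z) * k' z = 2 * z"
proof -
  have "g_inv V J z \<in> J" using g_inv_in[OF assms] I_J by blast
  then have "((\<lambda>z. V (g_inv V J z)) has_real_derivative deriv V (g_inv V J z) * k' z) (at z)"
    by (rule DERIV_chain2[OF V_der k'_der[OF assms]])
  moreover have "((\<lambda>z. V (g_inv V J z)) has_real_derivative 2 * z) (at z)"
  proof (rule has_field_derivative_transform_within_open[of "\<lambda>z. z\<^sup>2"])
    show "((\<lambda>z. z\<^sup>2) has_real_derivative 2 * z) (at z)" by (auto intro!: derivative_eq_intros)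
    show "open {- sqrt h0<..<sqrt h0}" by simp
  qed (use assms V_g_inv in \<open>auto simp: abs_less_iff minus_less_iff\<close>)
  ultimately show ?thesis by (rule DERIV_unique)
qed

lemma orbit_curve_der:
  assumes "0 < h" "h < h0"
  shows "(orbit_curve h has_vector_derivative
    speed h \<theta> *\<^sub>R (snd (orbit_curve h \<theta>), - deriv V (fst (orbit_curve h \<theta>)))) (at \<theta>)"
proof -
  let ?z = "sqrt h * sin \<theta>"
  note z = sin_bound[OF assms, of \<theta>]
  have "((\<lambda>\<theta>. g_inv V J (sqrt h * sin \<theta>)) has_real_derivative k' ?z * (sqrt h * cos \<theta>)) (at \<theta>)"
    by (rule DERIV_chain2[where g = "\<lambda>\<theta>. sqrt h * sin \<theta>", OF k'_der[OF z]]) (auto intro!: derivative_eq_intros)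
  moreover have "k' ?z * (sqrt h * cos \<theta>) = speed h \<theta> * (sqrt (2 * h) * cos \<theta>)"
    by (simp add: speed_def real_sqrt_mult)
  moreover have "((\<lambda>\<theta>. sqrt (2 * h) * cos \<theta>) has_real_derivative - sqrt (2 * h) * sin \<theta>) (at \<theta>)"
    by (auto intro!: derivative_eq_intros)
  moreover have "speed h \<theta> * deriv V (g_inv V J ?z) = sqrt (2 * h) * sin \<theta>"
  proof -
    have "speed h \<theta> * deriv V (g_inv V J ?z) = (deriv V (g_inv V J ?z) * k' ?z) / sqrt 2"
      by (simp add: speed_def)
    also have "\<dots> = (sqrt 2 * sqrt 2 * ?z) / sqrt 2" unfolding dV_k'[OF z] by simp
    also have "\<dots> = sqrt (2 * h) * sin \<theta>" by (simp add: real_sqrt_mult del: real_sqrt_mult_self)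
    finally show ?thesis .
  qed
  ultimately have
    "((\<lambda>\<theta>. g_inv V J (sqrt h * sin \<theta>)) has_vector_derivative speed h \<theta> * (sqrt (2 * h) * cos \<theta>)) (at \<theta>)"
    "((\<lambda>\<theta>. sqrt (2 * h) * cos \<theta>) has_vector_derivative - (speed h \<theta> * deriv V (g_inv V J ?z))) (at \<theta>)"
    by (simp_all add: has_real_derivative_iff_has_vector_derivative)
  from has_vector_derivative_Pair[OF this] show ?thesis
    by (simp add: orbit_curve_def[abs_def])
qed

text \<open>Time as a function of the angle. The integrand is positive and 2\<pi>-periodic, so each
  turn adds the same positive amount; hence \<tau> is onto, and that amount is the candidate for the
  period.\<close>

lemma orbit_time:
  assumes h: "0 < h" "h < h0"
  obtains \<tau> where "\<tau> 0 = 0" "\<And>\<theta>. (\<tau> has_real_derivative speed h \<theta>) (at \<theta>)"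
    "strict_mono \<tau>" "\<And>\<theta>. \<tau> (\<theta> + 2 * pi) = \<tau> \<theta> + \<tau> (2 * pi)" "surj \<tau>"
    "\<tau> (2 * pi) = integral {0..2 * pi} (speed h)"
proof -
  have "\<exists>F. \<forall>x. -\<infinity> < ereal x \<longrightarrow> ereal x < \<infinity> \<longrightarrow> (F has_vector_derivative speed h x) (at x)"
    using speed_cont[OF h, of UNIV]
    by (intro einterval_antiderivative) (auto simp: continuous_on_eq_continuous_at)
  then obtain F where F: "\<And>x. (F has_real_derivative speed h x) (at x)"
    by (auto simp: has_real_derivative_iff_has_vector_derivative)
  define \<tau> where "\<tau> x = F x - F 0" for x
  have d: "(\<tau> has_real_derivative speed h x) (at x)" for x
    unfolding \<tau>_def by (auto intro!: derivative_eq_intros F)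
  have sm: "strict_mono \<tau>"
  proof (rule strict_monoI)
    fix x y :: real assume "x < y"
    then show "\<tau> x < \<tau> y"
      by (rule DERIV_pos_imp_increasing) (metis d speed_pos[OF h])
  qed
  have per: "\<tau> (x + 2 * pi) = \<tau> x + \<tau> (2 * pi)" for x
  proof -
    have "((\<lambda>x. \<tau> (x + 2 * pi) - \<tau> x) has_real_derivative 0) (at x)" for x
    proof -
      have "((\<lambda>x. \<tau> (x + 2 * pi)) has_real_derivative speed h (x + 2 * pi) * 1) (at x)"
        by (rule DERIV_chain2[where g = "\<lambda>x. x + 2 * pi", OF d]) (auto intro!: derivative_eq_intros)
      moreover have "speed h (x + 2 * pi) = speed h x" by (simp add: speed_def)
      ultimately show ?thesis using d[of x] by (auto intro!: derivative_eq_intros)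
    qed
    then have "\<tau> (x + 2 * pi) - \<tau> x = \<tau> (0 + 2 * pi) - \<tau> 0" using DERIV_isconst_all by blast
    then show ?thesis by (simp add: \<tau>_def)
  qed
  have Tpos: "\<tau> (2 * pi) > 0" using strict_monoD[OF sm, of 0 "2 * pi"] by (simp add: \<tau>_def)
  have mult: "\<tau> (2 * pi * real n) = real n * \<tau> (2 * pi) \<and> \<tau> (- 2 * pi * real n) = - real n * \<tau> (2 * pi)" for n
  proof (induction n)
    case 0 show ?case by (simp add: \<tau>_def)
  next
    case (Suc n)
    then show ?case using per[of "2 * pi * real n"] per[of "- 2 * pi * real (Suc n)"]
      by (simp add: algebra_simps)
  qed
  have "surj \<tau>"
  proof (rule surjI[where f = "\<lambda>t. SOME x. \<tau> x = t"])
    fix t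
    obtain n where n: "\<bar>t\<bar> < real n * \<tau> (2 * pi)" using reals_Archimedean3[OF Tpos] by blast
    have "\<exists>x\<ge>- 2 * pi * real n. x \<le> 2 * pi * real n \<and> \<tau> x = t"
    proof (rule IVT')
      show "continuous_on {- 2 * pi * real n..2 * pi * real n} \<tau>"
        using d by (meson DERIV_isCont continuous_at_imp_continuous_on)
    qed (use n mult in \<open>auto simp: abs_less_iff\<close>)
    then show "\<tau> (SOME x. \<tau> x = t) = t" by (metis (mono_tags, lifting) someI_ex)
  qed
  moreover have "(speed h has_integral \<tau> (2 * pi) - \<tau> 0) {0..2 * pi}"
    using d by (intro fundamental_theorem_of_calculus)
      (auto simp: has_real_derivative_iff_has_vector_derivative intro: has_vector_derivative_at_within)
  then have "\<tau> (2 * pi) = integral {0..2 * pi} (speed h)"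
    by (simp add: \<tau>_def integral_unique)
  ultimately show thesis using that[of \<tau>] d sm per by (simp add: \<tau>_def)
qed

text \<open>A periodic solution inside the annulus is not known beforehand to surround the origin.
  It shares a point with an orbit that does, and is a time shift of it by uniqueness.\<close>

lemma orbit_through_axis:
  assumes "periodic_solution V J u" "range u \<subseteq> P" "\<And>t. energy V (u t) = h"
  shows "\<exists>t. u t = (0, sqrt (2 * h))"
proof -
  have s: "solution V J u" using assms by (simp add: periodic_solution_def)
  obtain w where w: "periodic_solution V J w" "u 0 \<in> range w" "(0, 0) \<in> inside (range w)"
    using annulus_orbit[of "u 0"] assms(2) by blast
  have sw: "solution V J w" using w(1) by (simp add: periodic_solution_def)
  obtain r where r: "w r = u 0" using w(2) by auto
  then have u: "u = (\<lambda>t. w (t + r))" by (intro solution_unique s solution_shift sw) simp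
  have "energy V (w 0) = h" using energy_constant[OF sw, of 0 r] r assms(3)[of 0] by simp
  then have "(0, sqrt (2 * h)) \<in> range w" using orbit_shape[OF w(1,3)] by metis
  then obtain t where "w t = (0, sqrt (2 * h))" by auto
  then have "u (t - r) = (0, sqrt (2 * h))" by (simp add: u)
  then show ?thesis ..
qed

text \<open>Both sides solve the vector field multiplied by dt/d\<theta>, with the same value at
  \<theta> = 0.\<close>

lemma orbit_parametrization:
  assumes h: "0 < h" "h < h0" and s: "solution V J u" and t0: "u t0 = (0, sqrt (2 * h))"
    and \<tau>: "\<tau> 0 = 0" "\<And>\<theta>. (\<tau> has_real_derivative speed h \<theta>) (at \<theta>)"
  shows "u (t0 + \<tau> \<theta>) = orbit_curve h \<theta>"
proof (rule potential_ode_unique[of J "deriv V" "deriv (deriv V)" "speed h" "\<lambda>\<theta>. u (t0 + \<tau> \<theta>)" "orbit_curve h"])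
  show "is_interval J" "continuous_on J (deriv (deriv V))" "continuous_on UNIV (speed h)"
    using J d2V_cont speed_cont[OF h] by auto
  show "(deriv V has_real_derivative deriv (deriv V) x) (at x)" if "x \<in> J" for x by (rule dV_der[OF that])
  show "((\<lambda>\<theta>. u (t0 + \<tau> \<theta>)) has_vector_derivative
      speed h t *\<^sub>R (snd (u (t0 + \<tau> t)), - deriv V (fst (u (t0 + \<tau> t))))) (at t)" for t
  proof -
    have "((\<lambda>\<theta>. t0 + \<tau> \<theta>) has_vector_derivative speed h t) (at t)"
      unfolding has_real_derivative_iff_has_vector_derivative[symmetric]
      by (auto intro!: derivative_eq_intros \<tau>(2))
    moreover have "(u has_vector_derivative (snd (u (t0 + \<tau> t)), - deriv V (fst (u (t0 + \<tau> t))))) (at (t0 + \<tau> t))"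
      using s by (simp add: solution_def)
    ultimately have "((u \<circ> (\<lambda>\<theta>. t0 + \<tau> \<theta>)) has_vector_derivative
        speed h t *\<^sub>R (snd (u (t0 + \<tau> t)), - deriv V (fst (u (t0 + \<tau> t))))) (at t)"
      by (rule vector_diff_chain_at)
    then show ?thesis by (simp add: o_def)
  qed
  show "fst (u (t0 + \<tau> t)) \<in> J" for t using s by (simp add: solution_def)
  show "(orbit_curve h has_vector_derivative
      speed h t *\<^sub>R (snd (orbit_curve h t), - deriv V (fst (orbit_curve h t)))) (at t)" for t
    by (rule orbit_curve_der[OF h])
  show "fst (orbit_curve h t) \<in> J" for t
    using g_inv_in[OF sin_bound[OF h]] I_J by (auto simp: orbit_curve_def)
  show "u (t0 + \<tau> 0) = orbit_curve h 0"
    using t0 \<tau>(1) g_inv_g[OF I_zero] g_sgn(3) by (simp add: orbit_curve_def)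
qed

lemma orbit_range:
  assumes h: "0 < h" "h < h0" and "periodic_solution V J u" "range u \<subseteq> P" "\<And>t. energy V (u t) = h"
  shows "range u = range (orbit_curve h)"
proof -
  obtain t0 where t0: "u t0 = (0, sqrt (2 * h))" using orbit_through_axis[OF assms(3-5)] by blast
  have s: "solution V J u" using assms by (simp add: periodic_solution_def)
  from orbit_time[OF h] obtain \<tau> where \<tau>: "\<tau> 0 = 0" "\<And>\<theta>. (\<tau> has_real_derivative speed h \<theta>) (at \<theta>)" "surj \<tau>"
    by metis
  have p: "orbit_curve h \<theta> = u (t0 + \<tau> \<theta>)" for \<theta>
    using orbit_parametrization[OF h s t0 \<tau>(1,2)] by simp
  have "u t \<in> range (orbit_curve h)" for t
  proof -
    obtain \<theta> where "t - t0 = \<tau> \<theta>" using \<tau>(3) by (metis surjD)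
    then have "u t = orbit_curve h \<theta>" using p[of \<theta>] by (metis add.commute diff_add_cancel)
    then show ?thesis by simp
  qed
  with p show ?thesis by auto
qed

lemma minimal_period_unique: "minimal_period u S \<Longrightarrow> minimal_period u T \<Longrightarrow> S = T"
  unfolding minimal_period_def by (metis linorder_neqE_linordered_idom)

text \<open>A period shorter than one turn would bring the orbit back to (0, sqrt (2 h)) at an angle
  strictly between 0 and 2\<pi> whose cosine is 1. All solutions of this energy in the annulus share
  the resulting minimal period, so the definite description is legitimate.\<close>

lemma period_formula:
  assumes h: "0 < h" "h < h0"
  shows "period_function V J h = integral {0..2 * pi} (speed h)"
proof -
  from orbit_time[OF h] obtain \<tau> where \<tau>: "\<tau> 0 = 0" "\<And>\<theta>. (\<tau> has_real_derivative speed h \<theta>) (at \<theta>)"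
    "strict_mono \<tau>" "\<And>\<theta>. \<tau> (\<theta> + 2 * pi) = \<tau> \<theta> + \<tau> (2 * pi)" "surj \<tau>"
    "\<tau> (2 * pi) = integral {0..2 * pi} (speed h)" by metis
  have mp: "minimal_period u (\<tau> (2 * pi))"
    if u: "periodic_solution V J u" "range u \<subseteq> P" "\<And>t. energy V (u t) = h" for u
  proof -
    obtain t0 where t0: "u t0 = (0, sqrt (2 * h))" using orbit_through_axis[OF u] by blast
    have s: "solution V J u" using u by (simp add: periodic_solution_def)
    have p: "u (t0 + \<tau> \<theta>) = orbit_curve h \<theta>" for \<theta>
      using orbit_parametrization[OF h s t0 \<tau>(1,2)] by simp
    show ?thesis unfolding minimal_period_def
    proof (intro conjI allI impI)
      show "0 < \<tau> (2 * pi)" using strict_monoD[OF \<tau>(3), of 0 "2 * pi"] \<tau>(1) by simp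
      fix t
      obtain \<theta> where \<theta>: "t - t0 = \<tau> \<theta>" using \<tau>(5) by (metis surjD)
      have "t + \<tau> (2 * pi) = t0 + \<tau> (\<theta> + 2 * pi)" "t = t0 + \<tau> \<theta>" using \<theta> \<tau>(4) by auto
      then have "u (t + \<tau> (2 * pi)) = orbit_curve h (\<theta> + 2 * pi)" "u t = orbit_curve h \<theta>"
        using p by metis+
      then show "u (t + \<tau> (2 * pi)) = u t" by (simp add: orbit_curve_def)
    next
      fix S assume S: "0 < S \<and> S < \<tau> (2 * pi)"
      obtain \<theta> where \<theta>: "S = \<tau> \<theta>" using \<tau>(5) by (metis surjD)
      then have "\<tau> 0 < \<tau> \<theta>" "\<tau> \<theta> < \<tau> (2 * pi)" using S \<tau>(1) by auto
      then have th: "0 < \<theta>" "\<theta> < 2 * pi" using strict_mono_less[OF \<tau>(3)] by auto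
      have "orbit_curve h \<theta> \<noteq> orbit_curve h 0"
      proof
        assume "orbit_curve h \<theta> = orbit_curve h 0"
        then have "g_inv V J (sqrt h * sin \<theta>) = g_inv V J (sqrt h * sin 0)" "cos \<theta> = 1"
          using h by (auto simp: orbit_curve_def)
        then obtain n :: int where n: "\<theta> = real_of_int n * 2 * pi" using cos_one_2pi_int[of \<theta>] by blast
        from th(1) have "0 < n" by (simp add: n zero_less_mult_iff)
        moreover from th(2) have "n < 1" by (simp add: n)
        ultimately show False by simp
      qed
      then show "\<exists>t. u (t + S) \<noteq> u t" using p[of \<theta>] p[of 0] \<theta> \<tau>(1) by (intro exI[of _ t0]) simp
    qed
  qed
  obtain q where q: "q \<in> P" "energy V q = h" using energy_attained[OF h] by blast
  obtain u where u: "periodic_solution V J u" "q \<in> range u" "range u \<subseteq> P"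
    using annulus_orbit[OF q(1)] by blast
  have "energy V (u t) = h" for t
    using u(2) q(2) energy_constant[of u] u(1) by (metis periodic_solution_def rangeE)
  note u' = u(1,3) this
  show ?thesis unfolding period_function_def \<tau>(6)[symmetric]
  proof (rule the_equality)
    show "\<exists>u. periodic_solution V J u \<and> range u \<subseteq> P \<and> (\<forall>t. energy V (u t) = h) \<and> minimal_period u (\<tau> (2 * pi))"
      using u' mp[OF u'] by blast
    fix T assume "\<exists>u. periodic_solution V J u \<and> range u \<subseteq> P \<and> (\<forall>t. energy V (u t) = h) \<and> minimal_period u T"
    then obtain w where w: "periodic_solution V J w" "range w \<subseteq> P" "\<And>t. energy V (w t) = h" "minimal_period w T"
      by blast
    show "T = \<tau> (2 * pi)" by (rule minimal_period_unique[OF w(4) mp[OF w(1-3)]])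
  qed
qed

end

section \<open>Regularity in the parameter\<close>

text \<open>Either alternative of (H) for an end of the projection implies continuity into the
  extended reals, and this is all that is required here. The outer energy is taken finite.\<close>

locale potential_family =
  fixes D :: "'p::t2_space set" and V :: "'p \<Rightarrow> real \<Rightarrow> real" and J :: "'p \<Rightarrow> real set" and h0 :: "'p \<Rightarrow> real"
  assumes ann: "\<mu> \<in> D \<Longrightarrow> annulus (V \<mu>) (J \<mu>) (h0 \<mu>)"
    and V_joint: "continuous_on {(x, \<mu>). \<mu> \<in> D \<and> x \<in> J \<mu>} (\<lambda>(x, \<mu>). (deriv ^^ k) (V \<mu>) x)"
    and left_cont: "continuous_on D (\<lambda>\<mu>. x_left (V \<mu>) (J \<mu>))"
    and right_cont: "continuous_on D (\<lambda>\<mu>. x_right (V \<mu>) (J \<mu>))"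
    and h0_cont: "continuous_on D h0"
begin

abbreviation "Ix \<mu> \<equiv> annulus.I (V \<mu>) (J \<mu>)"
definition W :: "('p \<times> real) set" where "W = {(\<mu>, x). \<mu> \<in> D \<and> x \<in> Ix \<mu>}"
definition Z :: "('p \<times> real) set" where "Z = {(\<mu>, z). \<mu> \<in> D \<and> \<bar>z\<bar> < sqrt (h0 \<mu>)}"

lemma pot: "\<mu> \<in> D \<Longrightarrow> potential (V \<mu>) (J \<mu>)"
  using ann annulus_def by blast

lemma W_slices: "open_slices W"
  unfolding open_slices_def
proof
  fix \<mu> show "open {x. (\<mu>, x) \<in> W}"
    using annulus.I_open[OF ann] by (cases "\<mu> \<in> D") (auto simp: W_def)
qed

lemma Z_slices: "open_slices Z"
  unfolding open_slices_def
proof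
  fix \<mu>
  have "{z. \<bar>z\<bar> < sqrt (h0 \<mu>)} = {- sqrt (h0 \<mu>)<..<sqrt (h0 \<mu>)}" by auto
  then show "open {x. (\<mu>, x) \<in> Z}" by (cases "\<mu> \<in> D") (auto simp: Z_def)
qed

lemma Ck_V: "Ck k W (\<lambda>\<mu>. (deriv ^^ j) (V \<mu>))"
proof (induction k arbitrary: j)
  have *: "continuous_on W (\<lambda>(\<mu>, x). (deriv ^^ j) (V \<mu>) x)" for j
  proof -
    have "continuous_on W (\<lambda>p. (\<lambda>(x, \<mu>). (deriv ^^ j) (V \<mu>) x) (snd p, fst p))"
      by (rule continuous_on_compose2[OF V_joint])
        (auto intro!: continuous_intros simp: W_def dest: subsetD[OF annulus.I_J[OF ann], rotated])
    then show ?thesis by (simp add: case_prod_beta)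
  qed
  { case 0 show ?case using * by simp }
  case (Suc k)
  show ?case
  proof (rule Ck_SucI[OF _ Suc *])
    fix \<mu> x assume a: "(\<mu>, x) \<in> W"
    then have "x \<in> J \<mu>" "\<mu> \<in> D" using annulus.I_J[OF ann] by (auto simp: W_def)
    then show "((deriv ^^ j) (V \<mu>) has_real_derivative (deriv ^^ Suc j) (V \<mu>) x) (at x)"
      using potential.an[OF pot] potential.J(1)[OF pot] by (intro real_analytic_iterated_deriv)
  qed
qed

text \<open>The quotient V(x) / x^2, in the integral form of Taylor's remainder. It is smooth
  through x = 0, jointly in the parameter, so that g = x sqrt w is visibly smooth where sgn(x)
  sqrt(V(x)) is not.\<close>

definition w :: "'p \<Rightarrow> real \<Rightarrow> real" where
  "w \<mu> x = integral {0..1} (\<lambda>s. (1 - s) * (deriv ^^ 2) (V \<mu>) (s * x))"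

lemma W_star: "(\<mu>, x) \<in> W \<Longrightarrow> 0 \<le> s \<Longrightarrow> s \<le> 1 \<Longrightarrow> (\<mu>, s * x) \<in> W"
proof -
  assume a: "(\<mu>, x) \<in> W" "0 \<le> s" "s \<le> 1"
  then have D: "\<mu> \<in> D" and x: "x \<in> Ix \<mu>" by (auto simp: W_def)
  have "s * x \<in> (if x \<ge> 0 then {0..x} else {x..0})"
    using a mult_right_mono[of s 1 x] mult_right_mono_neg[of s 1 x]
    by (auto simp: mult_nonneg_nonpos)
  also have "\<dots> \<subseteq> Ix \<mu>"
    using annulus.I_interval[OF ann[OF D] annulus.I_zero[OF ann[OF D]] x]
      annulus.I_interval[OF ann[OF D] x annulus.I_zero[OF ann[OF D]]] by auto
  finally show ?thesis using D by (simp add: W_def)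
qed

lemma Ck_w: "Ck k W w"
  unfolding w_def[abs_def]
  by (rule Ck_integral_scaled[OF W_star W_slices Ck_V]) (auto intro!: continuous_intros)

text \<open>The primitive used is (1 - s) x V'(s x) + V(s x). It equals V(x) at s = 1 and vanishes
  at s = 0 because V(0) = V'(0) = 0.\<close>

lemma V_eq_w: assumes "(\<mu>, x) \<in> W" shows "V \<mu> x = x\<^sup>2 * w \<mu> x"
proof -
  have D: "\<mu> \<in> D" using assms by (auto simp: W_def)
  note p = pot[OF D]
  have sJ: "s * x \<in> J \<mu>" if "s \<in> {0..1}" for s
    using W_star[OF assms] that annulus.I_J[OF ann[OF D]] by (auto simp: W_def)
  have "((\<lambda>s. (1 - s) * x\<^sup>2 * deriv (deriv (V \<mu>)) (s * x)) has_integral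
      ((1 - 1) * x * deriv (V \<mu>) (1 * x) + V \<mu> (1 * x)) - ((1 - 0) * x * deriv (V \<mu>) (0 * x) + V \<mu> (0 * x))) {0..1}"
  proof (rule fundamental_theorem_of_calculus)
    fix s :: real assume s: "s \<in> {0..1}"
    have 1: "((\<lambda>s. V \<mu> (s * x)) has_real_derivative deriv (V \<mu>) (s * x) * x) (at s)"
      by (rule DERIV_chain2[where g = "\<lambda>s. s * x", OF potential.V_der[OF p sJ[OF s]]])
        (auto intro!: derivative_eq_intros)
    have 2: "((\<lambda>s. deriv (V \<mu>) (s * x)) has_real_derivative deriv (deriv (V \<mu>)) (s * x) * x) (at s)"
      by (rule DERIV_chain2[where g = "\<lambda>s. s * x", OF potential.dV_der[OF p sJ[OF s]]])
        (auto intro!: derivative_eq_intros)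
    have "((\<lambda>s. (1 - s) * x * deriv (V \<mu>) (s * x) + V \<mu> (s * x)) has_real_derivative
        (1 - s) * x\<^sup>2 * deriv (deriv (V \<mu>)) (s * x)) (at s)"
      by (auto intro!: derivative_eq_intros 1 2 simp: power2_eq_square algebra_simps)
    then show "((\<lambda>s. (1 - s) * x * deriv (V \<mu>) (s * x) + V \<mu> (s * x)) has_vector_derivative
        (1 - s) * x\<^sup>2 * deriv (deriv (V \<mu>)) (s * x)) (at s within {0..1})"
      by (simp add: has_real_derivative_iff_has_vector_derivative has_vector_derivative_at_within)
  qed simp
  then have "((\<lambda>s. x\<^sup>2 * ((1 - s) * deriv (deriv (V \<mu>)) (s * x))) has_integral V \<mu> x) {0..1}"
    using potential.V0[OF p] potential.dV0[OF p] by (simp add: mult_ac)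
  from integral_unique[OF this] show ?thesis
    by (simp only: integral_mult_right) (simp add: w_def numeral_2_eq_2)
qed

lemma w_pos: assumes "(\<mu>, x) \<in> W" shows "w \<mu> x > 0"
proof (cases "x = 0")
  case False
  then show ?thesis
    using annulus.V_pos[OF ann, of \<mu> x] V_eq_w[OF assms] assms by (auto simp: W_def zero_less_mult_iff)
next
  case True
  have D: "\<mu> \<in> D" using assms by (auto simp: W_def)
  have "((\<lambda>s::real. s - s\<^sup>2 / 2) has_real_derivative (1 - s)) (at s within {0..1})" for s
    by (auto intro!: derivative_eq_intros)
  then have "((\<lambda>s::real. 1 - s) has_integral ((\<lambda>s. s - s\<^sup>2 / 2) 1 - (\<lambda>s. s - s\<^sup>2 / 2) 0)) {0..1}"
    by (intro fundamental_theorem_of_calculus) (auto simp: has_real_derivative_iff_has_vector_derivative)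
  then have "integral {0..1} (\<lambda>s::real. 1 - s) = 1 / 2" by (simp add: integral_unique)
  then have "w \<mu> x = 1 / 2 * deriv (deriv (V \<mu>)) 0" by (simp add: w_def True numeral_2_eq_2)
  then show ?thesis using potential.d2V0[OF pot[OF D]] by simp
qed

lemma g_eq: "(\<mu>, x) \<in> W \<Longrightarrow> x * sqrt (w \<mu> x) = g_fun (V \<mu>) x"
  using V_eq_w[of \<mu> x] by (simp add: g_fun_def real_sqrt_mult sgn_mult_abs mult.assoc[symmetric])

lemma Ck_g: "Ck k W (\<lambda>\<mu>. g_fun (V \<mu>))"
  by (rule Ck_cong[OF W_slices Ck_mult[OF Ck_ident Ck_sqrt[OF Ck_w w_pos]] g_eq])

lemmas g_der = Ck_deriv(2)[OF W_slices Ck_g]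
lemmas Ck_dg = Ck_deriv(1)[OF W_slices Ck_g]

text \<open>At 0 the derivative of x sqrt w is sqrt w. Elsewhere g^2 = V gives 2 g g' = V', and V'
  has the sign of g.\<close>

lemma dg_pos: assumes a: "(\<mu>, x) \<in> W" shows "deriv (g_fun (V \<mu>)) x > 0"
proof (cases "x = 0")
  case True
  have w: "((\<lambda>x. sqrt (w \<mu> x)) has_real_derivative deriv (\<lambda>x. sqrt (w \<mu> x)) x) (at x)"
    by (rule Ck_deriv(2)[OF W_slices Ck_sqrt[OF Ck_w w_pos] a])
  have "((\<lambda>x. x * sqrt (w \<mu> x)) has_real_derivative sqrt (w \<mu> x)) (at x)"
    by (rule DERIV_cong[OF DERIV_mult[OF DERIV_ident w]]) (simp add: True)
  then have "(g_fun (V \<mu>) has_real_derivative sqrt (w \<mu> x)) (at x)"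
  proof (rule has_field_derivative_transform_within_open)
    show "open {x. (\<mu>, x) \<in> W}" using W_slices by (simp add: open_slices_def)
  qed (use a g_eq in auto)
  then show ?thesis using w_pos[OF a] DERIV_unique[OF g_der[OF a]] by simp
next
  case False
  have D: "\<mu> \<in> D" and x: "x \<in> Ix \<mu>" using a by (auto simp: W_def)
  note A = ann[OF D]
  have "((\<lambda>x. (g_fun (V \<mu>) x)\<^sup>2) has_real_derivative 2 * g_fun (V \<mu>) x * deriv (g_fun (V \<mu>)) x) (at x)"
    by (auto intro!: derivative_eq_intros g_der[OF a])
  then have "(V \<mu> has_real_derivative 2 * g_fun (V \<mu>) x * deriv (g_fun (V \<mu>)) x) (at x)"
    by (rule has_field_derivative_transform_within_open[OF _ annulus.I_open[OF A] x annulus.g_square[OF A]])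
  moreover have "(V \<mu> has_real_derivative deriv (V \<mu>) x) (at x)"
    using x annulus.I_J[OF A] by (intro potential.V_der[OF pot[OF D]]) auto
  ultimately have "2 * g_fun (V \<mu>) x * deriv (g_fun (V \<mu>)) x = deriv (V \<mu>) x" by (rule DERIV_unique)
  moreover have "g_fun (V \<mu>) x * deriv (V \<mu>) x > 0"
    using annulus.I_pos(3)[OF A x] annulus.I_neg(3)[OF A x] annulus.g_sgn(1,2)[OF A x] False
    by (cases "x > 0") (auto intro: mult_pos_pos mult_neg_neg)
  ultimately have "0 < g_fun (V \<mu>) x * (2 * g_fun (V \<mu>) x * deriv (g_fun (V \<mu>)) x)" by simp
  then have "0 < 2 * (g_fun (V \<mu>) x)\<^sup>2 * deriv (g_fun (V \<mu>)) x"
    by (simp only: power2_eq_square mult_ac)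
  then show ?thesis by (simp add: zero_less_mult_iff)
qed

section \<open>The inverse coordinate and its dependence on the parameter\<close>

abbreviation "kf \<mu> \<equiv> g_inv (V \<mu>) (J \<mu>)"

lemma kf_in_W: "(\<mu>, z) \<in> Z \<Longrightarrow> (\<mu>, kf \<mu> z) \<in> W"
  using annulus.g_inv_in[OF ann] by (auto simp: Z_def W_def)

text \<open>Monotonicity replaces an implicit function argument: for fixed a, the inequality between
  g(a) and z persists for nearby parameters and z, and it decides on which side of a the value of
  the inverse lies.\<close>

lemma kf_cont: "continuous_on Z (\<lambda>(\<mu>, z). kf \<mu> z)"
  unfolding continuous_on_def
proof
  fix p assume pZ: "p \<in> Z"
  obtain \<mu>0 z0 where p: "p = (\<mu>0, z0)" by (cases p)
  have D: "\<mu>0 \<in> D" and z0: "\<bar>z0\<bar> < sqrt (h0 \<mu>0)" using pZ p by (auto simp: Z_def)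
  note A = ann[OF D]
  define x0 where "x0 = kf \<mu>0 z0"
  have x0: "x0 \<in> Ix \<mu>0" "g_fun (V \<mu>0) x0 = z0"
    using annulus.g_inv_in[OF A z0] annulus.g_g_inv[OF A z0] by (auto simp: x0_def)
  have cl: "((\<lambda>q. x_left (V (fst q)) (J (fst q))) \<longlongrightarrow> x_left (V \<mu>0) (J \<mu>0)) (at p within Z)"
    "((\<lambda>q. x_right (V (fst q)) (J (fst q))) \<longlongrightarrow> x_right (V \<mu>0) (J \<mu>0)) (at p within Z)"
  proof -
    have "continuous_on Z (\<lambda>q. x_left (V (fst q)) (J (fst q)))" "continuous_on Z (\<lambda>q. x_right (V (fst q)) (J (fst q)))"
      by (rule continuous_on_compose2[OF left_cont continuous_on_fst[OF continuous_on_id]], force simp: Z_def)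
        (rule continuous_on_compose2[OF right_cont continuous_on_fst[OF continuous_on_id]], force simp: Z_def)
    then show "((\<lambda>q. x_left (V (fst q)) (J (fst q))) \<longlongrightarrow> x_left (V \<mu>0) (J \<mu>0)) (at p within Z)"
      "((\<lambda>q. x_right (V (fst q)) (J (fst q))) \<longlongrightarrow> x_right (V \<mu>0) (J \<mu>0)) (at p within Z)"
      using pZ by (force simp: continuous_on_def p)+
  qed
  \<comment> \<open>Continuity of the two ends of the projection enters here: a test point stays
    admissible for nearby parameters.\<close>
  have inI: "\<forall>\<^sub>F q in at p within Z. a \<in> Ix (fst q)" if "a \<in> Ix \<mu>0" for a
  proof -
    have "x_left (V \<mu>0) (J \<mu>0) < ereal a" "ereal a < x_right (V \<mu>0) (J \<mu>0)"
      using that by (auto simp: annulus.I_def[OF A])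
    from order_tendstoD(2)[OF cl(1) this(1)] order_tendstoD(1)[OF cl(2) this(2)]
    have "\<forall>\<^sub>F q in at p within Z. x_left (V (fst q)) (J (fst q)) < ereal a \<and> ereal a < x_right (V (fst q)) (J (fst q)) \<and> q \<in> Z"
      unfolding eventually_at_filter by eventually_elim auto
    then show ?thesis by eventually_elim (auto simp: Z_def annulus.I_def[OF ann])
  qed
  \<comment> \<open>\<open>Q\<close> and \<open>R\<close> stand for either strict inequality.
    Continuity of g(a) is available only among parameters whose interval contains a;
    \<open>inI\<close> then removes the restriction.\<close>
  have g_tendsto: "\<forall>\<^sub>F q in at p within Z. Q (g_fun (V (fst q)) a) (snd q)"
    if aI: "a \<in> Ix \<mu>0" and Q: "\<And>f. (f \<longlongrightarrow> g_fun (V \<mu>0) a - z0) (at p within {q \<in> Z. a \<in> Ix (fst q)}) \<Longrightarrow>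
        \<forall>\<^sub>F q in at p within {q \<in> Z. a \<in> Ix (fst q)}. R (f q)" and QR: "\<And>x y. Q x y \<longleftrightarrow> R (x - y)" for a Q R
  proof -
    let ?Z = "{q \<in> Z. a \<in> Ix (fst q)}"
    have "continuous_on ?Z (\<lambda>q. (\<lambda>(\<mu>, x). g_fun (V \<mu>) x) (fst q, a))"
      by (rule continuous_on_compose2[OF Ck_continuous[OF Ck_g]])
        (auto intro!: continuous_intros simp: Z_def W_def)
    then have "continuous_on ?Z (\<lambda>q. g_fun (V (fst q)) a - snd q)"
      by (auto intro!: continuous_intros)
    then have "((\<lambda>q. g_fun (V (fst q)) a - snd q) \<longlongrightarrow> g_fun (V \<mu>0) a - z0) (at p within ?Z)"
      using pZ aI by (auto simp: continuous_on_def p)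
    from Q[OF this] inI[OF aI] have "\<forall>\<^sub>F q in nhds p. q \<noteq> p \<longrightarrow> q \<in> Z \<longrightarrow> R (g_fun (V (fst q)) a - snd q)"
      unfolding eventually_at_filter by eventually_elim auto
    then show ?thesis unfolding eventually_at_filter QR by eventually_elim auto
  qed
  have lt: "\<forall>\<^sub>F q in at p within Z. g_fun (V (fst q)) a < snd q" if "a \<in> Ix \<mu>0" "a < x0" for a
    using that annulus.g_mono[OF A that(1) x0(1) that(2)] x0(2)
    by (intro g_tendsto[where a = a and Q = "\<lambda>x y. x < y" and R = "\<lambda>x. x < 0"])
      (auto intro: order_tendstoD(2))
  have gt: "\<forall>\<^sub>F q in at p within Z. g_fun (V (fst q)) a > snd q" if "a \<in> Ix \<mu>0" "a > x0" for a
    using that annulus.g_mono[OF A x0(1) that(1,2)] x0(2)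
    by (intro g_tendsto[where a = a and Q = "\<lambda>x y. x > y" and R = "\<lambda>x. x > 0"])
      (auto intro: order_tendstoD(1))
  have kb: "a < kf \<mu> z" if "\<mu> \<in> D" "a \<in> Ix \<mu>" "\<bar>z\<bar> < sqrt (h0 \<mu>)" "g_fun (V \<mu>) a < z" for \<mu> z a
  proof -
    note B = ann[OF that(1)]
    show ?thesis
    proof (rule ccontr)
      assume "\<not> a < kf \<mu> z"
      then have "g_fun (V \<mu>) (kf \<mu> z) \<le> g_fun (V \<mu>) a"
        using annulus.g_mono[OF B annulus.g_inv_in[OF B that(3)] that(2)] by (cases "kf \<mu> z = a") auto
      then show False using annulus.g_g_inv[OF B that(3)] that(4) by simp
    qed
  qed
  have ka: "kf \<mu> z < a" if "\<mu> \<in> D" "a \<in> Ix \<mu>" "\<bar>z\<bar> < sqrt (h0 \<mu>)" "z < g_fun (V \<mu>) a" for \<mu> z a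
  proof -
    note B = ann[OF that(1)]
    show ?thesis
    proof (rule ccontr)
      assume "\<not> kf \<mu> z < a"
      then have "g_fun (V \<mu>) a \<le> g_fun (V \<mu>) (kf \<mu> z)"
        using annulus.g_mono[OF B that(2) annulus.g_inv_in[OF B that(3)]] by (cases "kf \<mu> z = a") auto
      then show False using annulus.g_g_inv[OF B that(3)] that(4) by simp
    qed
  qed
  have inZ: "\<forall>\<^sub>F q in at p within Z. q \<in> Z" by (simp add: eventually_at_filter)
  have "((\<lambda>q. kf (fst q) (snd q)) \<longlongrightarrow> x0) (at p within Z)"
  proof (rule order_tendstoI)
    fix c assume "c < x0"
    obtain e where e: "e > 0" "ball x0 e \<subseteq> Ix \<mu>0" by (rule openE[OF annulus.I_open[OF A] x0(1)])
    \<comment> \<open>A test point strictly between c and x0 that still belongs to the interval of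
      the base parameter.\<close>
    define a where "a = max (x0 - e / 2) ((c + x0) / 2)"
    have a: "a < x0" "c < a" "a \<in> ball x0 e" using e(1) \<open>c < x0\<close> unfolding a_def mem_ball dist_real_def by - (auto simp: max_def min_def abs_if field_simps)+
    then have aI: "a \<in> Ix \<mu>0" using e by blast
    show "\<forall>\<^sub>F q in at p within Z. c < kf (fst q) (snd q)"
      using inI[OF aI] lt[OF aI a(1)] inZ
    proof eventually_elim
      case (elim q)
      then have "a < kf (fst q) (snd q)" by (intro kb) (auto simp: Z_def)
      with a show ?case by simp
    qed
  next
    fix c assume "x0 < c"
    obtain e where e: "e > 0" "ball x0 e \<subseteq> Ix \<mu>0" by (rule openE[OF annulus.I_open[OF A] x0(1)])
    define a where "a = min (x0 + e / 2) ((c + x0) / 2)"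
    have a: "x0 < a" "a < c" "a \<in> ball x0 e" using e(1) \<open>x0 < c\<close> unfolding a_def mem_ball dist_real_def by - (auto simp: max_def min_def abs_if field_simps)+
    then have aI: "a \<in> Ix \<mu>0" using e by blast
    show "\<forall>\<^sub>F q in at p within Z. kf (fst q) (snd q) < c"
      using inI[OF aI] gt[OF aI a(1)] inZ
    proof eventually_elim
      case (elim q)
      then have "kf (fst q) (snd q) < a" by (intro ka) (auto simp: Z_def)
      with a show ?case by simp
    qed
  qed
  then show "((\<lambda>(\<mu>, z). kf \<mu> z) \<longlongrightarrow> (case p of (\<mu>, z) \<Rightarrow> kf \<mu> z)) (at p within Z)"
    unfolding p x0_def case_prod_beta by simp
qed

lemma kf_der:
  assumes "(\<mu>, z) \<in> Z"
  shows "(kf \<mu> has_real_derivative inverse (deriv (g_fun (V \<mu>)) (kf \<mu> z))) (at z)"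
proof -
  have D: "\<mu> \<in> D" and z: "\<bar>z\<bar> < sqrt (h0 \<mu>)" using assms by (auto simp: Z_def)
  let ?S = "{- sqrt (h0 \<mu>)<..<sqrt (h0 \<mu>)}"
  show ?thesis
  proof (rule DERIV_inverse_function[where a = "- sqrt (h0 \<mu>)" and b = "sqrt (h0 \<mu>)" and f = "g_fun (V \<mu>)"])
    show "(g_fun (V \<mu>) has_real_derivative deriv (g_fun (V \<mu>)) (kf \<mu> z)) (at (kf \<mu> z))"
      by (rule g_der[OF kf_in_W[OF assms]])
    show "deriv (g_fun (V \<mu>)) (kf \<mu> z) \<noteq> 0" using dg_pos[OF kf_in_W[OF assms]] by simp
    show "g_fun (V \<mu>) (kf \<mu> y) = y" if "- sqrt (h0 \<mu>) < y" "y < sqrt (h0 \<mu>)" for y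
      using that by (intro annulus.g_g_inv[OF ann[OF D]]) auto
    have "continuous_on ?S (\<lambda>y. (\<lambda>(\<mu>, z). kf \<mu> z) (\<mu>, y))"
      by (rule continuous_on_compose2[OF kf_cont]) (auto intro!: continuous_intros simp: Z_def D)
    then show "isCont (kf \<mu>) z"
      using z by (simp add: continuous_on_eq_continuous_at abs_less_iff)
  qed (use z in auto)
qed

lemma Ck_kf: "Ck k Z kf"
  by (rule Ck_inverse_function[OF kf_der _ kf_in_W kf_cont Ck_dg]) (use dg_pos in force)+

lemma annulus_coordinate: "\<mu> \<in> D \<Longrightarrow> annulus_coordinate (V \<mu>) (J \<mu>) (h0 \<mu>) (deriv (kf \<mu>))"
proof -
  assume D: "\<mu> \<in> D"
  have "continuous_on {- sqrt (h0 \<mu>)<..<sqrt (h0 \<mu>)} (\<lambda>y. (\<lambda>(\<mu>, z). deriv (kf \<mu>) z) (\<mu>, y))"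
    by (rule continuous_on_compose2[OF Ck_continuous[OF Ck_deriv(1)[OF Z_slices Ck_kf]]])
      (auto intro!: continuous_intros simp: Z_def D)
  then show ?thesis
    using ann[OF D] Ck_deriv(2)[OF Z_slices Ck_kf] DERIV_imp_deriv[OF kf_der] dg_pos[OF kf_in_W]
    by (intro annulus_coordinate.intro annulus_coordinate_axioms.intro) (auto simp: Z_def D)
qed

definition period_density :: "'p \<Rightarrow> real \<Rightarrow> real" where
  "period_density \<mu> z = z * sqrt (h0 \<mu>) * (deriv ^^ 2) (kf \<mu>) (z * sqrt (h0 \<mu>))"

lemma Ck_period_density: "Ck k (D \<times> {-1<..<1}) period_density"
proof -
  let ?W = "D \<times> {-1<..<1::real}"
  have "continuous_on ?W (\<lambda>p. sqrt (h0 (fst p)))"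
    by (intro continuous_intros continuous_on_compose2[OF h0_cont]) auto
  then have s: "Ck k ?W (\<lambda>\<mu> z. z * sqrt (h0 \<mu>))"
    by (intro Ck_mult Ck_ident Ck_param) (simp add: case_prod_beta)
  have "(\<mu>, z * sqrt (h0 \<mu>)) \<in> Z" if "(\<mu>, z) \<in> ?W" for \<mu> z
  proof -
    have "\<mu> \<in> D" "\<bar>z\<bar> < 1" using that by auto
    then have "\<bar>z\<bar> * sqrt (h0 \<mu>) < 1 * sqrt (h0 \<mu>)"
      using annulus.h0_pos[OF ann] by (intro mult_strict_right_mono) auto
    with \<open>\<mu> \<in> D\<close> show ?thesis using annulus.h0_pos[OF ann] by (auto simp: Z_def abs_mult less_imp_le)
  qed
  then have "Ck k ?W (\<lambda>\<mu> z. deriv (deriv (kf \<mu>)) (z * sqrt (h0 \<mu>)))"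
    by (rule Ck_compose[OF _ Ck_deriv(1)[OF Z_slices Ck_deriv(1)[OF Z_slices Ck_kf]] s])
  from Ck_mult[OF s this] show ?thesis
    unfolding period_density_def[abs_def] by (simp add: numeral_2_eq_2)
qed

end

section \<open>Wronskians and Euler operators\<close>

text \<open>Coefficient of the \<open>k\<close>-th derivative of \<open>f\<close> in the \<open>i\<close>-th iterate of \<open>x (1 - x\<^sup>2) d/dx\<close> applied to
  \<open>(1 - x\<^sup>2) f\<close>; note that \<open>x (1 - x\<^sup>2) d/dx = u d/du\<close>.\<close>

primrec euler_coeff :: "nat \<Rightarrow> nat \<Rightarrow> real poly" where
  "euler_coeff 0 = (\<lambda>k. if k = 0 then [:1, 0, -1:] else 0)"
| "euler_coeff (Suc i) = (\<lambda>k. [:0, 1, 0, -1:] *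
     (pderiv (euler_coeff i k) + (case k of 0 \<Rightarrow> 0 | Suc l \<Rightarrow> euler_coeff i l)))"

definition euler_iter :: "(real \<Rightarrow> real) \<Rightarrow> nat \<Rightarrow> real \<Rightarrow> real" where
  "euler_iter f i x = (\<Sum>k\<le>i. poly (euler_coeff i k) x * (deriv ^^ k) f x)"

lemma euler_coeff_upper: "i < k \<Longrightarrow> euler_coeff i k = 0"
  by (induction i arbitrary: k) (auto split: nat.split)

lemma euler_coeff_diag: "euler_coeff i i = [:1, 0, -1:] * [:0, 1, 0, -1:] ^ i"
  by (induction i) (simp_all add: euler_coeff_upper mult_ac del: mult_pCons_left mult_pCons_right)

definition smooth_at :: "(real \<Rightarrow> real) \<Rightarrow> real \<Rightarrow> bool" where
  "smooth_at f x \<longleftrightarrow> (\<forall>i. ((deriv ^^ i) f has_real_derivative (deriv ^^ Suc i) f x) (at x))"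

lemma euler_iter_der:
  assumes "smooth_at f x"
  shows "\<exists>d. (euler_iter f i has_real_derivative d) (at x) \<and> x * (1 - x\<^sup>2) * d = euler_iter f (Suc i) x"
proof -
  let ?c = "euler_coeff i" and ?f = "\<lambda>k. (deriv ^^ k) f"
  let ?d = "\<Sum>k\<le>i. poly (pderiv (?c k)) x * ?f k x + poly (?c k) x * ?f (Suc k) x"
  have "(euler_iter f i has_real_derivative ?d) (at x)"
  proof -
    have "((\<lambda>x. \<Sum>k\<le>i. poly (?c k) x * ?f k x) has_real_derivative ?d) (at x)"
    proof (rule DERIV_sum)
      fix k
      have fk: "(?f k has_real_derivative ?f (Suc k) x) (at x)" using assms unfolding smooth_at_def by blast
      show "((\<lambda>x. poly (?c k) x * ?f k x) has_real_derivative
        poly (pderiv (?c k)) x * ?f k x + poly (?c k) x * ?f (Suc k) x) (at x)"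
        by (rule DERIV_cong[OF DERIV_mult[OF poly_DERIV fk]]) simp
    qed
    then show ?thesis by (simp add: euler_iter_def[abs_def])
  qed
  moreover have "x * (1 - x\<^sup>2) * ?d = euler_iter f (Suc i) x"
  proof -
    let ?q = "x * (1 - x\<^sup>2)"
    have q: "poly [:0, 1, 0, -1:] x = ?q" by (simp add: power2_eq_square algebra_simps)
    have "euler_iter f (Suc i) x = (\<Sum>k\<le>Suc i. ?q * (poly (pderiv (?c k)) x * ?f k x))
       + (\<Sum>k\<le>Suc i. ?q * (poly (case k of 0 \<Rightarrow> 0 | Suc l \<Rightarrow> ?c l) x * ?f k x))"
      unfolding euler_iter_def sum.distrib[symmetric]
      by (intro sum.cong) (simp_all only: euler_coeff.simps poly_mult poly_add q ring_distribs mult.assoc)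
    also have "(\<Sum>k\<le>Suc i. ?q * (poly (pderiv (?c k)) x * ?f k x)) = (\<Sum>k\<le>i. ?q * (poly (pderiv (?c k)) x * ?f k x))"
      by (simp add: euler_coeff_upper)
    also have "(\<Sum>k\<le>Suc i. ?q * (poly (case k of 0 \<Rightarrow> 0 | Suc l \<Rightarrow> ?c l) x * ?f k x)) =
       (\<Sum>k\<le>i. ?q * (poly (?c k) x * ?f (Suc k) x))"
      by (subst sum.atMost_Suc_shift) simp
    finally show ?thesis by (simp add: sum.distrib sum_distrib_left distrib_left)
  qed
  ultimately show ?thesis by blast
qed

section \<open>The chart u = x / sqrt (1 - x^2) and the functions \<open>psi\<close>\<close>

lemma unit_interval_pos: "x \<in> {0<..<1} \<Longrightarrow> 0 < 1 - x\<^sup>2" for x :: real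
  using abs_square_less_1[of x] by auto

lemma chart_deriv:
  fixes x :: real
  assumes "\<bar>x\<bar> < 1"
  shows "((\<lambda>x. x / sqrt (1 - x\<^sup>2)) has_real_derivative 1 / ((1 - x\<^sup>2) * sqrt (1 - x\<^sup>2))) (at x)"
proof -
  have p: "1 - x\<^sup>2 > 0" using assms by (simp add: abs_square_less_1)
  have "((\<lambda>x. x / sqrt (1 - x\<^sup>2)) has_real_derivative
      (1 * sqrt (1 - x\<^sup>2) - x * ((- 2 * x) * (inverse (sqrt (1 - x\<^sup>2)) / 2))) / (sqrt (1 - x\<^sup>2) * sqrt (1 - x\<^sup>2))) (at x)"
    using p by (auto intro!: derivative_eq_intros simp: field_simps)
  moreover have "(1 * sqrt (1 - x\<^sup>2) - x * ((- 2 * x) * (inverse (sqrt (1 - x\<^sup>2)) / 2))) / (sqrt (1 - x\<^sup>2) * sqrt (1 - x\<^sup>2))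
     = 1 / ((1 - x\<^sup>2) * sqrt (1 - x\<^sup>2))"
  proof -
    define s where "s = sqrt (1 - x\<^sup>2)"
    have s: "s > 0" "s * s = 1 - x\<^sup>2" using p by (auto simp: s_def)
    have "(1 * s - x * ((- 2 * x) * (inverse s / 2))) / (s * s) = (s * s + x\<^sup>2) / (s * (s * s))"
      using s(1) by (simp add: field_simps power2_eq_square)
    also have "\<dots> = 1 / ((s * s) * s)" using s by simp
    finally show ?thesis using s(2) by (simp add: s_def)
  qed
  ultimately show ?thesis by simp
qed

lemma chart_der:
  assumes "x \<in> {0<..<1}"
  shows "((\<lambda>x. x / sqrt (1 - x\<^sup>2)) has_real_derivative (x / sqrt (1 - x\<^sup>2)) / (x * (1 - x\<^sup>2))) (at x)"
  by (rule DERIV_cong[OF chart_deriv]) (use assms in auto)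

lemma psi_der:
  assumes "x \<in> {0<..<1}"
  shows "((\<lambda>x. (x / sqrt (1 - x\<^sup>2)) powr \<nu>) has_real_derivative \<nu> * (x / sqrt (1 - x\<^sup>2)) powr \<nu> / (x * (1 - x\<^sup>2))) (at x)"
proof -
  have p: "1 - x\<^sup>2 > 0" "x > 0" using assms abs_square_less_1[of x] by auto
  then have pos: "x / sqrt (1 - x\<^sup>2) > 0" by simp
  define y where "y = x / sqrt (1 - x\<^sup>2)"
  have D: "((\<lambda>x. (x / sqrt (1 - x\<^sup>2)) powr \<nu>) has_real_derivative
      \<nu> * y powr (\<nu> - 1) * (y / (x * (1 - x\<^sup>2)))) (at x)"
    unfolding y_def
    by (rule DERIV_chain2[where g = "\<lambda>x. x / sqrt (1 - x\<^sup>2)", OF has_real_derivative_powr[OF pos] chart_der[OF assms]])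
  have "y powr (\<nu> - 1) * y = y powr \<nu>"
    using powr_mult_base[of y "\<nu> - 1"] pos unfolding y_def by (simp add: mult.commute)
  then have "\<nu> * y powr (\<nu> - 1) * (y / (x * (1 - x\<^sup>2))) = \<nu> * y powr \<nu> / (x * (1 - x\<^sup>2))"
    by (metis mult.assoc times_divide_eq_right)
  with D show ?thesis unfolding y_def by simp
qed

lemma Ck_powr_fun: "Ck k (UNIV \<times> {0<..}) (\<lambda>(\<mu>::'p::topological_space) x. x powr \<nu>)"
proof (induction k arbitrary: \<nu>)
  case 0 show ?case by (auto simp: case_prod_beta intro!: continuous_intros)
next
  case (Suc k)
  have "Ck k (UNIV \<times> {0<..}) (\<lambda>(\<mu>::'p) x. \<nu> * x powr (\<nu> - 1))"
    by (intro Ck_mult Ck_const Suc)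
  then show ?case
    by (rule Ck_SucI[rotated])
      (auto simp: case_prod_beta intro!: continuous_intros has_real_derivative_powr)
qed

lemma Ck_iterated_deriv:
  assumes "open_slices W" "\<And>k. Ck k W f"
  shows "Ck k W (\<lambda>\<mu>. (deriv ^^ i) (f \<mu>))"
  using assms by (induction i arbitrary: k) (auto intro: Ck_deriv(1))

lemma Ck_smooth_at:
  assumes "open_slices W" "\<And>k. Ck k W f" "(\<mu>, x) \<in> W"
  shows "smooth_at (f \<mu>) x"
  unfolding smooth_at_def
  using Ck_deriv(2)[OF assms(1) Ck_iterated_deriv[OF assms(1,2)] assms(3)] by simp

text \<open>With a dummy parameter, the closure properties of \<open>Ck\<close> suffice; 1 - x^2 is
  written as a sum of products to fit them.\<close>

lemma psi_smooth_at: "x \<in> {0<..<1} \<Longrightarrow> smooth_at (psi \<nu>) x"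
proof -
  assume x: "x \<in> {0<..<1}"
  let ?W = "(UNIV :: real set) \<times> {0<..<1::real}"
  have one: "Ck k ?W (\<lambda>_ x. 1 + - 1 * (x * x))" for k
    by (intro Ck_add Ck_mult Ck_const Ck_ident)
  have pos: "1 + - 1 * (x * x) > 0" if "(\<mu>, x) \<in> ?W" for \<mu> x
    using unit_interval_pos[of x] that by (auto simp: power2_eq_square)
  have u: "Ck k ?W (\<lambda>_ x. x * inverse (sqrt (1 + - 1 * (x * x))))" for k
    by (intro Ck_mult Ck_ident Ck_inverse Ck_sqrt one) (use pos in force)+
  have "Ck k ?W (\<lambda>_ x. (x * inverse (sqrt (1 + - 1 * (x * x)))) powr \<nu>)" for k
    by (rule Ck_compose[OF _ Ck_powr_fun u]) (use pos in force)
  moreover have "Ck k ?W (\<lambda>_ x. inverse (1 + - 1 * (x * x)))" for k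
    by (intro Ck_inverse one) (use pos in force)
  ultimately have "Ck k ?W (\<lambda>_ x. inverse (1 + - 1 * (x * x)) * (x * inverse (sqrt (1 + - 1 * (x * x)))) powr \<nu>)" for k
    by (intro Ck_mult)
  moreover have "(\<lambda>x. inverse (1 + - 1 * (x * x)) * (x * inverse (sqrt (1 + - 1 * (x * x)))) powr \<nu>) = psi \<nu>"
    by (simp add: psi_def[abs_def] divide_inverse power2_eq_square)
  ultimately have "Ck k ?W (\<lambda>_. psi \<nu>)" for k by simp
  from Ck_smooth_at[OF open_slices_Times this, of 0 x] x show ?thesis by simp
qed

text \<open>An identity for the i-th iterate on the whole interval may be differentiated, which
  gives the next iterate at a point.\<close>

lemma euler_iter_Suc:
  assumes "\<And>x. x \<in> {0<..<1} \<Longrightarrow> euler_iter f i x = F x" "x \<in> {0<..<1}" "smooth_at f x"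
    and "(F has_real_derivative d) (at x)"
  shows "euler_iter f (Suc i) x = x * (1 - x\<^sup>2) * d"
proof -
  obtain d' where d': "(euler_iter f i has_real_derivative d') (at x)" "x * (1 - x\<^sup>2) * d' = euler_iter f (Suc i) x"
    using euler_iter_der[OF assms(3)] by blast
  have "(euler_iter f i has_real_derivative d) (at x)"
    by (rule has_field_derivative_transform_within_open[OF assms(4), of "{0<..<1}"]) (use assms in auto)
  from DERIV_unique[OF d'(1) this] d'(2) show ?thesis by simp
qed

text \<open>In the chart, (1 - x^2) \<open>psi\<close> is the power of u with exponent \<nu>, an
  eigenfunction of u d/du with eigenvalue \<nu>.\<close>

lemma euler_iter_psi:
  "x \<in> {0<..<1} \<Longrightarrow> euler_iter (psi \<nu>) i x = \<nu> ^ i * (x / sqrt (1 - x\<^sup>2)) powr \<nu>"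
proof (induction i arbitrary: x)
  case 0
  have "euler_iter (psi \<nu>) 0 x = (1 - x\<^sup>2) * psi \<nu> x"
    by (simp add: euler_iter_def power2_eq_square)
  also have "\<dots> = (x / sqrt (1 - x\<^sup>2)) powr \<nu>" using unit_interval_pos[OF 0] by (simp add: psi_def)
  finally show ?case by simp
next
  case (Suc i)
  have "((\<lambda>x. \<nu> ^ i * (x / sqrt (1 - x\<^sup>2)) powr \<nu>) has_real_derivative
    \<nu> ^ i * (\<nu> * (x / sqrt (1 - x\<^sup>2)) powr \<nu> / (x * (1 - x\<^sup>2)))) (at x)"
    by (rule DERIV_cmult[OF psi_der[OF Suc.prems]])
  from euler_iter_Suc[OF Suc.IH Suc.prems psi_smooth_at[OF Suc.prems] this]
  show ?case using unit_interval_pos[OF Suc.prems] Suc.prems by simp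
qed

section \<open>The Wronskian as a polynomial in the Euler operator\<close>

definition vandermonde :: "real list \<Rightarrow> real" where
  "vandermonde \<nu>s = Determinant.det (Matrix.mat (length \<nu>s) (length \<nu>s) (\<lambda>(i, j). (\<nu>s ! j) ^ i))"

definition root_poly :: "real list \<Rightarrow> real poly" where
  "root_poly \<nu>s = (\<Prod>\<nu>\<leftarrow>\<nu>s. [:- \<nu>, 1:])"

lemma root_poly_degree: "degree (root_poly \<nu>s) = length \<nu>s" and root_poly_monic: "coeff (root_poly \<nu>s) (length \<nu>s) = 1"
proof -
  have "coeff (root_poly \<nu>s) (degree (root_poly \<nu>s)) = 1 \<and> degree (root_poly \<nu>s) = length \<nu>s"
  proof (induction \<nu>s)
    case (Cons \<nu> \<nu>s)
    then have "root_poly \<nu>s \<noteq> 0" by (metis coeff_0 zero_neq_one)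
    moreover have "root_poly (\<nu> # \<nu>s) = [:- \<nu>, 1:] * root_poly \<nu>s" by (simp add: root_poly_def)
    ultimately show ?case using Cons by (simp only: lead_coeff_mult) (auto simp: degree_mult_eq simp del: mult_pCons_left)
  qed (simp add: root_poly_def)
  then show "degree (root_poly \<nu>s) = length \<nu>s" "coeff (root_poly \<nu>s) (length \<nu>s) = 1" by auto
qed

lemma root_poly_root: "\<nu> \<in> set \<nu>s \<Longrightarrow> poly (root_poly \<nu>s) \<nu> = 0"
  by (induction \<nu>s) (auto simp: root_poly_def)

lemma prod_list_diag_mat: "prod_list (diag_mat (Matrix.mat n n f)) = (\<Prod>i<n. f (i, i))"
  unfolding diag_mat_def by (subst prod.list_conv_set_nth) (auto simp: atLeast0LessThan intro!: prod.cong)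

text \<open>A triangular matrix turns the Wronskian matrix into the matrix of Euler iterates, whose columns are
  \<open>\<nu>\<^sub>j ^ i\<close> times a power of \<open>u\<close>.  Adding multiples of the other rows to the last one with the coefficients
  of the polynomial with roots \<open>\<nu>\<^sub>j\<close> makes the last row vanish except for its last entry.\<close>

lemma D_op_formula:
  assumes x: "x \<in> {0<..<1}" and f: "smooth_at f x"
  shows "D_op \<nu>s f x = vandermonde \<nu>s / (1 - x\<^sup>2) *
    (\<Sum>k\<le>length \<nu>s. coeff (root_poly \<nu>s) k * euler_iter f k x)"
proof -
  define n where "n = length \<nu>s"
  define p where "p = root_poly \<nu>s"
  define fs where "fs = map psi \<nu>s @ [f]"
  define L where "L = (\<Sum>k\<le>n. coeff p k * euler_iter f k x)"
  define u where "u \<nu> = (x / sqrt (1 - x\<^sup>2)) powr \<nu>" for \<nu>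
  define r where "r = 1 - x\<^sup>2"
  have r: "r > 0" using unit_interval_pos[OF x] by (simp add: r_def)
  have u: "u \<nu> > 0" for \<nu> using x r by (simp add: u_def r_def)
  let ?N = "Suc n"
  let ?Wr = "Matrix.mat ?N ?N (\<lambda>(i, j). (deriv ^^ i) (fs ! j) x)"
  let ?C = "Matrix.mat ?N ?N (\<lambda>(i, k). poly (euler_coeff i k) x)"
  let ?R = "Matrix.mat ?N ?N (\<lambda>(i, k). if i < n then (if i = k then 1 else 0) else coeff p k)"
  let ?E = "Matrix.mat ?N ?N (\<lambda>(i, j). euler_iter (fs ! j) i x)"
  let ?M = "Matrix.mat ?N ?N (\<lambda>(i, j). if i < n then euler_iter (fs ! j) i x else \<Sum>k\<le>n. coeff p k * euler_iter (fs ! j) k x)"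
  have CW: "?C * ?Wr = ?E"
  proof (rule eq_matI)
    fix i j assume "i < dim_row ?E" "j < dim_col ?E"
    then have ij: "i < ?N" "j < ?N" by auto
    have "(?C * ?Wr) $$ (i, j) = (\<Sum>k<?N. poly (euler_coeff i k) x * (deriv ^^ k) (fs ! j) x)"
      using ij by (simp add: scalar_prod_def atLeast0LessThan)
    also have "\<dots> = (\<Sum>k\<le>i. poly (euler_coeff i k) x * (deriv ^^ k) (fs ! j) x)"
      using ij by (intro sum.mono_neutral_right) (auto simp: euler_coeff_upper)
    finally show "(?C * ?Wr) $$ (i, j) = ?E $$ (i, j)" using ij by (simp add: euler_iter_def)
  qed auto
  have RE: "?R * ?E = ?M"
  proof (rule eq_matI)
    fix i j assume "i < dim_row ?M" "j < dim_col ?M"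
    then have ij: "i < ?N" "j < ?N" by auto
    have "(?R * ?E) $$ (i, j) = (\<Sum>k<?N. (if i < n then (if i = k then 1 else 0) else coeff p k) * euler_iter (fs ! j) k x)"
      using ij by (simp add: scalar_prod_def atLeast0LessThan)
    also have "\<dots> = ?M $$ (i, j)"
    proof (cases "i < n")
      case True
      have "(\<Sum>k<?N. (if i = k then 1 else 0) * euler_iter (fs ! j) k x) = (\<Sum>k<?N. if i = k then euler_iter (fs ! j) k x else 0)"
        by (intro sum.cong) auto
      then show ?thesis using True ij by simp
    qed (use ij in \<open>simp add: lessThan_Suc_atMost\<close>)
    finally show "(?R * ?E) $$ (i, j) = ?M $$ (i, j)" .
  qed auto
  \<comment> \<open>The product of the diagonal is r^(n+1) times the power of x (1 - x^2) that
    stands in \<open>D_op\<close>. The denominators of the \<open>psi\<close> absorb r^n, which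
    leaves the single factor 1 / (1 - x^2) of the result.\<close>
  have detC: "Determinant.det ?C = (\<Prod>i<?N. r * (x * r) ^ i)"
    by (subst det_lower_triangular[of ?N])
      (auto simp: euler_coeff_upper prod_list_diag_mat euler_coeff_diag poly_power r_def power2_eq_square algebra_simps
        simp del: mult_pCons_left intro!: prod.cong)
  have detR: "Determinant.det ?R = 1"
    by (subst det_lower_triangular[of ?N])
      (auto simp: prod_list_diag_mat p_def n_def root_poly_monic)
  have fsn: "fs ! n = f" by (simp add: fs_def n_def nth_append)
  have fsj: "fs ! j = psi (\<nu>s ! j)" if "j < n" for j using that by (simp add: fs_def n_def nth_append)
  have last_row: "(\<Sum>k\<le>n. coeff p k * euler_iter (fs ! j) k x) = 0" if "j < n" for j
  proof -
    have "(\<Sum>k\<le>n. coeff p k * euler_iter (fs ! j) k x) = (\<Sum>k\<le>n. coeff p k * (\<nu>s ! j) ^ k) * u (\<nu>s ! j)"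
      unfolding fsj[OF that] euler_iter_psi[OF x] by (simp add: sum_distrib_right u_def mult.assoc)
    also have "(\<Sum>k\<le>n. coeff p k * (\<nu>s ! j) ^ k) = poly p (\<nu>s ! j)"
      unfolding poly_altdef p_def root_poly_degree n_def ..
    also have "\<dots> = 0" unfolding p_def by (rule root_poly_root) (use that in \<open>simp add: n_def\<close>)
    finally show ?thesis by simp
  qed
  let ?A = "Matrix.mat n n (\<lambda>(i, j). (\<nu>s ! j) ^ i)"
  let ?U = "Matrix.mat n n (\<lambda>(i, j). if i = j then u (\<nu>s ! j) else 0)"
  have "mat_delete ?M n n = ?A * ?U"
  proof (rule eq_matI)
    fix i j assume "i < dim_row (?A * ?U)" "j < dim_col (?A * ?U)"
    then have ij: "i < n" "j < n" by auto
    have "(?A * ?U) $$ (i, j) = (\<Sum>k<n. (\<nu>s ! k) ^ i * (if k = j then u (\<nu>s ! j) else 0))"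
      using ij by (simp add: scalar_prod_def atLeast0LessThan)
    also have "\<dots> = (\<Sum>k<n. if k = j then (\<nu>s ! k) ^ i * u (\<nu>s ! j) else 0)"
      by (intro sum.cong) auto
    finally show "mat_delete ?M n n $$ (i, j) = (?A * ?U) $$ (i, j)"
      using ij by (simp add: mat_delete_def fsj euler_iter_psi[OF x] u_def)
  qed (auto simp: mat_delete_def)
  moreover have "Determinant.det ?U = (\<Prod>j<n. u (\<nu>s ! j))"
    by (subst det_lower_triangular[of n]) (auto simp: prod_list_diag_mat)
  ultimately have minor: "Determinant.det (mat_delete ?M n n) = vandermonde \<nu>s * (\<Prod>j<n. u (\<nu>s ! j))"
    by (simp add: det_mult[of _ n] vandermonde_def n_def)
  have "Determinant.det ?M = (\<Sum>j<?N. ?M $$ (n, j) * cofactor ?M n j)"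
    by (rule laplace_expansion_row) auto
  also have "\<dots> = L * cofactor ?M n n"
    by (simp add: last_row fsn L_def)
  also have "\<dots> = L * (vandermonde \<nu>s * (\<Prod>j<n. u (\<nu>s ! j)))"
    unfolding cofactor_def minor by (simp add: power_add[symmetric] mult_2[symmetric])
  finally have detM: "Determinant.det ?M = L * (vandermonde \<nu>s * (\<Prod>j<n. u (\<nu>s ! j)))" .
  have "Determinant.det ?M = Determinant.det ?R * (Determinant.det ?C * Determinant.det ?Wr)"
    unfolding RE[symmetric] CW[symmetric]
    by (simp only: det_mult[OF mat_carrier mult_carrier_mat[OF mat_carrier mat_carrier]]
      det_mult[OF mat_carrier mat_carrier])
  then have W: "Determinant.det ?C * Determinant.det ?Wr = L * (vandermonde \<nu>s * (\<Prod>j<n. u (\<nu>s ! j)))"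
    using detM detR by simp
  have tri: "(\<Sum>i<?N. i) = n * (n + 1) div 2"
    by (simp add: lessThan_Suc_atMost gauss_sum_nat atMost_atLeast0)
  have "Determinant.det ?C = r ^ ?N * (x * r) ^ (n * (n + 1) div 2)"
    unfolding detC prod.distrib power_sum[symmetric] tri by simp
  moreover have "wronskian fs x = Determinant.det ?Wr"
    by (simp add: wronskian_def fs_def n_def)
  ultimately have W': "r ^ ?N * ((x * r) ^ (n * (n + 1) div 2) * wronskian fs x) = L * vandermonde \<nu>s * (\<Prod>j<n. u (\<nu>s ! j))"
    using W by (simp add: mult_ac)
  have "(\<Prod>\<nu>\<leftarrow>\<nu>s. psi \<nu> x) = (\<Prod>j<n. u (\<nu>s ! j) / r)"
    by (subst prod.list_conv_set_nth) (auto simp: n_def psi_def u_def r_def atLeast0LessThan intro!: prod.cong)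
  then have psis: "(\<Prod>\<nu>\<leftarrow>\<nu>s. psi \<nu> x) = (\<Prod>j<n. u (\<nu>s ! j)) / r ^ n"
    by (simp add: prod_dividef)
  have up: "(\<Prod>j<n. u (\<nu>s ! j)) > 0" using u by (intro prod_pos) auto
  have "D_op \<nu>s f x = (x * r) ^ (n * (n + 1) div 2) * wronskian fs x * r ^ n / (\<Prod>j<n. u (\<nu>s ! j))"
    by (simp add: D_op_def Let_def n_def[symmetric] r_def[symmetric] fs_def[symmetric] psis)
  also have "\<dots> = (r ^ ?N * ((x * r) ^ (n * (n + 1) div 2) * wronskian fs x)) / (r * (\<Prod>j<n. u (\<nu>s ! j)))"
    using r up by (simp add: field_simps)
  also have "\<dots> = vandermonde \<nu>s / r * L"
  proof -
    have "L * v * z / (r * z) = v / r * L" if "z > 0" for v z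
      using that r by (simp add: field_simps)
    from this[OF up] show ?thesis unfolding W' .
  qed
  finally show ?thesis by (simp add: r_def L_def n_def p_def)
qed

section \<open>Positivity of averages\<close>

definition averaging :: "(real \<Rightarrow> real) \<Rightarrow> real \<Rightarrow> real" where
  "averaging \<phi> t = integral {0..pi / 2} (\<lambda>b. \<phi> (t * sin b))"

text \<open>The Taylor coefficients of \<open>1 / \<surd>(1 - y)\<close>; \<open>remainder m b\<close> below is \<open>cos b\<close> times the \<open>m\<close>-th Taylor
  remainder at \<open>y = sin\<^sup>2 b\<close>.\<close>

primrec cbin :: "nat \<Rightarrow> real" where
  "cbin 0 = 1"
| "cbin (Suc k) = cbin k * (2 * real k + 1) / (2 * real k + 2)"

lemma cbin_pos: "0 < cbin k" and cbin_le: "cbin k \<le> 1"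
proof -
  have "0 < cbin k \<and> cbin k \<le> 1"
  proof (induction k)
    case (Suc k)
    have "cbin k * (2 * real k + 1) \<le> 1 * (2 * real k + 2)"
      using Suc by (intro mult_mono) auto
    then show ?case using Suc by simp
  qed simp
  then show "0 < cbin k" "cbin k \<le> 1" by auto
qed

lemma cbin_rec: "(2 * real k + 2) * cbin (Suc k) = cbin k * (2 * real k + 1)"
  by simp

declare cbin.simps(2) [simp del]

definition remainder :: "nat \<Rightarrow> real \<Rightarrow> real" where
  "remainder m b = 1 - cos b * (\<Sum>k<m. cbin k * sin b ^ (2 * k))"

text \<open>The recursion (2k + 2) c(k+1) = (2k + 1) c(k) makes all lower terms cancel. The index
  starts at 1, the remainder of order 0 being the constant 1.\<close>

lemma remainder_der:
  "(remainder (Suc m) has_real_derivative 2 * real (Suc m) * cbin (Suc m) * sin b ^ (2 * m + 1)) (at b)"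
proof (induction m)
  case 0
  have "(remainder 1 has_real_derivative sin b) (at b)"
    unfolding remainder_def[abs_def] by (auto intro!: derivative_eq_intros)
  then show ?case by (simp add: cbin.simps(2))
next
  case (Suc m)
  let ?m = "Suc m"
  have e: "remainder (Suc ?m) = (\<lambda>b. remainder ?m b - cbin ?m * (cos b * sin b ^ (2 * ?m)))"
    by (simp add: remainder_def[abs_def] algebra_simps)
  have d: "((\<lambda>b. cos b * sin b ^ (2 * ?m)) has_real_derivative
     2 * real ?m * sin b ^ (2 * m + 1) - (2 * real ?m + 1) * sin b ^ (2 * ?m + 1)) (at b)"
  proof -
    define X where "X = sin b ^ (2 * m + 1)"
    have X: "sin b ^ (2 * ?m - Suc 0) = X" "sin b ^ (2 * ?m) = X * sin b" "sin b ^ (2 * ?m + 1) = X * (sin b)\<^sup>2"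
      by (simp_all add: X_def power2_eq_square mult_ac)
    have "((\<lambda>b. cos b * sin b ^ (2 * ?m)) has_real_derivative
       - sin b * sin b ^ (2 * ?m) + real (2 * ?m) * (cos b * sin b ^ (2 * ?m - Suc 0)) * cos b) (at b)"
      by (rule DERIV_mult[OF DERIV_cos DERIV_power[OF DERIV_sin]])
    moreover have "- sin b * sin b ^ (2 * ?m) + real (2 * ?m) * (cos b * sin b ^ (2 * ?m - Suc 0)) * cos b =
      (cos b)\<^sup>2 * (2 * real ?m * X) - (sin b)\<^sup>2 * X"
      unfolding X by (simp add: power2_eq_square mult_ac)
    ultimately show ?thesis unfolding cos_squared_eq X X_def[symmetric]
      by (simp only:) (simp add: algebra_simps)
  qed
  have "(remainder (Suc ?m) has_real_derivative 2 * real ?m * cbin ?m * sin b ^ (2 * m + 1) -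
     cbin ?m * (2 * real ?m * sin b ^ (2 * m + 1) - (2 * real ?m + 1) * sin b ^ (2 * ?m + 1))) (at b)"
    unfolding e by (intro DERIV_diff Suc DERIV_cmult d)
  moreover have "2 * real ?m * cbin ?m * sin b ^ (2 * m + 1) -
     cbin ?m * (2 * real ?m * sin b ^ (2 * m + 1) - (2 * real ?m + 1) * sin b ^ (2 * ?m + 1))
     = 2 * real (Suc ?m) * cbin (Suc ?m) * sin b ^ (2 * ?m + 1)"
  proof -
    have c: "2 * real (Suc ?m) * cbin (Suc ?m) = cbin ?m * (2 * real ?m + 1)"
      using cbin_rec[of ?m] by simp
    show ?thesis unfolding c by (simp add: algebra_simps)
  qed
  ultimately show ?case by simp
qed

lemma sin_pow_der: "((\<lambda>b. sin b ^ (2 * Suc m)) has_real_derivative 2 * real (Suc m) * sin b ^ (2 * m + 1) * cos b) (at b)"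
  for b :: real
  by (rule DERIV_cong[OF DERIV_power[OF DERIV_sin]]) simp

text \<open>For m > 0 the difference of the two sides vanishes at 0, and its derivative is a
  nonnegative multiple of 1 - cos.\<close>

lemma remainder_lower:
  assumes "0 \<le> b" "b \<le> pi / 2"
  shows "cbin m * sin b ^ (2 * m) \<le> remainder m b"
proof (cases m)
  case 0 then show ?thesis by (simp add: remainder_def)
next
  case (Suc l)
  have "remainder m 0 - cbin m * sin 0 ^ (2 * m) \<le> remainder m b - cbin m * sin b ^ (2 * m)"
  proof (rule DERIV_nonneg_imp_nondecreasing[OF assms(1)])
    fix x assume x: "0 \<le> x" "x \<le> b"
    have "((\<lambda>b. remainder m b - cbin m * sin b ^ (2 * m)) has_real_derivative
      2 * real m * cbin m * sin x ^ (2 * l + 1) - cbin m * (2 * real m * sin x ^ (2 * l + 1) * cos x)) (at x)"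
      unfolding Suc by (intro DERIV_diff DERIV_cmult remainder_der sin_pow_der)
    moreover have "0 \<le> 2 * real m * cbin m * sin x ^ (2 * l + 1) * (1 - cos x)"
      using x assms cbin_pos[of m] by (intro mult_nonneg_nonneg zero_le_power sin_ge_zero) auto
    ultimately show "\<exists>y. ((\<lambda>b. remainder m b - cbin m * sin b ^ (2 * m)) has_real_derivative y) (at x) \<and> 0 \<le> y"
      by (auto simp: algebra_simps)
  qed
  moreover have "(\<Sum>k\<le>l. cbin k * 0 ^ (2 * k)) = (\<Sum>k\<le>l. if k = 0 then 1 else 0)"
    by (intro sum.cong) auto
  then have "remainder m 0 = 0" using Suc by (simp add: remainder_def lessThan_Suc_atMost)
  ultimately show ?thesis using Suc by simp
qed

text \<open>For m > 0 the difference has a derivative with the factor 2 cos - \<open>cbin m\<close>,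
  nonnegative because cos \<ge> 1/2 and the coefficient is at most 1. Near \<pi>/2 no such bound is
  needed.\<close>

lemma remainder_upper:
  assumes "0 \<le> b" "b \<le> pi / 2" "1 / 2 \<le> cos b"
  shows "remainder m b \<le> 2 * sin b ^ (2 * m)"
proof (cases m)
  case 0 then show ?thesis by (simp add: remainder_def)
next
  case (Suc l)
  have "2 * sin 0 ^ (2 * m) - remainder m 0 \<le> 2 * sin b ^ (2 * m) - remainder m b"
  proof (rule DERIV_nonneg_imp_nondecreasing[OF assms(1)])
    fix x assume x: "0 \<le> x" "x \<le> b"
    have "((\<lambda>b. 2 * sin b ^ (2 * m) - remainder m b) has_real_derivative
      2 * (2 * real m * sin x ^ (2 * l + 1) * cos x) - 2 * real m * cbin m * sin x ^ (2 * l + 1)) (at x)"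
      unfolding Suc by (intro DERIV_diff DERIV_cmult remainder_der sin_pow_der)
    moreover have "cos b \<le> cos x" using x assms by (intro cos_monotone_0_pi_le) auto
    then have "0 \<le> 2 * real m * sin x ^ (2 * l + 1) * (2 * cos x - cbin m)"
      using x assms cbin_le[of m] by (intro mult_nonneg_nonneg zero_le_power sin_ge_zero) auto
    ultimately show "\<exists>y. ((\<lambda>b. 2 * sin b ^ (2 * m) - remainder m b) has_real_derivative y) (at x) \<and> 0 \<le> y"
      by (auto simp: algebra_simps)
  qed
  moreover have "(\<Sum>k\<le>l. cbin k * 0 ^ (2 * k)) = (\<Sum>k\<le>l. if k = 0 then 1 else 0)"
    by (intro sum.cong) auto
  then have "remainder m 0 = 0" using Suc by (simp add: remainder_def lessThan_Suc_atMost)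
  ultimately show ?thesis using Suc by simp
qed

lemma integral_sin_substitution:
  assumes "continuous_on {0..t} g" "0 < t"
  shows "integral {0..pi / 2} (\<lambda>b. g (t * sin b) * sin b ^ k * cos b) = integral {0..t} (\<lambda>u. g u * u ^ k) / t ^ (k + 1)"
proof -
  have "((\<lambda>b. (t * cos b) *\<^sub>R (g (t * sin b) * (t * sin b) ^ k)) has_integral integral {t * sin 0..t * sin (pi / 2)} (\<lambda>u. g u * u ^ k)) {0..pi / 2}"
  proof (rule has_integral_substitution[where c = 0 and d = t])
    show "(\<lambda>b. t * sin b) ` {0..pi / 2} \<subseteq> {0..t}"
      using assms(2) by (auto intro!: mult_nonneg_nonneg sin_ge_zero simp: mult_left_le)
    show "continuous_on {0..t} (\<lambda>u. g u * u ^ k)" using assms by (intro continuous_intros)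
    show "((\<lambda>b. t * sin b) has_real_derivative t * cos x) (at x within {0..pi / 2})" for x
      by (auto intro!: derivative_eq_intros)
  qed (use assms in auto)
  then have "((\<lambda>b. t ^ (k + 1) * (g (t * sin b) * sin b ^ k * cos b)) has_integral integral {0..t} (\<lambda>u. g u * u ^ k)) {0..pi / 2}"
    by (simp add: power_mult_distrib mult_ac)
  from integral_unique[OF this] assms(2) show ?thesis
    unfolding integral_mult_right by (simp add: field_simps)
qed

text \<open>Write 1 as the remainder plus cos b times the Taylor polynomial. The factor cos b is the
  Jacobian of u = t sin b, so the second part consists of truncated momenta.\<close>

lemma averaging_decomposition:
  assumes g: "continuous_on {0..t} g" and t: "0 < t"
  shows "averaging g t = integral {0..pi / 2} (\<lambda>b. g (t * sin b) * remainder m b)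
     + (\<Sum>k<m. cbin k * (integral {0..t} (\<lambda>u. g u * u ^ (2 * k)) / t ^ (2 * k + 1)))"
proof -
  have gs: "continuous_on {0..pi / 2} (\<lambda>b. g (t * sin b))"
    using t by (intro continuous_on_compose2[OF g])
      (auto intro!: continuous_intros mult_nonneg_nonneg sin_ge_zero simp: mult_left_le)
  have r: "continuous_on {0..pi / 2} (remainder m)"
    unfolding remainder_def by (intro continuous_intros)
  have "averaging g t = integral {0..pi / 2} (\<lambda>b. g (t * sin b) * remainder m b +
      (\<Sum>k<m. cbin k * (g (t * sin b) * sin b ^ (2 * k) * cos b)))"
    unfolding averaging_def remainder_def
    by (intro integral_cong) (simp add: sum_distrib_left sum_distrib_right algebra_simps)
  also have "\<dots> = integral {0..pi / 2} (\<lambda>b. g (t * sin b) * remainder m b) +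
      integral {0..pi / 2} (\<lambda>b. \<Sum>k<m. cbin k * (g (t * sin b) * sin b ^ (2 * k) * cos b))"
    by (intro Henstock_Kurzweil_Integration.integral_add integrable_continuous_interval continuous_intros gs r)
  also have "integral {0..pi / 2} (\<lambda>b. \<Sum>k<m. cbin k * (g (t * sin b) * sin b ^ (2 * k) * cos b)) =
      (\<Sum>k<m. cbin k * (integral {0..t} (\<lambda>u. g u * u ^ (2 * k)) / t ^ (2 * k + 1)))"
  proof (subst integral_sum)
    show "(\<Sum>k<m. integral {0..pi / 2} (\<lambda>b. cbin k * (g (t * sin b) * sin b ^ (2 * k) * cos b))) =
      (\<Sum>k<m. cbin k * (integral {0..t} (\<lambda>u. g u * u ^ (2 * k)) / t ^ (2 * k + 1)))"
      by (intro sum.cong refl) (simp only: integral_mult_right integral_sin_substitution[OF g t])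
  qed (auto intro!: integrable_continuous_interval continuous_intros gs)
  finally show ?thesis .
qed

text \<open>Since the full momentum is zero, the truncated one is minus its tail; an upper bound for
  \<open>g\<close> therefore gives a lower bound.\<close>

lemma tail_bound:
  assumes g: "continuous_on {0..} g"
    and u0: "1 \<le> u0" "u0 \<le> t" and A: "0 \<le> A"
    and up: "\<And>u. u0 \<le> u \<Longrightarrow> g u \<le> A * u powr (e - 1 - 2 * real m)"
    and k: "k < m" and e: "e \<le> 1"
    and lim: "((\<lambda>t. integral {0..t} (\<lambda>u. g u * u ^ (2 * k))) \<longlongrightarrow> 0) at_top"
  shows "- A * t powr (e - 2 * real m + 2 * real k) \<le> integral {0..t} (\<lambda>u. g u * u ^ (2 * k))"
proof -
  let ?I = "\<lambda>t. integral {0..t} (\<lambda>u. g u * u ^ (2 * k))"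
  let ?p = "e - 2 * real m + 2 * real k"
  have km: "real k + 1 \<le> real m" using k by simp
  \<comment> \<open>This makes the tail convergent and, as 1 / |p| \<le> 1, keeps the constant
    \<open>A\<close> unchanged.\<close>
  then have p: "?p \<le> - 1" using e by simp
  have t: "0 < t" using u0 by simp
  have ci: "continuous_on {0..s} (\<lambda>u. g u * u ^ (2 * k))" for s
    by (intro continuous_intros continuous_on_subset[OF g]) auto
  have b: "?I s - ?I t \<le> A * t powr ?p" if "t \<le> s" for s
  proof -
    have "?I t + integral {t..s} (\<lambda>u. g u * u ^ (2 * k)) = ?I s"
      using t that ci by (intro Henstock_Kurzweil_Integration.integral_combine integrable_continuous_interval) auto
    moreover have "integral {t..s} (\<lambda>u. g u * u ^ (2 * k)) \<le> integral {t..s} (\<lambda>u. A * u powr (?p - 1))"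
    proof (rule integral_le)
      show "(\<lambda>u. g u * u ^ (2 * k)) integrable_on {t..s}"
        by (rule integrable_continuous_interval[OF continuous_on_subset[OF ci[of s]]]) (use t in auto)
      show "(\<lambda>u. A * u powr (?p - 1)) integrable_on {t..s}"
        using t by (intro integrable_continuous_interval continuous_intros) auto
      fix u assume "u \<in> {t..s}"
      then have u: "u0 \<le> u" "0 < u" using u0 by auto
      have "g u * u ^ (2 * k) \<le> A * u powr (e - 1 - 2 * real m) * u ^ (2 * k)"
        using up[OF u(1)] u by (intro mult_right_mono) auto
      also have "\<dots> = A * u powr (?p - 1)"
        using u by (simp add: powr_realpow[symmetric] powr_add[symmetric] mult.assoc algebra_simps)
      finally show "g u * u ^ (2 * k) \<le> A * u powr (?p - 1)" .
    qed
    moreover have "((\<lambda>u. A * u powr (?p - 1)) has_integral A * s powr ?p / ?p - A * t powr ?p / ?p) {t..s}"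
    proof (rule fundamental_theorem_of_calculus[OF that])
      fix u assume "u \<in> {t..s}"
      then have "0 < u" using t by simp
      then have "((\<lambda>u. u powr ?p) has_real_derivative ?p * u powr (?p - 1)) (at u)"
        by (rule has_real_derivative_powr)
      then have "((\<lambda>u. A / ?p * u powr ?p) has_real_derivative A / ?p * (?p * u powr (?p - 1))) (at u)"
        by (rule DERIV_cmult)
      then show "((\<lambda>u. A * u powr ?p / ?p) has_vector_derivative A * u powr (?p - 1)) (at u within {t..s})"
        using p by (simp add: has_real_derivative_iff_has_vector_derivative has_vector_derivative_at_within)
    qed
    then have "integral {t..s} (\<lambda>u. A * u powr (?p - 1)) = A * s powr ?p / ?p - A * t powr ?p / ?p"
      by (rule integral_unique)
    moreover have "A * s powr ?p / ?p \<le> 0" using p A by (intro divide_nonneg_nonpos) auto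
    moreover have "- (A * t powr ?p / ?p) \<le> A * t powr ?p"
    proof -
      have "A * t powr ?p * 1 \<le> A * t powr ?p * (- ?p)" using p A by (intro mult_left_mono) auto
      then show ?thesis using p by (simp add: field_simps)
    qed
    ultimately show ?thesis by linarith
  qed
  have "((\<lambda>s. ?I s - ?I t) \<longlongrightarrow> 0 - ?I t) at_top" by (intro tendsto_intros lim)
  then have "0 - ?I t \<le> A * t powr ?p"
    by (rule tendsto_upperbound) (auto intro!: eventually_mono[OF eventually_ge_at_top[of t]] b)
  then show ?thesis by simp
qed

text \<open>After division by t^(-1-2m) three contributions compete: a bounded one from u \<le> u0,
  the tails of order t^e, and the main one of order t^e K. For |e| \<le> \<delta> and t \<ge> t0 the
  integral K exceeds any prescribed size, whatever the sign of e, so one half of the main term beats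
  each of the others. The thresholds depend on \<open>A1\<close>, \<open>A2\<close>,
  \<open>M\<close>, \<open>u0\<close> and \<open>m\<close> only, which gives uniformity in the
  parameter.\<close>

lemma averaging_positive:
  assumes A1: "0 < A1" and A2: "0 \<le> A2" and M: "0 \<le> M" and u0: "1 \<le> u0"
  obtains t0 \<delta> where "0 < t0" "0 < \<delta>"
    "\<And>g e t. \<lbrakk>continuous_on {0..} g; \<bar>e\<bar> \<le> \<delta>; t0 \<le> t;
       \<And>u. 0 \<le> u \<Longrightarrow> u \<le> u0 \<Longrightarrow> \<bar>g u\<bar> \<le> M;
       \<And>u. u0 \<le> u \<Longrightarrow> A1 * u powr (e - 1 - 2 * real m) \<le> g u;
       \<And>u. u0 \<le> u \<Longrightarrow> g u \<le> A2 * u powr (e - 1 - 2 * real m);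
       \<And>k. k < m \<Longrightarrow> ((\<lambda>t. integral {0..t} (\<lambda>u. g u * u ^ (2 * k))) \<longlongrightarrow> 0) at_top\<rbrakk>
      \<Longrightarrow> 0 < averaging g t"
proof -
  define B where "B = 4 * M * u0 ^ (2 * m + 1)"
  define c where "c = cbin m * A1"
  have c: "0 < c" using A1 cbin_pos by (simp add: c_def)
  have B: "0 \<le> B" using M u0 by (simp add: B_def)
  \<comment> \<open>The size demanded of K: c L / 2 has to beat the tails and c (L / u0) / 2 the
    part u \<le> u0.\<close>
  define L where "L = 1 + 2 * (real m * A2 + 1) / c + 2 * u0 * (B + 1) / c"
  have L1: "1 \<le> L" and La: "real m * A2 + 1 \<le> c * L / 2" and Lb: "B + 1 \<le> c * (L / u0) / 2"
  proof -
    have n: "0 \<le> 2 * (real m * A2 + 1) / c" "0 \<le> 2 * u0 * (B + 1) / c" using A2 B c u0 by auto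
    then show "1 \<le> L" by (simp add: L_def)
    have "c * (2 * (real m * A2 + 1) / c) \<le> c * L" using n c by (intro mult_left_mono) (auto simp: L_def)
    then show "real m * A2 + 1 \<le> c * L / 2" using c by simp
    have "c * (2 * u0 * (B + 1) / c) \<le> c * L" using n c by (intro mult_left_mono) (auto simp: L_def)
    then have "2 * u0 * (B + 1) \<le> c * L" using c by simp
    then show "B + 1 \<le> c * (L / u0) / 2" using u0 by (simp add: field_simps)
  qed
  \<comment> \<open>For |e| \<le> d one has K \<ge> (1 - s0^d) / d, which is at least 1 / (2 d) = L
    as soon as s0^d \<le> 1/2.\<close>
  define d where "d = 1 / (2 * L)"
  have d: "0 < d" "d \<le> 1" "1 / 2 / d = L" using L1 by (auto simp: d_def)
  \<comment> \<open>Solves (u0 / t0)^d = 1/2.\<close>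
  define t0 where "t0 = u0 * 2 powr (1 / d)"
  have two: "2 \<le> 2 powr (1 / d)"
    using powr_mono[of 1 "1 / d" "2::real"] d by simp
  have t0: "2 * u0 \<le> t0" using two u0 by (simp add: t0_def)
  have pos: "0 < averaging g t"
    if g: "continuous_on {0..} g" and e: "\<bar>e\<bar> \<le> d" and t: "t0 \<le> t"
      and gM: "\<And>u. 0 \<le> u \<Longrightarrow> u \<le> u0 \<Longrightarrow> \<bar>g u\<bar> \<le> M"
      and lo: "\<And>u. u0 \<le> u \<Longrightarrow> A1 * u powr (e - 1 - 2 * real m) \<le> g u"
      and up: "\<And>u. u0 \<le> u \<Longrightarrow> g u \<le> A2 * u powr (e - 1 - 2 * real m)"
      and mom: "\<And>k. k < m \<Longrightarrow> ((\<lambda>t. integral {0..t} (\<lambda>u. g u * u ^ (2 * k))) \<longlongrightarrow> 0) at_top"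
    for g e t
  proof -
    have tt: "0 < t" "2 * u0 \<le> t" "u0 \<le> t" using t t0 u0 by auto
    define s0 where "s0 = u0 / t"
    have s0: "0 < s0" "s0 \<le> 1 / 2" using tt u0 by (auto simp: s0_def field_simps)
    \<comment> \<open>Splits the average where t sin b = u0: below, only |g| \<le> M is known;
      above, the two-sided power bounds hold.\<close>
    define b0 where "b0 = arcsin s0"
    have b0: "0 \<le> b0" "b0 \<le> pi / 2" "sin b0 = s0"
      using s0 arcsin_ubound[of s0] arcsin_le_arcsin[of 0 s0] by (auto simp: b0_def)
    have s0d: "s0 powr d \<le> 1 / 2"
    proof -
      have "s0 \<le> 2 powr (- 1 / d)"
      proof -
        have "s0 \<le> u0 / t0" unfolding s0_def using t t0 u0 by (intro divide_left_mono) auto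
        also have "\<dots> = 2 powr (- 1 / d)" using u0 by (simp add: t0_def powr_minus_divide)
        finally show ?thesis .
      qed
      then have "s0 powr d \<le> (2 powr (- 1 / d)) powr d" using s0 d by (intro powr_mono2) auto
      also have "\<dots> = 2 powr (- 1)" unfolding powr_powr using d by simp
      also have "\<dots> = 1 / 2" by (simp add: powr_minus_divide)
      finally show ?thesis .
    qed
    have gs: "continuous_on {0..pi / 2} (\<lambda>b. g (t * sin b))"
      using tt by (intro continuous_on_compose2[OF g]) (auto intro!: continuous_intros mult_nonneg_nonneg sin_ge_zero)
    have rm: "continuous_on {0..pi / 2} (remainder m)" unfolding remainder_def by (intro continuous_intros)
    have grc: "continuous_on {0..pi / 2} (\<lambda>b. g (t * sin b) * remainder m b)" by (intro continuous_intros gs rm)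
    have sub: "{0..b0} \<subseteq> {0..pi / 2}" "{b0..pi / 2} \<subseteq> {0..pi / 2}" using b0 by auto
    have sinb: "sin b \<le> s0" if "b \<in> {0..b0}" for b
      using that b0 by (auto simp: b0(3)[symmetric] intro!: sin_monotone_2pi_le)
    have sinb': "s0 \<le> sin b" if "b \<in> {b0..pi / 2}" for b
      using that b0 by (auto simp: b0(3)[symmetric] intro!: sin_monotone_2pi_le)
    have split: "integral {0..pi / 2} (\<lambda>b. g (t * sin b) * remainder m b) =
        integral {0..b0} (\<lambda>b. g (t * sin b) * remainder m b) + integral {b0..pi / 2} (\<lambda>b. g (t * sin b) * remainder m b)"
      using b0 by (intro Henstock_Kurzweil_Integration.integral_combine[symmetric] integrable_continuous_interval grc) auto
    \<comment> \<open>Here sin b \<le> s0 \<le> 1/2, hence cos b \<ge> 1/2. The constant 4 is the 2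
      of \<open>remainder_upper\<close> times the 2 in 1 \<le> 2 cos b, inserted to obtain an
      explicit primitive.\<close>
    have low: "- B / t ^ (2 * m + 1) \<le> integral {0..b0} (\<lambda>b. g (t * sin b) * remainder m b)"
    proof -
      let ?F = "\<lambda>b. - 4 * M * (sin b ^ (2 * m + 1) / real (2 * m + 1))"
      have F: "((\<lambda>b. - 4 * M * (sin b ^ (2 * m) * cos b)) has_integral ?F b0 - ?F 0) {0..b0}"
      proof (rule fundamental_theorem_of_calculus[OF b0(1)])
        fix x
        have "(?F has_real_derivative - 4 * M * (sin x ^ (2 * m) * cos x)) (at x)"
          by (intro DERIV_cmult DERIV_cong[OF DERIV_cdivide[OF DERIV_power[OF DERIV_sin]]]) (simp del: of_nat_Suc)
        then show "(?F has_vector_derivative - 4 * M * (sin x ^ (2 * m) * cos x)) (at x within {0..b0})"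
          by (simp add: has_real_derivative_iff_has_vector_derivative has_vector_derivative_at_within)
      qed
      have "4 * M * (s0 ^ (2 * m + 1) / real (2 * m + 1)) \<le> 4 * M * (s0 ^ (2 * m + 1) / 1)"
        using M s0 by (intro mult_left_mono divide_left_mono) auto
      also have "\<dots> = B / t ^ (2 * m + 1)"
        unfolding B_def s0_def power_divide by simp
      finally have "- B / t ^ (2 * m + 1) \<le> integral {0..b0} (\<lambda>b. - 4 * M * (sin b ^ (2 * m) * cos b))"
        using integral_unique[OF F] b0(3) by simp
      also have "\<dots> \<le> integral {0..b0} (\<lambda>b. g (t * sin b) * remainder m b)"
      proof (rule integral_le)
        show "(\<lambda>b. - 4 * M * (sin b ^ (2 * m) * cos b)) integrable_on {0..b0}" using F by blast
        show "(\<lambda>b. g (t * sin b) * remainder m b) integrable_on {0..b0}"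
          by (intro integrable_continuous_interval continuous_on_subset[OF grc sub(1)])
        fix b assume b: "b \<in> {0..b0}"
        then have b': "0 \<le> b" "b \<le> pi / 2" using b0 by auto
        have sn: "0 \<le> sin b" using b' by (intro sin_ge_zero) auto
        have cb: "1 / 2 \<le> cos b"
        proof -
          have "(sin b)\<^sup>2 \<le> (1 / 2)\<^sup>2" using sinb[OF b] s0 sn by (intro power_mono) auto
          then have "(1 / 2)\<^sup>2 \<le> (cos b)\<^sup>2" unfolding cos_squared_eq by (simp add: power2_eq_square)
          then show ?thesis by (rule power2_le_imp_le) (use b' cos_ge_zero[of b] in auto)
        qed
        have "0 \<le> cbin m * sin b ^ (2 * m)" using cbin_pos[of m] sn by simp
        then have r: "0 \<le> remainder m b" "remainder m b \<le> 2 * sin b ^ (2 * m)"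
          using remainder_lower[OF b', of m] remainder_upper[OF b' cb, of m] by linarith+
        have "t * sin b \<le> u0" using sinb[OF b] tt by (simp add: s0_def field_simps)
        then have gb: "\<bar>g (t * sin b)\<bar> \<le> M" using sn tt by (intro gM) auto
        have "\<bar>g (t * sin b) * remainder m b\<bar> \<le> M * (2 * sin b ^ (2 * m))"
          unfolding abs_mult using r gb M by (intro mult_mono) auto
        also have "\<dots> \<le> M * (2 * sin b ^ (2 * m) * (2 * cos b))"
        proof (rule mult_left_mono[OF _ M])
          have "2 * sin b ^ (2 * m) * 1 \<le> 2 * sin b ^ (2 * m) * (2 * cos b)"
            using cb sn by (intro mult_left_mono) auto
          then show "2 * sin b ^ (2 * m) \<le> 2 * sin b ^ (2 * m) * (2 * cos b)" by simp
        qed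
        finally show "- 4 * M * (sin b ^ (2 * m) * cos b) \<le> g (t * sin b) * remainder m b" by (simp add: abs_le_iff)
      qed
      finally show ?thesis .
    qed
    define K where "K = integral {b0..pi / 2} (\<lambda>b. sin b powr (e - 1) * cos b)"
    have spos: "0 < sin b" if "b \<in> {b0..pi / 2}" for b using sinb'[OF that] s0 by simp
    have cpos: "0 \<le> cos b" if "b \<in> {b0..pi / 2}" for b using that b0 by (intro cos_ge_zero) auto
    have powi: "(\<lambda>b. a * (sin b powr r * cos b)) integrable_on {b0..pi / 2}" for a r
      using spos by (intro integrable_continuous_interval continuous_intros) force
    have FT: "integral {b0..pi / 2} (\<lambda>b. sin b powr (r - 1) * cos b) = 1 / r - s0 powr r / r" if "r \<noteq> 0" for r
    proof -
      have "((\<lambda>b. sin b powr (r - 1) * cos b) has_integral (sin (pi / 2) powr r / r - sin b0 powr r / r)) {b0..pi / 2}"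
      proof (rule fundamental_theorem_of_calculus[OF b0(2)])
        fix x assume x: "x \<in> {b0..pi / 2}"
        have "((\<lambda>b. sin b powr r) has_real_derivative r * sin x powr (r - 1) * cos x) (at x)"
          by (rule DERIV_chain2[OF has_real_derivative_powr[OF spos[OF x]] DERIV_sin])
        then have "((\<lambda>b. sin b powr r / r) has_real_derivative r * sin x powr (r - 1) * cos x / r) (at x)"
          by (rule DERIV_cdivide)
        then show "((\<lambda>b. sin b powr r / r) has_vector_derivative sin x powr (r - 1) * cos x) (at x within {b0..pi / 2})"
          using that by (simp add: has_real_derivative_iff_has_vector_derivative has_vector_derivative_at_within)
      qed
      from integral_unique[OF this] show ?thesis by (simp add: b0(3))
    qed
    have K1: "L \<le> K"
    proof -
      have "1 / 2 / d \<le> (1 - s0 powr d) / d" using s0d d by (intro divide_right_mono) auto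
      also have "\<dots> = integral {b0..pi / 2} (\<lambda>b. 1 * (sin b powr (d - 1) * cos b))"
        using FT[of d] d by (simp add: diff_divide_distrib)
      also have "\<dots> \<le> integral {b0..pi / 2} (\<lambda>b. 1 * (sin b powr (e - 1) * cos b))"
      proof (rule integral_le[OF powi powi])
        fix b assume b: "b \<in> {b0..pi / 2}"
        have "sin b powr (d - 1) \<le> sin b powr (e - 1)"
          using spos[OF b] e by (intro powr_mono') auto
        then show "1 * (sin b powr (d - 1) * cos b) \<le> 1 * (sin b powr (e - 1) * cos b)"
          using cpos[OF b] by (simp add: mult_right_mono)
      qed
      finally show ?thesis using d(3) by (simp add: K_def)
    qed
    \<comment> \<open>Against the bounded part t^e itself may be small, so it is taken inside the
      integral: t sin b \<ge> u0 \<ge> 1 allows the exponent e to be lowered to -d.\<close>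
    have K2: "L / u0 \<le> t powr e * K"
    proof -
      have "L / u0 \<le> u0 powr (- d) * L"
      proof -
        have "u0 powr (- 1) \<le> u0 powr (- d)" using u0 d by (intro powr_mono) auto
        then have "u0 powr (- 1) * L \<le> u0 powr (- d) * L" using L1 by (intro mult_right_mono) auto
        then show ?thesis using u0 by (simp add: powr_minus_divide)
      qed
      also have "\<dots> \<le> u0 powr (- d) * ((1 - s0 powr d) / d)"
      proof -
        have "1 / 2 / d \<le> (1 - s0 powr d) / d" using s0d d by (intro divide_right_mono) auto
        then show ?thesis using d(3) by (intro mult_left_mono) auto
      qed
      also have "\<dots> = t powr (- d) * (1 / (- d) - s0 powr (- d) / (- d))"
      proof -
        have "u0 = t * s0" using tt by (simp add: s0_def)
        then have "u0 powr (- d) = t powr (- d) * s0 powr (- d)" using tt s0 by (simp add: powr_mult)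
        moreover have "s0 powr (- d) * s0 powr d = 1" using s0 by (simp add: powr_add[symmetric])
        ultimately show ?thesis using d by (simp add: field_simps)
      qed
      also have "\<dots> = t powr (- d) * integral {b0..pi / 2} (\<lambda>b. sin b powr (- d - 1) * cos b)"
        using FT[of "- d"] d by simp
      also have "\<dots> = integral {b0..pi / 2} (\<lambda>b. t powr (- d) * (sin b powr (- d - 1) * cos b))" by simp
      also have "\<dots> \<le> integral {b0..pi / 2} (\<lambda>b. t powr e * (sin b powr (e - 1) * cos b))"
      proof (rule integral_le[OF powi powi])
        fix b assume b: "b \<in> {b0..pi / 2}"
        have "1 \<le> t * sin b" using sinb'[OF b] u0 tt by (simp add: s0_def field_simps)
        then have "(t * sin b) powr (- d) \<le> (t * sin b) powr e" using e by (intro powr_mono) auto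
        then have "(t * sin b) powr (- d) * (cos b / sin b) \<le> (t * sin b) powr e * (cos b / sin b)"
          using cpos[OF b] spos[OF b] by (intro mult_right_mono) auto
        then show "t powr (- d) * (sin b powr (- d - 1) * cos b) \<le> t powr e * (sin b powr (e - 1) * cos b)"
          using tt spos[OF b] by (simp add: powr_mult powr_diff mult_ac)
      qed
      finally show ?thesis by (simp add: K_def)
    qed
    have high: "c * t powr (e - 1 - 2 * real m) * K \<le> integral {b0..pi / 2} (\<lambda>b. g (t * sin b) * remainder m b)"
    proof -
      have "c * t powr (e - 1 - 2 * real m) * K = integral {b0..pi / 2} (\<lambda>b. c * t powr (e - 1 - 2 * real m) * (sin b powr (e - 1) * cos b))"
        by (simp add: K_def)
      also have "\<dots> \<le> integral {b0..pi / 2} (\<lambda>b. g (t * sin b) * remainder m b)"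
      proof (rule integral_le[OF powi])
        show "(\<lambda>b. g (t * sin b) * remainder m b) integrable_on {b0..pi / 2}"
          by (intro integrable_continuous_interval continuous_on_subset[OF grc sub(2)])
        fix b assume b: "b \<in> {b0..pi / 2}"
        then have b': "0 \<le> b" "b \<le> pi / 2" using b0 by auto
        have "u0 \<le> t * sin b" using sinb'[OF b] tt by (simp add: s0_def field_simps)
        then have "A1 * (t * sin b) powr (e - 1 - 2 * real m) \<le> g (t * sin b)" by (rule lo)
        moreover have "cbin m * sin b ^ (2 * m) * cos b \<le> remainder m b"
        proof -
          have "cbin m * sin b ^ (2 * m) * cos b \<le> cbin m * sin b ^ (2 * m) * 1"
            using spos[OF b] cbin_pos[of m] by (intro mult_left_mono) auto
          then show ?thesis using remainder_lower[OF b', of m] by simp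
        qed
        ultimately have "A1 * (t * sin b) powr (e - 1 - 2 * real m) * (cbin m * sin b ^ (2 * m) * cos b) \<le> g (t * sin b) * remainder m b"
        proof (rule mult_mono)
          have "0 \<le> A1 * (t * sin b) powr (e - 1 - 2 * real m)" using A1 by simp
          then show "0 \<le> g (t * sin b)" using lo[OF \<open>u0 \<le> t * sin b\<close>] by linarith
          show "0 \<le> cbin m * sin b ^ (2 * m) * cos b" using spos[OF b] cpos[OF b] cbin_pos[of m] by simp
        qed
        moreover have "(t * sin b) powr (e - 1 - 2 * real m) * sin b ^ (2 * m) = t powr (e - 1 - 2 * real m) * sin b powr (e - 1)"
          using spos[OF b] tt by (simp add: powr_mult powr_realpow[symmetric] powr_add[symmetric] mult.assoc)
        ultimately show "c * t powr (e - 1 - 2 * real m) * (sin b powr (e - 1) * cos b) \<le> g (t * sin b) * remainder m b"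
          by (simp add: c_def mult_ac)
      qed
      finally show ?thesis .
    qed
    have tails: "- (real m * A2) * t powr (e - 1 - 2 * real m) \<le>
        (\<Sum>k<m. cbin k * (integral {0..t} (\<lambda>u. g u * u ^ (2 * k)) / t ^ (2 * k + 1)))"
    proof -
      have "- A2 * t powr (e - 1 - 2 * real m) \<le> cbin k * (integral {0..t} (\<lambda>u. g u * u ^ (2 * k)) / t ^ (2 * k + 1))"
        if k: "k < m" for k
      proof -
        have "- A2 * t powr (e - 2 * real m + 2 * real k) \<le> integral {0..t} (\<lambda>u. g u * u ^ (2 * k))"
          by (rule tail_bound[OF g u0 tt(3) A2 up k _ mom[OF k]]) (use e d in auto)
        then have "- A2 * t powr (e - 2 * real m + 2 * real k) / t ^ (2 * k + 1) \<le> integral {0..t} (\<lambda>u. g u * u ^ (2 * k)) / t ^ (2 * k + 1)"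
          using tt by (intro divide_right_mono) auto
        moreover have "t powr (e - 2 * real m + 2 * real k) / t ^ (2 * k + 1) = t powr (e - 1 - 2 * real m)"
        proof -
          have "t ^ (2 * k + 1) = t powr (2 * real k + 1)"
            using powr_realpow[OF tt(1), of "2 * k + 1"] by (simp add: add.commute)
          moreover have "e - 2 * real m + 2 * real k - (2 * real k + 1) = e - 1 - 2 * real m" by simp
          ultimately show ?thesis by (metis powr_diff)
        qed
        ultimately have "- A2 * t powr (e - 1 - 2 * real m) \<le> integral {0..t} (\<lambda>u. g u * u ^ (2 * k)) / t ^ (2 * k + 1)"
          by (metis times_divide_eq_right)
        then have "cbin k * (- A2 * t powr (e - 1 - 2 * real m)) \<le> cbin k * (integral {0..t} (\<lambda>u. g u * u ^ (2 * k)) / t ^ (2 * k + 1))"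
          using cbin_pos[of k] by (intro mult_left_mono) auto
        moreover have "cbin k * (A2 * t powr (e - 1 - 2 * real m)) \<le> 1 * (A2 * t powr (e - 1 - 2 * real m))"
          using cbin_le A2 by (intro mult_right_mono) auto
        ultimately show ?thesis by simp
      qed
      from sum_mono[of "{..<m}", OF this] show ?thesis by (simp add: mult.assoc)
    qed
    have "t powr (e - 1 - 2 * real m) = t powr e / t ^ (2 * m + 1)"
      using tt by (simp add: powr_diff powr_realpow[symmetric] powr_add) 
    then have "averaging g t \<ge> (c * (t powr e * K) - B - real m * A2 * t powr e) / t ^ (2 * m + 1)"
      using low high tails averaging_decomposition[OF continuous_on_subset[OF g] tt(1), of m] split
      by (simp add: diff_divide_distrib)
    moreover have "c * (t powr e * K) - B - real m * A2 * t powr e > 0"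
    proof -
      have 1: "c * (L / u0) / 2 \<le> c * (t powr e * K) / 2"
        using mult_left_mono[OF K2, of c] c by simp
      have "(c * L / 2) * t powr e \<le> (c * K / 2) * t powr e" using K1 c by (intro mult_right_mono) auto
      moreover have "(real m * A2 + 1) * t powr e \<le> (c * L / 2) * t powr e" using La by (intro mult_right_mono) auto
      ultimately have "(real m * A2 + 1) * t powr e \<le> (c * K / 2) * t powr e" by linarith
      then have 2: "real m * A2 * t powr e + t powr e \<le> c * (t powr e * K) / 2" by (simp add: algebra_simps)
      have "0 < t powr e" using tt by simp
      with 1 2 Lb show ?thesis by linarith
    qed
    ultimately show ?thesis using tt by (meson divide_pos_pos less_le_trans zero_less_power)
  qed
  show thesis
    by (rule that[of t0 d]) (use d t0 u0 pos in auto)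
qed

section \<open>Zeros of averages\<close>

text \<open>A dummy real parameter makes the results on families available for a single
  function.\<close>

definition smooth_line :: "(real \<Rightarrow> real) \<Rightarrow> bool" where
  "smooth_line f \<longleftrightarrow> (\<forall>k. Ck k (UNIV :: (real \<times> real) set) (\<lambda>_. f))"

lemma open_slices_UNIV: "open_slices UNIV"
  by (simp add: open_slices_def)

lemma smooth_line_deriv:
  assumes "smooth_line f"
  shows "smooth_line (deriv f)" "(f has_real_derivative deriv f x) (at x)"
proof -
  have f: "Ck (Suc k) (UNIV :: (real \<times> real) set) (\<lambda>_. f)" for k
    using assms unfolding smooth_line_def by blast
  show "smooth_line (deriv f)"
    unfolding smooth_line_def using Ck_deriv(1)[OF open_slices_UNIV f] by blast
  show "(f has_real_derivative deriv f x) (at x)"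
    by (rule Ck_deriv(2)[OF open_slices_UNIV f]) simp
qed

lemma smooth_line_continuous: "smooth_line f \<Longrightarrow> continuous_on A f"
  using smooth_line_deriv(2) by (meson DERIV_isCont continuous_at_imp_continuous_on)

definition theta :: "(real \<Rightarrow> real) \<Rightarrow> real \<Rightarrow> real" where
  "theta f u = u * deriv f u"

definition euler_shift :: "real \<Rightarrow> (real \<Rightarrow> real) \<Rightarrow> real \<Rightarrow> real" where
  "euler_shift \<nu> f u = theta f u - \<nu> * f u"

lemma smooth_line_euler_shift: "smooth_line f \<Longrightarrow> smooth_line (euler_shift \<nu> f)"
  and smooth_line_theta: "smooth_line f \<Longrightarrow> smooth_line (theta f)"
proof -
  assume f: "smooth_line f"
  then have "Ck k (UNIV :: (real \<times> real) set) (\<lambda>_ u. u * deriv f u)"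
    "Ck k (UNIV :: (real \<times> real) set) (\<lambda>_ u. u * deriv f u + (- \<nu>) * f u)" for k
    using smooth_line_deriv(1)[OF f] unfolding smooth_line_def
    by (intro Ck_add Ck_mult Ck_const Ck_ident; blast)+
  then show "smooth_line (euler_shift \<nu> f)" "smooth_line (theta f)"
    by (simp_all add: smooth_line_def euler_shift_def[abs_def] theta_def[abs_def])
qed

lemma smooth_line_theta_iter: "smooth_line f \<Longrightarrow> smooth_line ((theta ^^ k) f)"
  by (induction k) (auto intro: smooth_line_theta)

lemma theta_iter_euler_shift:
  assumes "smooth_line f"
  shows "(theta ^^ k) (euler_shift \<nu> f) u = (theta ^^ Suc k) f u - \<nu> * (theta ^^ k) f u"
proof (induction k arbitrary: u)
  case 0 show ?case by (simp add: euler_shift_def)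
next
  case (Suc k)
  have "(theta ^^ k) (euler_shift \<nu> f) = (\<lambda>u. (theta ^^ Suc k) f u - \<nu> * (theta ^^ k) f u)"
    using Suc by blast
  moreover have "((\<lambda>u. (theta ^^ Suc k) f u - \<nu> * (theta ^^ k) f u) has_real_derivative
     deriv ((theta ^^ Suc k) f) u - \<nu> * deriv ((theta ^^ k) f) u) (at u)"
    by (intro DERIV_diff DERIV_cmult smooth_line_deriv(2) smooth_line_theta_iter assms)
  ultimately have "deriv ((theta ^^ k) (euler_shift \<nu> f)) u = deriv ((theta ^^ Suc k) f) u - \<nu> * deriv ((theta ^^ k) f) u"
    by (simp add: DERIV_imp_deriv)
  moreover have A: "(theta ^^ Suc k) g u = u * deriv ((theta ^^ k) g) u" for k g u
    by (simp add: theta_def)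
  ultimately show ?case
    by (simp only: A[of k "euler_shift \<nu> f" u] A[of "Suc k" f u] A[of k f u]) (simp add: algebra_simps)
qed

primrec euler_op :: "real list \<Rightarrow> (real \<Rightarrow> real) \<Rightarrow> real \<Rightarrow> real" where
  "euler_op [] f = f"
| "euler_op (\<nu> # \<nu>s) f = euler_op \<nu>s (euler_shift \<nu> f)"

text \<open>Passes from the expanded polynomial in u d/du, which the Wronskian yields, to the
  product of first-order factors to which Rolle's theorem is applied one at a time.\<close>

lemma euler_op_poly:
  "smooth_line f \<Longrightarrow> (\<Sum>k\<le>length \<nu>s. coeff (root_poly \<nu>s) k * (theta ^^ k) f u) = euler_op \<nu>s f u"
proof (induction \<nu>s arbitrary: f)
  case Nil show ?case by (simp add: root_poly_def)
next
  case (Cons \<nu> \<nu>s)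
  let ?p = "root_poly \<nu>s" and ?n = "length \<nu>s"
  have top: "coeff ?p (Suc ?n) = 0" by (rule coeff_eq_0) (simp add: root_poly_degree)
  have p: "root_poly (\<nu> # \<nu>s) = pCons 0 ?p - Polynomial.smult \<nu> ?p" by (simp add: root_poly_def)
  have "(\<Sum>k\<le>Suc ?n. coeff (root_poly (\<nu> # \<nu>s)) k * (theta ^^ k) f u)
     = (\<Sum>k\<le>Suc ?n. coeff (pCons 0 ?p) k * (theta ^^ k) f u) - (\<Sum>k\<le>Suc ?n. \<nu> * (coeff ?p k * (theta ^^ k) f u))"
    unfolding p by (simp only: coeff_diff coeff_smult left_diff_distrib sum_subtractf mult.assoc)
  also have "(\<Sum>k\<le>Suc ?n. coeff (pCons 0 ?p) k * (theta ^^ k) f u) = (\<Sum>k\<le>?n. coeff ?p k * (theta ^^ Suc k) f u)"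
    by (subst sum.atMost_Suc_shift) simp
  also have "(\<Sum>k\<le>Suc ?n. \<nu> * (coeff ?p k * (theta ^^ k) f u)) = (\<Sum>k\<le>?n. \<nu> * (coeff ?p k * (theta ^^ k) f u))"
    by (simp add: top)
  also have "(\<Sum>k\<le>?n. coeff ?p k * (theta ^^ Suc k) f u) - (\<Sum>k\<le>?n. \<nu> * (coeff ?p k * (theta ^^ k) f u)) =
     (\<Sum>k\<le>?n. coeff ?p k * (theta ^^ k) (euler_shift \<nu> f) u)"
    unfolding theta_iter_euler_shift[OF Cons.prems] sum_subtractf[symmetric]
    by (intro sum.cong) (simp_all add: algebra_simps)
  also have "\<dots> = euler_op \<nu>s (euler_shift \<nu> f) u" by (rule Cons.IH[OF smooth_line_euler_shift[OF Cons.prems]])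
  finally show ?case by simp
qed

lemma euler_iter_chart:
  assumes \<phi>: "smooth_line \<phi>" and f: "\<And>x. x \<in> {0<..<1} \<Longrightarrow> (1 - x\<^sup>2) * f x = \<phi> (x / sqrt (1 - x\<^sup>2))"
    and sm: "\<And>x. x \<in> {0<..<1} \<Longrightarrow> smooth_at f x"
  shows "x \<in> {0<..<1} \<Longrightarrow> euler_iter f i x = (theta ^^ i) \<phi> (x / sqrt (1 - x\<^sup>2))"
proof (induction i arbitrary: x)
  case 0
  have "euler_iter f 0 x = (1 - x\<^sup>2) * f x" by (simp add: euler_iter_def power2_eq_square)
  with f[OF 0] show ?case by simp
next
  case (Suc i)
  let ?u = "x / sqrt (1 - x\<^sup>2)"
  have "((\<lambda>x. (theta ^^ i) \<phi> (x / sqrt (1 - x\<^sup>2))) has_real_derivative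
     deriv ((theta ^^ i) \<phi>) ?u * (?u / (x * (1 - x\<^sup>2)))) (at x)"
    by (rule DERIV_chain2[where g = "\<lambda>x. x / sqrt (1 - x\<^sup>2)",
        OF smooth_line_deriv(2)[OF smooth_line_theta_iter[OF \<phi>]] chart_der[OF Suc.prems]])
  from euler_iter_Suc[OF Suc.IH Suc.prems sm[OF Suc.prems] this]
  have "euler_iter f (Suc i) x = x * (1 - x\<^sup>2) * (deriv ((theta ^^ i) \<phi>) ?u * (?u / (x * (1 - x\<^sup>2))))" .
  also have "\<dots> = ?u * deriv ((theta ^^ i) \<phi>) ?u"
  proof -
    have "q * (d * (v / q)) = v * d" if "q \<noteq> 0" for q d v :: real using that by simp
    moreover have "x * (1 - x\<^sup>2) \<noteq> 0" using Suc.prems unit_interval_pos[OF Suc.prems] by simp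
    ultimately show ?thesis by blast
  qed
  finally show ?case by (simp add: theta_def[of "(theta ^^ i) \<phi>"])
qed

lemma D_op_euler:
  assumes "smooth_line \<phi>" "\<And>x. x \<in> {0<..<1} \<Longrightarrow> (1 - x\<^sup>2) * f x = \<phi> (x / sqrt (1 - x\<^sup>2))"
    and "\<And>x. x \<in> {0<..<1} \<Longrightarrow> smooth_at f x" and x: "x \<in> {0<..<1}"
  shows "D_op \<nu>s f x = vandermonde \<nu>s / (1 - x\<^sup>2) * euler_op \<nu>s \<phi> (x / sqrt (1 - x\<^sup>2))"
  unfolding D_op_formula[OF x assms(3)[OF x]] euler_op_poly[OF assms(1), symmetric]
  by (simp only: euler_iter_chart[OF assms])

section \<open>Averages, Euler operators and the count of zeros\<close>

lemma averaging_der: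
  assumes "smooth_line \<phi>"
  shows "(averaging \<phi> has_real_derivative integral {0..pi / 2} (\<lambda>b. deriv \<phi> (t * sin b) * sin b)) (at t)"
proof -
  have c: "continuous_on A (\<lambda>z. \<psi> (p z))" if "smooth_line \<psi>" "continuous_on A p" for \<psi> p and A :: "'a::topological_space set"
    by (rule continuous_on_compose2[OF smooth_line_continuous[OF that(1), of UNIV] that(2)]) simp
  have "((\<lambda>t. integral (cbox 0 (pi / 2)) (\<lambda>b. \<phi> (t * sin b))) has_field_derivative
      integral (cbox 0 (pi / 2)) (\<lambda>b. deriv \<phi> (t * sin b) * sin b)) (at t within UNIV)"
  proof (rule leibniz_rule_field_derivative)
    show "((\<lambda>t. \<phi> (t * sin b)) has_field_derivative deriv \<phi> (x * sin b) * sin b) (at x within UNIV)" for x b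
      by (rule DERIV_chain2[where g = "\<lambda>t. t * sin b", OF smooth_line_deriv(2)[OF assms]])
        (auto intro!: derivative_eq_intros)
    show "(\<lambda>b. \<phi> (x * sin b)) integrable_on cbox 0 (pi / 2)" for x
      by (rule integrable_continuous[OF c[OF assms]]) (intro continuous_intros)
    show "continuous_on (UNIV \<times> cbox 0 (pi / 2)) (\<lambda>(x, b). deriv \<phi> (x * sin b) * sin b)"
    proof -
      have "continuous_on (UNIV \<times> cbox 0 (pi / 2)) (\<lambda>z. deriv \<phi> (fst z * sin (snd z)))"
        by (rule c[OF smooth_line_deriv(1)[OF assms]]) (intro continuous_intros)
      then show ?thesis unfolding case_prod_beta by (intro continuous_on_mult continuous_intros)
    qed
  qed auto
  then show ?thesis by (simp add: averaging_def[abs_def])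
qed

text \<open>Differentiating \<phi>(t sin b) by t d/dt gives the value of u d/du \<phi> at u = t sin
  b.\<close>

lemma euler_shift_averaging:
  assumes "smooth_line \<phi>"
  shows "t * deriv (averaging \<phi>) t - \<nu> * averaging \<phi> t = averaging (euler_shift \<nu> \<phi>) t"
proof -
  have c: "continuous_on {0..pi / 2} (\<lambda>b. \<psi> (t * sin b))" if "smooth_line \<psi>" for \<psi>
    by (rule continuous_on_compose2[OF smooth_line_continuous[OF that, of UNIV]]) (auto intro!: continuous_intros)
  have "averaging (euler_shift \<nu> \<phi>) t = integral {0..pi / 2} (\<lambda>b. t * (deriv \<phi> (t * sin b) * sin b) - \<nu> * \<phi> (t * sin b))"
    by (simp add: averaging_def euler_shift_def theta_def mult_ac)
  also have "\<dots> = integral {0..pi / 2} (\<lambda>b. t * (deriv \<phi> (t * sin b) * sin b)) - integral {0..pi / 2} (\<lambda>b. \<nu> * \<phi> (t * sin b))"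
    by (intro Henstock_Kurzweil_Integration.integral_diff integrable_continuous_interval continuous_intros c assms smooth_line_deriv(1))
  also have "\<dots> = t * deriv (averaging \<phi>) t - \<nu> * averaging \<phi> t"
    unfolding DERIV_imp_deriv[OF averaging_der[OF assms]] by (simp add: averaging_def)
  finally show ?thesis ..
qed

text \<open>The zeros of the derivative are kept below the largest zero of the function. When a
  larger zero is added, the new critical point lies above the old maximum and is distinct from all
  the previous ones.\<close>

lemma rolle_finite:
  fixes F F' :: "real \<Rightarrow> real"
  assumes der: "\<And>t. t0 < t \<Longrightarrow> (F has_real_derivative F' t) (at t)"
    and A: "finite A" "A \<noteq> {}" "A \<subseteq> {t. t0 < t \<and> F t = 0}"
  shows "\<exists>B. finite B \<and> B \<subseteq> {t. t0 < t \<and> t < Max A \<and> F' t = 0} \<and> card A = Suc (card B)"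
  using A
proof (induction A rule: finite_linorder_max_induct)
  case (insert b A)
  show ?case
  proof (cases "A = {}")
    case True then show ?thesis by (intro exI[of _ "{}"]) auto
  next
    case False
    obtain B where B: "finite B" "B \<subseteq> {t. t0 < t \<and> t < Max A \<and> F' t = 0}" "card A = Suc (card B)"
      using insert.IH False insert.prems by auto
    have mA: "Max A \<in> A" "Max A < b" using insert False by auto
    then have z: "t0 < Max A" "F (Max A) = 0" "F b = 0" using insert.prems by auto
    have "\<exists>c>Max A. c < b \<and> (F has_real_derivative 0) (at c)"
    proof (rule Rolle)
      show "continuous_on {Max A..b} F"
      proof (intro continuous_at_imp_continuous_on ballI)
        fix x assume "x \<in> {Max A..b}"
        then have "t0 < x" using z by auto
        from der[OF this] show "isCont F x" by (rule DERIV_isCont)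
      qed
      show "F differentiable (at x)" if "Max A < x" "x < b" for x
        using der[of x] z that real_differentiable_def by auto
    qed (use mA z in auto)
    then obtain c where c: "Max A < c" "c < b" "(F has_real_derivative 0) (at c)" by blast
    have "F' c = 0" using DERIV_unique[OF c(3) der[of c]] c z by simp
    moreover have "Max (insert b A) = b" using insert mA by (intro Max_eqI) (auto intro: less_imp_le)
    moreover have "c \<notin> B" using B c by auto
    moreover have "b \<notin> A" using insert by auto
    ultimately show ?thesis using B c z mA insert
      by (intro exI[of _ "insert c B"]) auto
  qed
qed simp

lemma card_bound_by_finite_subsets:
  assumes "\<And>A. finite A \<Longrightarrow> A \<subseteq> S \<Longrightarrow> card A \<le> n"
  shows "finite S \<and> card S \<le> n"
proof -
  have "finite S"
  proof (rule ccontr)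
    assume "infinite S"
    then obtain A where "A \<subseteq> S" "finite A" "card A = Suc n" using infinite_arbitrarily_large by blast
    with assms show False by fastforce
  qed
  with assms show ?thesis by blast
qed

text \<open>With the integrating factor t^(-\<nu>), the derivative of t^(-\<nu>) times the average
  is t^(-\<nu>-1) times the average of the shifted function. Each factor of the Euler operator thus
  costs at most one zero.\<close>

lemma zeros_averaging:
  assumes "0 \<le> t0"
  shows "smooth_line \<phi> \<Longrightarrow> (\<And>t. t0 < t \<Longrightarrow> averaging (euler_op \<nu>s \<phi>) t \<noteq> 0) \<Longrightarrow>
    finite {t. t0 < t \<and> averaging \<phi> t = 0} \<and> card {t. t0 < t \<and> averaging \<phi> t = 0} \<le> length \<nu>s"
proof (induction \<nu>s arbitrary: \<phi>)
  case Nil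
  then have e: "{t. t0 < t \<and> averaging \<phi> t = 0} = {}" by auto
  show ?case unfolding e by simp
next
  case (Cons \<nu> \<nu>s)
  let ?S = "{t. t0 < t \<and> averaging (euler_shift \<nu> \<phi>) t = 0}"
  have "finite ?S \<and> card ?S \<le> length \<nu>s"
    by (rule Cons.IH[OF smooth_line_euler_shift[OF Cons.prems(1)]]) (use Cons.prems(2) in simp)
  then have IH: "finite ?S" "card ?S \<le> length \<nu>s" by blast+
  define F where "F t = averaging \<phi> t * t powr (- \<nu>)" for t
  define F' where "F' t = averaging (euler_shift \<nu> \<phi>) t * t powr (- \<nu> - 1)" for t
  have der: "(F has_real_derivative F' t) (at t)" if "t0 < t" for t
  proof -
    have t: "0 < t" using that assms by simp
    have d: "(averaging \<phi> has_real_derivative deriv (averaging \<phi>) t) (at t)"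
      using averaging_der[OF Cons.prems(1)] by (metis DERIV_imp_deriv)
    have "(F has_real_derivative (deriv (averaging \<phi>) t * t powr (- \<nu>) + (- \<nu> * t powr (- \<nu> - 1)) * averaging \<phi> t)) (at t)"
      unfolding F_def by (rule DERIV_mult[OF d has_real_derivative_powr[OF t]])
    moreover have "t powr (- \<nu>) = t * t powr (- \<nu> - 1)"
      using powr_mult_base[of t "- \<nu> - 1"] t by simp
    then have "deriv (averaging \<phi>) t * t powr (- \<nu>) + (- \<nu> * t powr (- \<nu> - 1)) * averaging \<phi> t = F' t"
      unfolding F'_def euler_shift_averaging[OF Cons.prems(1), symmetric] by (simp add: algebra_simps)
    ultimately show ?thesis by simp
  qed
  show ?case
  proof (rule card_bound_by_finite_subsets)
    fix A assume A: "finite A" "A \<subseteq> {t. t0 < t \<and> averaging \<phi> t = 0}"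
    show "card A \<le> length (\<nu> # \<nu>s)"
    proof (cases "A = {}")
      case False
      have "A \<subseteq> {t. t0 < t \<and> F t = 0}" using A(2) by (auto simp: F_def)
      from rolle_finite[OF der A(1) False this]
      obtain B where B: "finite B" "B \<subseteq> {t. t0 < t \<and> t < Max A \<and> F' t = 0}" "card A = Suc (card B)"
        by blast
      have "B \<subseteq> ?S" using B(2) assms by (auto simp: F'_def)
      then have "card B \<le> length \<nu>s" using card_mono[OF IH(1)] IH(2) by (meson le_trans)
      with B(3) show ?thesis by simp
    qed simp
  qed
qed

section \<open>Critical energies as zeros of an average\<close>

text \<open>Uses sin (\<pi> - s) = sin s on each half turn and sin (s + \<pi>) = - sin s between the
  halves; this is how the even part of the density arises.\<close>

lemma integral_sin_quarters:
  fixes q :: "real \<Rightarrow> real"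
  assumes q: "continuous_on {-1..1} q"
  shows "integral {0..2 * pi} (\<lambda>s. q (sin s)) = 2 * integral {0..pi / 2} (\<lambda>s. q (sin s) + q (- sin s))"
proof -
  have c: "continuous_on A (\<lambda>s. q (sin s))" "continuous_on A (\<lambda>s. q (- sin s))" for A
    by (rule continuous_on_compose2[OF q]; auto intro!: continuous_intros)+
  note i = integrable_continuous_interval[OF c(1)] integrable_continuous_interval[OF c(2)]
  have half: "integral {0..pi} p = 2 * integral {0..pi / 2} p"
    if p: "continuous_on UNIV p" "\<And>s. p (pi - s) = p s" for p :: "real \<Rightarrow> real"
  proof -
    have "integral {0..pi / 2} p + integral {pi / 2..pi} p = integral {0..pi} p"
      by (intro Henstock_Kurzweil_Integration.integral_combine integrable_continuous_interval
          continuous_on_subset[OF p(1)]) auto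
    moreover have "integral {pi / 2..pi} p = integral {- pi..- pi / 2} (\<lambda>s. p (- s))"
      using integral_reflect_real[where f = p and a = "pi / 2" and b = pi] by simp
    moreover have "integral {- pi..- pi / 2} ((\<lambda>s. p (pi - s)) \<circ> (\<lambda>s. s + pi)) = integral {- pi + pi..- pi / 2 + pi} (\<lambda>s. p (pi - s))"
      by (rule integral_shift) (intro continuous_on_compose2[OF p(1)] continuous_intros, auto)
    moreover have "(\<lambda>s. p (pi - s)) \<circ> (\<lambda>s. s + pi) = (\<lambda>s. p (- s))" by (simp add: fun_eq_iff)
    moreover have "(\<lambda>s. p (pi - s)) = p" using p(2) by (rule ext)
    moreover have "- pi / 2 + pi = pi / 2" by simp
    ultimately have "integral {pi / 2..pi} p = integral {0..pi / 2} p" by (simp only: add.left_inverse)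
    with \<open>integral {0..pi / 2} p + integral {pi / 2..pi} p = integral {0..pi} p\<close> show ?thesis by linarith
  qed
  have "integral {0..pi} (\<lambda>s. q (sin s)) + integral {pi..2 * pi} (\<lambda>s. q (sin s)) = integral {0..2 * pi} (\<lambda>s. q (sin s))"
    by (intro Henstock_Kurzweil_Integration.integral_combine i) auto
  moreover have "integral {0..pi} ((\<lambda>s. q (sin s)) \<circ> (\<lambda>s. s + pi)) = integral {0 + pi..pi + pi} (\<lambda>s. q (sin s))"
    by (rule integral_shift) (rule c)
  moreover have "integral {0..pi} (\<lambda>s. q (sin s)) = 2 * integral {0..pi / 2} (\<lambda>s. q (sin s))"
    by (rule half) (use c in auto)
  moreover have "integral {0..pi} (\<lambda>s. q (- sin s)) = 2 * integral {0..pi / 2} (\<lambda>s. q (- sin s))"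
    by (rule half) (use c in auto)
  moreover have "integral {0..pi / 2} (\<lambda>s. q (sin s) + q (- sin s)) =
      integral {0..pi / 2} (\<lambda>s. q (sin s)) + integral {0..pi / 2} (\<lambda>s. q (- sin s))"
    by (intro Henstock_Kurzweil_Integration.integral_add i)
  ultimately show ?thesis by (simp add: o_def mult_2[symmetric])
qed

text \<open>The substitution sin \<alpha> = c sin b / D, with D^2 = 1 + t^2 sin^2 b and c^2 = 1 +
  t^2, turns (t / c) sin \<alpha> into u / sqrt (1 + u^2) for u = t sin b. Its Jacobian c / D^2
  cancels the weight 1 + u^2.\<close>

lemma averaging_change_of_chart:
  assumes p: "continuous_on {0..<1} p" and t: "0 < t"
    and \<phi>: "\<And>u. 0 \<le> u \<Longrightarrow> \<phi> u * (1 + u\<^sup>2) = p (u / sqrt (1 + u\<^sup>2))"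
  shows "integral {0..pi / 2} (\<lambda>s. p (t / sqrt (1 + t\<^sup>2) * sin s)) = sqrt (1 + t\<^sup>2) * averaging \<phi> t"
proof -
  define c where "c = sqrt (1 + t\<^sup>2)"
  have c: "1 < c" "c\<^sup>2 = 1 + t\<^sup>2" "0 < c" using t by (simp_all add: c_def add_pos_nonneg)
  define D where "D b = sqrt (1 + t\<^sup>2 * (sin b)\<^sup>2)" for b
  have D: "0 < D b" "(D b)\<^sup>2 = 1 + t\<^sup>2 * (sin b)\<^sup>2" for b
  proof -
    have "0 < 1 + t\<^sup>2 * (sin b)\<^sup>2" by (rule add_pos_nonneg) auto
    then show "0 < D b" "(D b)\<^sup>2 = 1 + t\<^sup>2 * (sin b)\<^sup>2" by (auto simp: D_def)
  qed
  define y where "y b = c * sin b / D b" for b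
  have cos2: "1 - (y b)\<^sup>2 = (cos b / D b)\<^sup>2" for b
  proof -
    have "1 - (y b)\<^sup>2 = ((D b)\<^sup>2 - c\<^sup>2 * (sin b)\<^sup>2) / (D b)\<^sup>2"
      using D(1)[of b] by (simp add: y_def power_divide power_mult_distrib diff_divide_distrib)
    also have "(D b)\<^sup>2 - c\<^sup>2 * (sin b)\<^sup>2 = (cos b)\<^sup>2"
      unfolding D(2) c(2) cos_squared_eq by (simp add: algebra_simps)
    finally show ?thesis by (simp add: power_divide)
  qed
  have y01: "0 \<le> y b" "y b \<le> 1" if "b \<in> {0..pi / 2}" for b
  proof -
    show "0 \<le> y b" using that D(1)[of b] c sin_ge_zero[of b] by (simp add: y_def)
    have "0 \<le> 1 - (y b)\<^sup>2" unfolding cos2 by simp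
    then have "(y b)\<^sup>2 \<le> 1\<^sup>2" by simp
    then show "y b \<le> 1" by (rule power2_le_imp_le) simp
  qed
  have Dder: "(D has_real_derivative t\<^sup>2 * sin b * cos b / D b) (at b)" for b
  proof -
    have "((\<lambda>b. 1 + t\<^sup>2 * (sin b)\<^sup>2) has_real_derivative t\<^sup>2 * (2 * sin b * cos b)) (at b)"
      by (auto intro!: derivative_eq_intros)
    from DERIV_chain2[where f = sqrt, OF DERIV_real_sqrt this] show ?thesis
      using D(1)[of b] unfolding D_def by (simp add: field_simps)
  qed
  have yder: "(y has_real_derivative c * cos b / D b ^ 3) (at b)" for b
  proof -
    have "(y has_real_derivative (c * cos b * D b - c * sin b * (t\<^sup>2 * sin b * cos b / D b)) / (D b * D b)) (at b)"
      unfolding y_def using D(1)[of b] by (auto intro!: derivative_eq_intros Dder)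
    moreover have "(c * cos b * D b - c * sin b * (t\<^sup>2 * sin b * cos b / D b)) / (D b * D b) =
       c * cos b * ((D b)\<^sup>2 - t\<^sup>2 * (sin b)\<^sup>2) / D b ^ 3"
      using D(1)[of b] by (simp add: field_simps power2_eq_square power3_eq_cube)
    ultimately show ?thesis unfolding D(2) by simp
  qed
  define al where "al b = arcsin (y b)" for b
  have sin_al: "sin (al b) = y b" if "b \<in> {0..pi / 2}" for b
    using y01[OF that] by (simp add: al_def)
  have al_der: "(al has_real_derivative c / (D b)\<^sup>2) (at b)" if b: "b \<in> {0..<pi / 2}" for b
  proof -
    have cb: "0 < cos b" using b by (intro cos_gt_zero_pi) auto
    have "0 < 1 - (y b)\<^sup>2" unfolding cos2 using cb D(1)[of b] by simp
    then have "\<bar>y b\<bar> < 1" by (simp add: abs_square_less_1)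
    then have "(al has_real_derivative inverse (sqrt (1 - (y b)\<^sup>2)) * (c * cos b / D b ^ 3)) (at b)"
      unfolding al_def[abs_def] by (intro DERIV_chain2[OF DERIV_arcsin yder]) auto
    moreover have "sqrt (1 - (y b)\<^sup>2) = cos b / D b"
      unfolding cos2 using cb D(1)[of b] by simp
    ultimately show ?thesis using cb D(1)[of b] by (simp add: field_simps power2_eq_square power3_eq_cube)
  qed
  have al_cont: "continuous_on {0..pi / 2} al"
    unfolding al_def
  proof (rule continuous_on_arcsin)
    show "continuous_on {0..pi / 2} y" using yder by (meson DERIV_isCont continuous_at_imp_continuous_on)
  qed (use y01 in force)
  let ?\<sigma> = "t / sqrt (1 + t\<^sup>2)"
  have "t < c" by (rule power2_less_imp_less) (use c in auto)
  then have \<sigma>: "0 < ?\<sigma>" "?\<sigma> < 1" using t c(3) by (auto simp: c_def)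
  have "((\<lambda>b. (c / (D b)\<^sup>2) *\<^sub>R p (?\<sigma> * sin (al b))) has_integral
     integral {al 0..al (pi / 2)} (\<lambda>s. p (?\<sigma> * sin s)) - integral {al (pi / 2)..al 0} (\<lambda>s. p (?\<sigma> * sin s))) {0..pi / 2}"
  \<comment> \<open>The arcsine is not differentiable at 1, so b = \<pi>/2 is treated as an
    exceptional point.\<close>
  proof (rule has_integral_substitution_general[where s = "{pi / 2}" and c = 0 and d = "pi / 2"])
    show "al ` {0..pi / 2} \<subseteq> {0..pi / 2}"
    proof
      fix z assume "z \<in> al ` {0..pi / 2}"
      then obtain b where b: "b \<in> {0..pi / 2}" "z = al b" by blast
      show "z \<in> {0..pi / 2}"
        using y01[OF b(1)] arcsin_le_arcsin[of 0 "y b"] arcsin_ubound[of "y b"] b(2) by (simp add: al_def)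
    qed
    show "continuous_on {0..pi / 2} (\<lambda>s. p (?\<sigma> * sin s))"
    proof (rule continuous_on_compose2[OF p])
      show "(\<lambda>s. ?\<sigma> * sin s) ` {0..pi / 2} \<subseteq> {0..<1}"
      proof
        fix z assume "z \<in> (\<lambda>s. ?\<sigma> * sin s) ` {0..pi / 2}"
        then obtain s where s: "s \<in> {0..pi / 2}" "z = ?\<sigma> * sin s" by blast
        have "0 \<le> sin s" "sin s \<le> 1" using s by (auto intro: sin_ge_zero)
        then have "0 \<le> ?\<sigma> * sin s" "?\<sigma> * sin s \<le> ?\<sigma> * 1" using \<sigma> by (auto simp del: times_divide_eq_left intro!: mult_left_mono mult_nonneg_nonneg)
        then show "z \<in> {0..<1}" using \<sigma> s(2) by simp
      qed
    qed (intro continuous_intros)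
    show "(al has_real_derivative c / (D b)\<^sup>2) (at b within {0..pi / 2})" if "b \<in> {0..pi / 2} - {pi / 2}" for b
      by (rule has_field_derivative_at_within[OF al_der]) (use that in auto)
  qed (auto intro: al_cont)
  moreover have "al 0 = 0" by (simp add: al_def y_def)
  moreover have "al (pi / 2) = pi / 2"
  proof -
    have "D (pi / 2) = c" by (simp add: D_def c_def)
    then show ?thesis using c by (simp add: al_def y_def)
  qed
  ultimately have "((\<lambda>b. (c / (D b)\<^sup>2) *\<^sub>R p (?\<sigma> * sin (al b))) has_integral integral {0..pi / 2} (\<lambda>s. p (?\<sigma> * sin s))) {0..pi / 2}"
    by simp
  moreover have "(c / (D b)\<^sup>2) *\<^sub>R p (?\<sigma> * sin (al b)) = c * \<phi> (t * sin b)" if b: "b \<in> {0..pi / 2}" for b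
  proof -
    have "?\<sigma> * sin (al b) = t * sin b / sqrt (1 + (t * sin b)\<^sup>2)"
      unfolding sin_al[OF b] y_def D_def c_def[symmetric] using c by (simp add: power_mult_distrib)
    moreover have "0 \<le> t * sin b" using b t sin_ge_zero[of b] by simp
    ultimately have "p (?\<sigma> * sin (al b)) = \<phi> (t * sin b) * (D b)\<^sup>2"
      using \<phi>[of "t * sin b"] by (simp add: D(2) power_mult_distrib)
    then show ?thesis using D(1)[of b] by simp
  qed
  ultimately have "((\<lambda>b. c * \<phi> (t * sin b)) has_integral integral {0..pi / 2} (\<lambda>s. p (?\<sigma> * sin s))) {0..pi / 2}"
    by (rule has_integral_eq[rotated])
  from integral_unique[OF this] show ?thesis by (simp add: averaging_def c_def)
qed

section \<open>From zeros of the derivative of the period to zeros of the average\<close>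

context annulus_coordinate
begin

text \<open>The period formula is differentiated under the integral in the amplitude z = sqrt h,
  where the integrand is smooth, and the chain rule returns to h.\<close>

lemma critical_energy_integral:
  assumes k'': "\<And>z. \<bar>z\<bar> < sqrt h0 \<Longrightarrow> (k' has_real_derivative k2 z) (at z)"
    and k2: "continuous_on {- sqrt h0<..<sqrt h0} k2"
    and h: "0 < h" "h < h0" and crit: "(period_function V J has_real_derivative 0) (at h)"
  shows "integral {0..2 * pi} (\<lambda>s. sin s * k2 (sqrt h * sin s)) = 0"
proof -
  define \<rho> where "\<rho> z = integral {0..2 * pi} (\<lambda>s. k' (z * sin s) / sqrt 2)" for z
  let ?B = "ball 0 (sqrt h0)"
  have zs: "\<bar>z * sin s\<bar> < sqrt h0" if "z \<in> ?B" for z s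
  proof -
    have "\<bar>z * sin s\<bar> \<le> \<bar>z\<bar> * 1" unfolding abs_mult by (intro mult_left_mono) auto
    then show ?thesis using that by simp
  qed
  have sh: "sqrt h \<in> ?B" using h by simp
  have "((\<lambda>z. integral (cbox 0 (2 * pi)) (\<lambda>s. k' (z * sin s) / sqrt 2)) has_field_derivative
      integral (cbox 0 (2 * pi)) (\<lambda>s. k2 (sqrt h * sin s) * sin s / sqrt 2)) (at (sqrt h) within ?B)"
  proof (rule leibniz_rule_field_derivative)
    show "((\<lambda>z. k' (z * sin s) / sqrt 2) has_field_derivative k2 (z * sin s) * sin s / sqrt 2) (at z within ?B)"
      if "z \<in> ?B" for z s
    proof -
      have "((\<lambda>z. k' (z * sin s)) has_real_derivative k2 (z * sin s) * sin s) (at z)"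
        by (rule DERIV_chain2[where g = "\<lambda>z. z * sin s", OF k''[OF zs[OF that]]]) (auto intro!: derivative_eq_intros)
      from DERIV_cdivide[OF this] show ?thesis by (rule has_field_derivative_at_within)
    qed
    show "(\<lambda>s. k' (z * sin s) / sqrt 2) integrable_on cbox 0 (2 * pi)" if "z \<in> ?B" for z
      using zs[OF that] by (intro integrable_continuous continuous_intros continuous_on_compose2[OF k'_cont])
        (auto simp: abs_less_iff minus_less_iff)
    show "continuous_on (?B \<times> cbox 0 (2 * pi)) (\<lambda>(z, s). k2 (z * sin s) * sin s / sqrt 2)"
      unfolding case_prod_beta using zs
      by (intro continuous_intros continuous_on_compose2[OF k2]) (auto simp: abs_less_iff minus_less_iff)
  qed (use sh in auto)
  then have \<rho>: "(\<rho> has_real_derivative integral {0..2 * pi} (\<lambda>s. k2 (sqrt h * sin s) * sin s / sqrt 2)) (at (sqrt h))"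
    unfolding \<rho>_def[abs_def] using at_within_open[OF sh open_ball] by simp
  have "((\<lambda>h. \<rho> (sqrt h)) has_real_derivative
      integral {0..2 * pi} (\<lambda>s. k2 (sqrt h * sin s) * sin s / sqrt 2) * (inverse (sqrt h) / 2)) (at h)"
    by (rule DERIV_chain2[OF \<rho> DERIV_real_sqrt[OF h(1)]])
  then have "(period_function V J has_real_derivative
      integral {0..2 * pi} (\<lambda>s. k2 (sqrt h * sin s) * sin s / sqrt 2) * (inverse (sqrt h) / 2)) (at h)"
    by (rule has_field_derivative_transform_within_open[of _ _ _ "{0<..<h0}"])
      (use h period_formula in \<open>auto simp: \<rho>_def speed_def[abs_def]\<close>)
  from DERIV_unique[OF this crit] h have "integral {0..2 * pi} (\<lambda>s. k2 (sqrt h * sin s) * sin s / sqrt 2) = 0" by simp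
  then show ?thesis by (simp add: mult.commute)
qed

end

context potential_family
begin

text \<open>The function \<phi> of the overview, extended to all real u; only sums, products,
  inverses and square roots occur, in the form the closure properties of \<open>Ck\<close>
  expect.\<close>

definition chart_density :: "'p \<Rightarrow> real \<Rightarrow> real" where
  "chart_density \<mu> u = inverse (1 + u * u) * P_op (period_density \<mu>) (u * inverse (sqrt (1 + u * u)))"

lemma chart_bound: "\<bar>u * inverse (sqrt (1 + u * u))\<bar> < 1" for u :: real
proof -
  have "sqrt (u * u) < sqrt (1 + u * u)" by (rule real_sqrt_less_mono) simp
  then have u: "\<bar>u\<bar> < sqrt (1 + u * u)" by simp
  then have "0 < sqrt (1 + u * u)" by linarith
  with u have "\<bar>u\<bar> / sqrt (1 + u * u) < 1" by simp
  then show ?thesis by (simp add: abs_mult divide_inverse)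
qed

lemma Ck_P_period_density: "Ck k (D \<times> {-1<..<1}) (\<lambda>\<mu>. P_op (period_density \<mu>))"
proof -
  have "Ck k (D \<times> {-1<..<1}) (\<lambda>\<mu> x. period_density \<mu> x + period_density \<mu> (- 1 * x))"
    by (intro Ck_add Ck_period_density Ck_compose[where f = period_density, OF _ Ck_period_density]
        Ck_mult Ck_const Ck_ident) auto
  then show ?thesis by (simp add: P_op_def[abs_def])
qed

lemma Ck_chart_density: "Ck k (D \<times> UNIV) chart_density"
proof -
  have pos: "1 + u * u > 0" for u :: real by (rule add_pos_nonneg) auto
  have q: "Ck k (D \<times> UNIV) (\<lambda>(\<mu>::'p) u. 1 + u * u)" by (intro Ck_add Ck_mult Ck_const Ck_ident)
  have z: "Ck k (D \<times> UNIV) (\<lambda>(\<mu>::'p) u. u * inverse (sqrt (1 + u * u)))"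
    by (intro Ck_mult Ck_ident Ck_inverse[OF Ck_sqrt[OF q]]) (use pos in \<open>auto simp: less_imp_neq[symmetric]\<close>)
  have "Ck k (D \<times> UNIV) (\<lambda>\<mu> u. P_op (period_density \<mu>) (u * inverse (sqrt (1 + u * u))))"
    by (rule Ck_compose[where f = "\<lambda>\<mu>. P_op (period_density \<mu>)", OF _ Ck_P_period_density z])
      (use chart_bound in \<open>auto simp: abs_less_iff minus_less_iff\<close>)
  moreover have "Ck k (D \<times> UNIV) (\<lambda>(\<mu>::'p) u. inverse (1 + u * u))"
    by (rule Ck_inverse[OF q]) (use pos in \<open>auto simp: less_imp_neq[symmetric]\<close>)
  ultimately show ?thesis unfolding chart_density_def[abs_def] by (rule Ck_mult[rotated])
qed

lemma smooth_chart_density: "\<mu> \<in> D \<Longrightarrow> smooth_line (chart_density \<mu>)"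
proof -
  assume D: "\<mu> \<in> D"
  have "Ck k (UNIV \<times> {x. (\<mu>, x) \<in> D \<times> UNIV}) (\<lambda>_::real. chart_density \<mu>)" for k
    by (rule Ck_slice[OF Ck_chart_density])
  then show ?thesis using D by (simp add: smooth_line_def)
qed

text \<open>For this t the amplitude t / sqrt (1 + t^2) equals sqrt (h / h0), so the change of chart
  applies to the integral of the preceding criterion.\<close>

lemma critical_energy_zero:
  assumes D: "\<mu> \<in> D" and h: "0 < h" "h < h0 \<mu>"
    and crit: "(period_function (V \<mu>) (J \<mu>) has_real_derivative 0) (at h)"
  shows "averaging (chart_density \<mu>) (sqrt (h / (h0 \<mu> - h))) = 0"
proof -
  let ?k = "kf \<mu>" and ?s = "sqrt (h0 \<mu>)"
  define t where "t = sqrt (h / (h0 \<mu> - h))"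
  have t: "0 < t" "t\<^sup>2 = h / (h0 \<mu> - h)" using h by (auto simp: t_def)
  have \<sigma>: "t / sqrt (1 + t\<^sup>2) = sqrt (h / h0 \<mu>)"
  proof -
    have "1 + t\<^sup>2 = h0 \<mu> / (h0 \<mu> - h)" using t h by (simp add: field_simps)
    then show ?thesis using h by (simp add: t_def real_sqrt_divide[symmetric])
  qed
  have \<sigma>s: "sqrt (h / h0 \<mu>) * ?s = sqrt h" using h by (simp add: real_sqrt_mult[symmetric])
  have \<sigma>1: "0 < sqrt (h / h0 \<mu>)" "sqrt (h / h0 \<mu>) < 1" using h by auto
  have Z: "(\<mu>, z) \<in> Z" if "\<bar>z\<bar> < ?s" for z using that D by (simp add: Z_def)
  have "Ck (Suc k) Z (\<lambda>\<mu>. deriv (kf \<mu>))" for k by (rule Ck_deriv(1)[OF Z_slices Ck_kf])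
  note k2 = Ck_deriv[OF Z_slices this]
  have c2: "continuous_on {- ?s<..<?s} (deriv (deriv ?k))"
  proof -
    have "continuous_on {- ?s<..<?s} (\<lambda>y. (\<lambda>(\<mu>, z). deriv (deriv (kf \<mu>)) z) (\<mu>, y))"
      by (rule continuous_on_compose2[OF Ck_continuous[OF k2(1)]]) (auto intro!: continuous_intros simp: Z_def D)
    then show ?thesis by simp
  qed
  have I0: "integral {0..2 * pi} (\<lambda>s. sin s * deriv (deriv ?k) (sqrt h * sin s)) = 0"
    by (rule annulus_coordinate.critical_energy_integral[OF annulus_coordinate[OF D] k2(2)[OF Z] c2 h crit])
  let ?q = "\<lambda>y. period_density \<mu> (sqrt (h / h0 \<mu>) * y)"
  have pd: "continuous_on {-1<..<1} (period_density \<mu>)"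
  proof -
    have "continuous_on {-1<..<1} (\<lambda>y. (\<lambda>(\<mu>, z). period_density \<mu> z) (\<mu>, y))"
      by (rule continuous_on_compose2[OF Ck_continuous[OF Ck_period_density]]) (auto intro!: continuous_intros simp: D)
    then show ?thesis by simp
  qed
  have q: "continuous_on {-1..1} ?q"
  proof (rule continuous_on_compose2[OF pd])
    show "(\<lambda>y. sqrt (h / h0 \<mu>) * y) ` {-1..1} \<subseteq> {-1<..<1}"
    proof
      fix z assume "z \<in> (\<lambda>y. sqrt (h / h0 \<mu>) * y) ` {-1..1}"
      then obtain y where y': "z = sqrt (h / h0 \<mu>) * y" "y \<in> {-1..1}" by (rule imageE)
      then have y: "\<bar>y\<bar> \<le> 1" "z = sqrt (h / h0 \<mu>) * y" by auto
      have "\<bar>z\<bar> \<le> sqrt (h / h0 \<mu>) * 1" unfolding y(2) abs_mult using y \<sigma>1 by (intro mult_mono) auto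
      then have "\<bar>z\<bar> < 1" using \<sigma>1(2) by linarith
      then show "z \<in> {-1<..<1}" by auto
    qed
  qed (intro continuous_intros)
  have "integral {0..2 * pi} (\<lambda>s. ?q (sin s)) = integral {0..2 * pi} (\<lambda>s. sqrt h * (sin s * deriv (deriv ?k) (sqrt h * sin s)))"
  proof (rule integral_cong)
    fix s
    have e: "sqrt (h / h0 \<mu>) * sin s * ?s = sqrt h * sin s" using \<sigma>s by (metis mult.commute mult.left_commute)
    show "?q (sin s) = sqrt h * (sin s * deriv (deriv ?k) (sqrt h * sin s))"
      unfolding period_density_def e by (simp add: numeral_2_eq_2)
  qed
  also have "\<dots> = 0" using I0 by simp
  finally have "integral {0..pi / 2} (\<lambda>s. ?q (sin s) + ?q (- sin s)) = 0"
    unfolding integral_sin_quarters[OF q] by simp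
  then have "integral {0..pi / 2} (\<lambda>s. P_op (period_density \<mu>) (t / sqrt (1 + t\<^sup>2) * sin s)) = 0"
    unfolding \<sigma> by (simp add: P_op_def)
  moreover have "integral {0..pi / 2} (\<lambda>s. P_op (period_density \<mu>) (t / sqrt (1 + t\<^sup>2) * sin s)) = sqrt (1 + t\<^sup>2) * averaging (chart_density \<mu>) t"
  proof (rule averaging_change_of_chart[OF _ t(1)])
    have "continuous_on {0..<1} (\<lambda>x. period_density \<mu> x + period_density \<mu> (- x))"
      by (intro continuous_intros continuous_on_compose2[OF pd]) auto
    then show "continuous_on {0..<1} (P_op (period_density \<mu>))" by (simp add: P_op_def[abs_def])
    fix u :: real
    have "1 + u * u > 0" by (rule add_pos_nonneg) auto
    then show "chart_density \<mu> u * (1 + u\<^sup>2) = P_op (period_density \<mu>) (u / sqrt (1 + u\<^sup>2))"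
      by (simp add: chart_density_def power2_eq_square divide_inverse)
  qed
  moreover have "sqrt (1 + t\<^sup>2) > 0" by (simp add: add_pos_nonneg)
  ultimately show ?thesis unfolding t_def[symmetric] by simp
qed

lemma DP_function_eq:
  assumes D: "\<mu> \<in> D" and x: "x \<in> {0<..<1}"
  shows "DP_function (V \<mu>) (J \<mu>) \<nu>s x =
    vandermonde \<nu>s / (1 - x\<^sup>2) * euler_op \<nu>s (chart_density \<mu>) (x / sqrt (1 - x\<^sup>2))"
proof -
  have "DP_function (V \<mu>) (J \<mu>) \<nu>s = D_op \<nu>s (P_op (period_density \<mu>))"
    by (simp add: DP_function_def Let_def annulus.h0[OF ann[OF D]] period_density_def[abs_def])
  moreover have "D_op \<nu>s (P_op (period_density \<mu>)) x =
    vandermonde \<nu>s / (1 - x\<^sup>2) * euler_op \<nu>s (chart_density \<mu>) (x / sqrt (1 - x\<^sup>2))"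
  proof (rule D_op_euler[OF smooth_chart_density[OF D] _ _ x])
    fix x :: real assume x: "x \<in> {0<..<1}"
    have r: "0 < 1 - x\<^sup>2" by (rule unit_interval_pos[OF x])
    let ?u = "x / sqrt (1 - x\<^sup>2)"
    have u: "1 + ?u * ?u = inverse (1 - x\<^sup>2)" using r by (simp add: field_simps power2_eq_square)
    have "?u * inverse (sqrt (1 + ?u * ?u)) = x" unfolding u using r by (simp add: real_sqrt_inverse)
    then show "(1 - x\<^sup>2) * P_op (period_density \<mu>) x = chart_density \<mu> ?u"
      unfolding chart_density_def u by simp
    show "smooth_at (P_op (period_density \<mu>)) x"
      by (rule Ck_smooth_at[OF open_slices_Times Ck_P_period_density]) (use x D in auto)
  qed
  ultimately show ?thesis by simp
qed

end

section \<open>Momenta and quantification\<close>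

lemma chart_inverse:
  fixes u :: real
  assumes "0 < u"
  defines "x \<equiv> u / sqrt (1 + u\<^sup>2)"
  shows "x \<in> {0<..<1}" "x / sqrt (1 - x\<^sup>2) = u" "1 - x\<^sup>2 = 1 / (1 + u\<^sup>2)"
proof -
  have p: "0 < 1 + u\<^sup>2" by (simp add: add_pos_nonneg)
  show 1: "1 - x\<^sup>2 = 1 / (1 + u\<^sup>2)" using p by (simp add: x_def power_divide field_simps)
  have "0 < 1 - x\<^sup>2" unfolding 1 using p by simp
  then have "\<bar>x\<bar> < 1" by (simp add: abs_square_less_1)
  moreover have "0 < x" using assms p by (simp add: x_def)
  ultimately show "x \<in> {0<..<1}" by simp
  show "x / sqrt (1 - x\<^sup>2) = u" unfolding 1 using p by (simp add: x_def real_sqrt_divide)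
qed

text \<open>The integrable majorant for the momenta, with primitive -2 sqrt (1 - x).\<close>

lemma inverse_sqrt_integrable: "set_integrable lborel {0..1} (\<lambda>x::real. C / sqrt (1 - x))"
proof -
  have "((\<lambda>x::real. 1 / sqrt (1 - x)) has_integral (- 2 * sqrt (1 - 1) - (- 2 * sqrt (1 - 0)))) {0..1}"
  proof (rule fundamental_theorem_of_calculus_interior)
    show "continuous_on {0..1} (\<lambda>x::real. - 2 * sqrt (1 - x))" by (intro continuous_intros)
    fix x :: real assume "x \<in> {0<..<1}"
    then have "((\<lambda>x. - 2 * sqrt (1 - x)) has_real_derivative 1 / sqrt (1 - x)) (at x)"
      by (auto intro!: derivative_eq_intros simp: field_simps)
    then show "((\<lambda>x. - 2 * sqrt (1 - x)) has_vector_derivative 1 / sqrt (1 - x)) (at x)"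
      by (simp add: has_real_derivative_iff_has_vector_derivative)
  qed simp
  then have "(\<lambda>x::real. 1 / sqrt (1 - x)) absolutely_integrable_on {0..1}"
    by (intro nonnegative_absolutely_integrable_1) auto
  then have "integrable lebesgue (\<lambda>x::real. indicator {0..1} x *\<^sub>R (1 / sqrt (1 - x)))"
    by (simp add: set_integrable_def)
  moreover have "(\<lambda>x::real. indicator {0..1} x *\<^sub>R (1 / sqrt (1 - x))) \<in> borel_measurable lborel"
    by measurable
  ultimately have "set_integrable lborel {0..1} (\<lambda>x::real. 1 / sqrt (1 - x))"
    by (simp add: set_integrable_def integrable_completion)
  then have "set_integrable lborel {0..1} (\<lambda>x::real. C * (1 / sqrt (1 - x)))"
    by (intro set_integrable_mult_right)
  then show ?thesis by simp
qed

text \<open>The momenta are assumed to vanish only where they are defined, so integrability comes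
  first: \<xi> + k \<le> 0 leaves no singularity stronger than 1 / sqrt (1 - x). The substitution u
  = x / sqrt (1 - x^2) then turns the vanishing integral into a limit on the half line.\<close>

lemma momentum_limit:
  assumes G: "continuous_on UNIV G"
    and F: "\<And>x. x \<in> {0<..<1} \<Longrightarrow> F x = G (x / sqrt (1 - x\<^sup>2)) / (1 - x\<^sup>2)"
    and z1: "0 \<le> z1" "z1 < 1" and B: "\<And>x. z1 < x \<Longrightarrow> x < 1 \<Longrightarrow> \<bar>F x * (1 - x) powr \<xi>\<bar> \<le> B"
    and \<xi>: "\<xi> + real k \<le> 0"
    and mom: "momentum_defined (Suc k) F \<Longrightarrow> momentum (Suc k) F = 0"
  shows "((\<lambda>t. integral {0..t} (\<lambda>u. G u * u ^ (2 * k))) \<longlongrightarrow> 0) at_top"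
proof -
  define ch where "ch x = x / sqrt (1 - x\<^sup>2)" for x :: real
  define q where "q x = G (ch x) * ch x ^ (2 * k) / ((1 - x\<^sup>2) * sqrt (1 - x\<^sup>2))" for x
  have r: "0 < 1 - x\<^sup>2" if "\<bar>x\<bar> < 1" for x :: real using that by (simp add: abs_square_less_1)
  have chc: "continuous_on {0..<1} ch" "continuous_on {0..s} ch" if "s < 1" for s
    unfolding ch_def using r that by (auto intro!: continuous_intros simp: less_imp_neq[symmetric])
  have qc: "continuous_on {0..s} q" if "s < 1" for s
  proof -
    have "continuous_on {0..s} (\<lambda>x. G (ch x))"
      by (rule continuous_on_compose2[OF G chc(2)[OF that]]) simp
    moreover have "(1 - x\<^sup>2) * sqrt (1 - x\<^sup>2) \<noteq> 0" if "x \<in> {0..s}" for x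
      using r[of x] that \<open>s < 1\<close> by auto
    ultimately show ?thesis unfolding q_def using chc(2)[OF that]
      by (intro continuous_on_divide continuous_on_mult continuous_on_power continuous_intros) auto
  qed
  have qm: "momentum_integrand (Suc k) F x = q x" if "x \<in> {0<..<1}" for x
    unfolding momentum_integrand_def q_def F[OF that] ch_def by (simp add: mult_ac)
  have bd1: "\<bar>q x\<bar> \<le> B / sqrt (1 - x)" if x: "z1 < x" "x < 1" for x
  proof -
    have x01: "x \<in> {0<..<1}" "0 < x" using x z1 by auto
    have rx: "0 < 1 - x\<^sup>2" using r[of x] x01 by simp
    have "x\<^sup>2 \<le> x" using x01 by (simp add: power2_eq_square mult_left_le)
    then have y: "1 - x \<le> 1 - x\<^sup>2" "0 < 1 - x" "1 - x \<le> 1" using x x01 by auto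
    have B0: "0 \<le> B" using B[OF x] by linarith
    have "\<bar>q x\<bar> = \<bar>F x\<bar> / sqrt (1 - x\<^sup>2) * \<bar>ch x\<bar> ^ (2 * k)"
      unfolding qm[OF x01(1), symmetric] momentum_integrand_def ch_def
      using rx by (simp add: abs_mult power_abs)
    also have "\<dots> \<le> \<bar>F x\<bar> / sqrt (1 - x) * (1 / (1 - x)) ^ k"
    proof (rule mult_mono)
      show "\<bar>F x\<bar> / sqrt (1 - x\<^sup>2) \<le> \<bar>F x\<bar> / sqrt (1 - x)" using y by (intro divide_left_mono) auto
      have "\<bar>ch x\<bar>\<^sup>2 = x\<^sup>2 / (1 - x\<^sup>2)" using rx by (simp add: ch_def power_divide)
      also have "\<dots> \<le> 1 / (1 - x)" using y \<open>x\<^sup>2 \<le> x\<close> x by (intro frac_le) auto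
      finally have "(\<bar>ch x\<bar>\<^sup>2) ^ k \<le> (1 / (1 - x)) ^ k" by (intro power_mono) auto
      then show "\<bar>ch x\<bar> ^ (2 * k) \<le> (1 / (1 - x)) ^ k" by (simp add: power_mult)
    qed (use y in auto)
    also have "\<dots> = \<bar>F x * (1 - x) powr \<xi>\<bar> * (1 - x) powr (- (\<xi> + real k)) / sqrt (1 - x)"
    proof -
      have "(1 - x) powr \<xi> * (1 - x) powr (- (\<xi> + real k)) = (1 - x) powr (- real k)"
        by (simp add: powr_add[symmetric])
      also have "\<dots> = (1 / (1 - x)) ^ k"
        using y(2) by (simp add: powr_minus_divide powr_realpow power_one_over)
      finally show ?thesis by (simp add: abs_mult mult_ac)
    qed
    also have "\<dots> \<le> B * 1 / sqrt (1 - x)"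
    proof (intro divide_right_mono mult_mono)
      show "(1 - x) powr (- (\<xi> + real k)) \<le> 1" using y \<xi> by (intro powr_le1) auto
    qed (use B[OF x] B0 y in auto)
    finally show ?thesis by simp
  qed
  have "bounded (q ` {0..z1})" by (intro compact_imp_bounded compact_continuous_image qc z1) auto
  then obtain B' where B': "\<And>x. x \<in> {0..z1} \<Longrightarrow> \<bar>q x\<bar> \<le> B'" unfolding bounded_iff by (metis imageI real_norm_def)
  define C where "C = max B B'"
  \<comment> \<open>At x = 1 both sides are 0, by the convention for division by zero.\<close>
  have bd: "\<bar>q x\<bar> \<le> C / sqrt (1 - x)" if x01: "x \<in> {0..1}" for x
  proof -
    consider "x \<le> z1" | "z1 < x" "x < 1" | "x = 1" using x01 by fastforce
    then show ?thesis
    proof cases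
      case 1
      then have "\<bar>q x\<bar> \<le> B'" using x01 by (intro B') auto
      also have "B' \<le> C" by (simp add: C_def)
      finally have C: "\<bar>q x\<bar> \<le> C" .
      have "0 < sqrt (1 - x)" "sqrt (1 - x) \<le> 1" using 1 z1 x01 by auto
      then have "C * sqrt (1 - x) \<le> C * 1" using C by (intro mult_left_mono) auto
      then have "C \<le> C / sqrt (1 - x)" using \<open>0 < sqrt (1 - x)\<close> by (simp add: field_simps)
      with C show ?thesis by linarith
    next
      case 2
      have "B / sqrt (1 - x) \<le> C / sqrt (1 - x)" using 2 by (intro divide_right_mono) (auto simp: C_def)
      with bd1[OF 2] show ?thesis by linarith
    qed (simp add: q_def)
  qed
  have G_meas: "G \<in> borel_measurable borel" using G by (rule borel_measurable_continuous_onI)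
  have q_meas: "q \<in> borel_measurable borel"
    unfolding q_def ch_def using G_meas by measurable
  have q_int: "set_integrable lborel {0..1} q"
  proof (rule set_integrable_bound[OF inverse_sqrt_integrable[of C]])
    show "set_borel_measurable lborel {0..1} q" unfolding set_borel_measurable_def using q_meas by measurable
    show "AE x in lborel. x \<in> {0..1} \<longrightarrow> norm (q x) \<le> norm (C / sqrt (1 - x))"
    proof (intro AE_I2 impI)
      fix x :: real assume "x \<in> {0..1}"
      from order_trans[OF bd[OF this] abs_ge_self]
      show "norm (q x) \<le> norm (C / sqrt (1 - x))" by (simp only: real_norm_def)
    qed
  qed
  let ?mi = "momentum_integrand (Suc k) F"
  \<comment> \<open>Nothing is known of \<open>F\<close> at 0; this value changes the integrand on a
    null set only.\<close>
  define c0 where "c0 = ?mi 0"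
  have mi: "(\<lambda>x. indicator {0..<1} x *\<^sub>R ?mi x) = (\<lambda>x. if x = 0 then c0 else indicator {0..1} x *\<^sub>R q x)"
  proof
    fix x :: real
    consider "x = 0" | "x \<in> {0<..<1}" | "x = 1" | "x < 0 \<or> 1 < x" by fastforce
    then show "indicator {0..<1} x *\<^sub>R ?mi x = (if x = 0 then c0 else indicator {0..1} x *\<^sub>R q x)"
      by cases (auto simp: c0_def qm, simp add: q_def)
  qed
  have m1: "(\<lambda>x. indicator {0..1} x *\<^sub>R q x) \<in> borel_measurable lborel" using q_meas by measurable
  have m2: "(\<lambda>x. indicator {0..<1} x *\<^sub>R ?mi x) \<in> borel_measurable lborel" unfolding mi using m1 by measurable
  have ae: "AE x in lborel. indicator {0..<1} x *\<^sub>R ?mi x = indicator {0..1} x *\<^sub>R q x"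
    using AE_lborel_singleton[of 0] by eventually_elim (metis (no_types, lifting) mi)
  have "momentum_defined (Suc k) F"
    unfolding momentum_defined_def set_integrable_def
    using integrable_cong_AE[OF m2 m1 ae] q_int by (simp add: set_integrable_def)
  from mom[OF this] have "(LINT x:{0..1}|lborel. q x) = 0"
    unfolding momentum_def set_lebesgue_integral_def integral_cong_AE[OF m2 m1 ae] .
  with set_borel_integral_eq_integral[OF q_int] have I1: "q integrable_on {0..1}" "integral {0..1} q = 0" by auto
  have cI: "continuous_on {0..1} (\<lambda>s. integral {0..s} q)" by (rule indefinite_integral_continuous_1[OF I1(1)])
  have lim: "((\<lambda>t::real. t / sqrt (1 + t\<^sup>2)) \<longlongrightarrow> 1) at_top" by real_asymp
  have ev: "\<forall>\<^sub>F t::real in at_top. t / sqrt (1 + t\<^sup>2) \<in> {0..1}"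
    using eventually_gt_at_top[of 0] by eventually_elim (use chart_inverse(1) in force)
  have "((\<lambda>t::real. integral {0..t / sqrt (1 + t\<^sup>2)} q) \<longlongrightarrow> integral {0..1} q) at_top"
    by (rule continuous_on_tendsto_compose[OF cI lim _ ev]) simp
  then have L: "((\<lambda>t::real. integral {0..t / sqrt (1 + t\<^sup>2)} q) \<longlongrightarrow> 0) at_top" unfolding I1(2) .
  have eq: "integral {0..t / sqrt (1 + t\<^sup>2)} q = integral {0..t} (\<lambda>u. G u * u ^ (2 * k))" if t: "0 < t" for t
  proof -
    define s where "s = t / sqrt (1 + t\<^sup>2)"
    have s: "s \<in> {0<..<1}" "ch s = t" using chart_inverse[OF t] by (auto simp: s_def ch_def)
    have chd: "(ch has_real_derivative 1 / ((1 - x\<^sup>2) * sqrt (1 - x\<^sup>2))) (at x)" if "x \<in> {0..s}" for x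
      unfolding ch_def[abs_def] using that s by (intro chart_deriv) auto
    have mono: "ch x \<in> {0..t}" if x: "x \<in> {0..s}" for x
    proof -
      have "ch x \<le> ch s"
      proof (rule DERIV_nonneg_imp_nondecreasing[where f = ch and a = x and b = s])
        fix y assume y: "x \<le> y" "y \<le> s"
        then have "y \<in> {0..s}" "0 < 1 - y\<^sup>2" using x s r[of y] by auto
        then show "\<exists>d. (ch has_real_derivative d) (at y) \<and> 0 \<le> d"
          using chd by (intro exI conjI) auto
      qed (use x in auto)
      moreover have "0 \<le> ch x" using x r[of x] s by (auto simp: ch_def)
      ultimately show ?thesis using s(2) by simp
    qed
    have "((\<lambda>x. (1 / ((1 - x\<^sup>2) * sqrt (1 - x\<^sup>2))) *\<^sub>R (G (ch x) * ch x ^ (2 * k))) has_integral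
        integral {ch 0..ch s} (\<lambda>u. G u * u ^ (2 * k))) {0..s}"
    proof (rule has_integral_substitution[where c = 0 and d = t])
      show "continuous_on {0..t} (\<lambda>u. G u * u ^ (2 * k))"
        by (intro continuous_intros continuous_on_subset[OF G]) auto
      show "(ch has_real_derivative 1 / ((1 - x\<^sup>2) * sqrt (1 - x\<^sup>2))) (at x within {0..s})" if "x \<in> {0..s}" for x
        by (rule has_field_derivative_at_within[OF chd[OF that]])
      show "ch 0 \<le> ch s" using s(2) t by (simp add: ch_def)
    qed (use s mono in auto)
    then have "(q has_integral integral {0..t} (\<lambda>u. G u * u ^ (2 * k))) {0..s}"
      unfolding s(2) by (simp add: q_def[abs_def] ch_def[of 0])
    then show ?thesis unfolding s_def by (rule integral_unique)
  qed
  show ?thesis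
    by (rule Lim_transform_eventually[OF L eventually_mono[OF eventually_gt_at_top[of 0] eq]])
qed

section \<open>Estimates uniform in the parameter\<close>

lemma powr_bounds:
  assumes "1 / 2 \<le> y" "y \<le> 2" "\<bar>p\<bar> \<le> (Y::real)"
  shows "2 powr (- Y) \<le> y powr p" "y powr p \<le> 2 powr Y"
proof -
  have "ln y \<le> ln 2" "- ln 2 \<le> ln y"
    using assms ln_mono[of y 2] ln_mono[of "1 / 2" y] by (auto simp: ln_div)
  then have "\<bar>ln y\<bar> \<le> ln 2" by linarith
  then have "\<bar>p * ln y\<bar> \<le> Y * ln 2" unfolding abs_mult using assms(3) by (intro mult_mono) auto
  then show "2 powr (- Y) \<le> y powr p" "y powr p \<le> 2 powr Y" using assms(1) by (auto simp: powr_def)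
qed

text \<open>Two-sided bounds at a single point 1 - w keep the ratio of w^\<xi>(\<mu>) and
  w^\<xi>(\<mu>0) between 1/8 and 8: a factor 4 from the bounds and 2 from continuity of
  \<open>F\<close> in the parameter. With w so small that ln 8 < e |ln w|, the exponents differ by
  less than e.\<close>

lemma exponent_continuous:
  fixes \<xi> :: "'p::topological_space \<Rightarrow> real"
  assumes A: "0 < A" and z1: "z1 < 1"
    and ev: "\<forall>\<^sub>F \<mu> in nhds \<mu>0. \<forall>z. z1 < z \<and> z < 1 \<longrightarrow> F \<mu> z * (1 - z) powr \<xi> \<mu> \<in> {A / 2<..<2 * A}"
    and cont: "\<And>z. z1 < z \<Longrightarrow> z < 1 \<Longrightarrow> ((\<lambda>\<mu>. F \<mu> z) \<longlongrightarrow> F \<mu>0 z) (nhds \<mu>0)"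
    and e: "0 < e"
  shows "\<forall>\<^sub>F \<mu> in nhds \<mu>0. \<bar>\<xi> \<mu> - \<xi> \<mu>0\<bar> < e"
proof -
  define w where "w = min ((1 - z1) / 2) (exp (- ln 8 / e) / 2)"
  have w: "0 < w" "w < 1 - z1" "w < exp (- ln 8 / e)" using z1 by (auto simp: w_def min_def)
  have lnw: "ln w < - ln 8 / e" using w by (metis exp_less_cancel_iff exp_ln)
  have z: "z1 < 1 - w" "1 - w < 1" using w by auto
  define f where "f = F \<mu>0 (1 - w)"
  have "F \<mu>0 (1 - w) * (1 - (1 - w)) powr \<xi> \<mu>0 \<in> {A / 2<..<2 * A}"
    using eventually_nhds_x_imp_x[OF ev] z by blast
  then have f1: "A / 2 < f * w powr \<xi> \<mu>0" "f * w powr \<xi> \<mu>0 < 2 * A" by (auto simp: f_def)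
  have "0 < w powr \<xi> \<mu>0" using w by simp
  then have f: "0 < f" using f1 A by (metis less_trans half_gt_zero zero_less_mult_pos2)
  have "\<forall>\<^sub>F \<mu> in nhds \<mu>0. f / 2 < F \<mu> (1 - w)" "\<forall>\<^sub>F \<mu> in nhds \<mu>0. F \<mu> (1 - w) < 2 * f"
    using order_tendstoD(1)[OF cont[OF z], of "f / 2"] order_tendstoD(2)[OF cont[OF z], of "2 * f"] f
    by (auto simp: f_def)
  with ev show ?thesis
  proof eventually_elim
    case (elim \<mu>)
    let ?W = "w powr \<xi> \<mu>" and ?Wz = "w powr \<xi> \<mu>0" and ?f = "F \<mu> (1 - w)"
    have W: "A / 2 < ?f * ?W" "?f * ?W < 2 * A" using elim z by force+
    have pos: "0 < ?W" "0 < ?Wz" using w by auto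
    have "f / 2 * ?W \<le> ?f * ?W" "?f * ?W \<le> 2 * f * ?W" using elim pos by (auto intro!: mult_right_mono)
    then have "f * ?W < 4 * A" "A < 4 * (f * ?W)" using W by auto
    then have "f * ?W < 8 * (f * ?Wz)" "f * ?Wz < 8 * (f * ?W)" using f1 by linarith+
    then have "?W < 8 * ?Wz" "?Wz < 8 * ?W" using f by (auto simp: mult.left_commute[of _ f])
    then have "ln ?W < ln (8 * ?Wz)" "ln ?Wz < ln (8 * ?W)"
      using pos ln_less_cancel_iff[of ?W "8 * ?Wz"] ln_less_cancel_iff[of ?Wz "8 * ?W"] by simp_all
    moreover have "ln (8 * ?W) = ln 8 + \<xi> \<mu> * ln w" "ln (8 * ?Wz) = ln 8 + \<xi> \<mu>0 * ln w"
      "ln ?W = \<xi> \<mu> * ln w" "ln ?Wz = \<xi> \<mu>0 * ln w"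
      using w ln_mult[of 8 ?W] ln_mult[of 8 ?Wz] by (simp_all add: ln_powr)
    ultimately have "\<xi> \<mu> * ln w < ln 8 + \<xi> \<mu>0 * ln w" "\<xi> \<mu>0 * ln w < ln 8 + \<xi> \<mu> * ln w" by simp_all
    then have "\<bar>(\<xi> \<mu> - \<xi> \<mu>0) * ln w\<bar> < ln 8" by (simp add: algebra_simps abs_less_iff)
    moreover have "ln 8 < e * (- ln w)" using lnw e by (simp add: field_simps)
    moreover have "0 < ln 8 / e" using e by simp
    then have "0 < - ln w" using lnw by linarith
    moreover from this have "\<bar>(\<xi> \<mu> - \<xi> \<mu>0) * ln w\<bar> = \<bar>\<xi> \<mu> - \<xi> \<mu>0\<bar> * (- ln w)" by (simp add: abs_mult)
    ultimately have "\<bar>\<xi> \<mu> - \<xi> \<mu>0\<bar> * (- ln w) < e * (- ln w)" by linarith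
    then show ?case by (simp only: mult_less_cancel_right_pos[OF \<open>0 < - ln w\<close>])
  qed
qed

text \<open>Joint convergence gives, on one interval (z1, 1) for all nearby parameters, bounds that
  become two-sided power bounds for G in u. The sign \<sigma> of the limit reduces everything to the
  positive case.\<close>

lemma averaging_eventually_nonzero:
  fixes G F :: "'p::heine_borel \<Rightarrow> real \<Rightarrow> real"
  assumes U: "open U" "\<mu>0 \<in> U"
    and G: "continuous_on (U \<times> UNIV) (\<lambda>(\<mu>, u). G \<mu> u)"
    and F: "\<And>\<mu> x. \<mu> \<in> U \<Longrightarrow> x \<in> {0<..<1} \<Longrightarrow> F \<mu> x = G \<mu> (x / sqrt (1 - x\<^sup>2)) / (1 - x\<^sup>2)"
    and quant: "quantified_at_1 U F a \<xi> \<mu>0" and \<xi>0: "\<xi> \<mu>0 = 1 / 2 - real m"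
    and mom: "\<And>i \<mu>. i \<in> {1..m} \<Longrightarrow> \<mu> \<in> U \<Longrightarrow> momentum_defined i (F \<mu>) \<Longrightarrow> momentum i (F \<mu>) = 0"
  shows "\<exists>t0>0. \<forall>\<^sub>F \<mu> in nhds \<mu>0. \<forall>t\<ge>t0. averaging (G \<mu>) t \<noteq> 0"
proof -
  have a0: "a \<mu>0 \<noteq> 0"
    and lim: "((\<lambda>(z, \<mu>). F \<mu> z * (1 - z) powr \<xi> \<mu>) \<longlongrightarrow> a \<mu>0) (at_left 1 \<times>\<^sub>F nhds \<mu>0)"
    using quant unfolding quantified_at_1_def by blast+
  define A where "A = \<bar>a \<mu>0\<bar>"
  define \<sigma> where "\<sigma> = sgn (a \<mu>0)"
  have A: "0 < A" "\<sigma> * a \<mu>0 = A" using a0 by (auto simp: A_def \<sigma>_def sgn_if)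
  have sg: "\<bar>\<sigma>\<bar> = 1" "\<sigma> \<noteq> 0" using a0 by (auto simp: \<sigma>_def sgn_if)
  let ?B = "at_left 1 \<times>\<^sub>F nhds \<mu>0"
  have T: "((\<lambda>p. \<sigma> * (case p of (z, \<mu>) \<Rightarrow> F \<mu> z * (1 - z) powr \<xi> \<mu>)) \<longlongrightarrow> A) ?B"
    unfolding A(2)[symmetric] by (intro tendsto_intros lim)
  have "\<forall>\<^sub>F p in ?B. A / 2 < \<sigma> * (case p of (z, \<mu>) \<Rightarrow> F \<mu> z * (1 - z) powr \<xi> \<mu>)"
    "\<forall>\<^sub>F p in ?B. \<sigma> * (case p of (z, \<mu>) \<Rightarrow> F \<mu> z * (1 - z) powr \<xi> \<mu>) < 2 * A"
    by (rule order_tendstoD(1)[OF T], use A(1) in simp) (rule order_tendstoD(2)[OF T], use A(1) in simp)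
  then have "\<forall>\<^sub>F p in ?B. \<sigma> * (case p of (z, \<mu>) \<Rightarrow> F \<mu> z * (1 - z) powr \<xi> \<mu>) \<in> {A / 2<..<2 * A}"
    by eventually_elim auto
  then obtain Pf Pg where Pf: "eventually Pf (at_left 1)" and Pg: "eventually Pg (nhds \<mu>0)"
    and P: "\<And>z \<mu>. Pf z \<Longrightarrow> Pg \<mu> \<Longrightarrow> \<sigma> * (F \<mu> z * (1 - z) powr \<xi> \<mu>) \<in> {A / 2<..<2 * A}"
    unfolding eventually_prod_filter by auto
  obtain b where b: "b < 1" "\<And>z. b < z \<Longrightarrow> z < 1 \<Longrightarrow> Pf z"
    using Pf unfolding eventually_at_left_field by blast
  define z1 where "z1 = max 0 b"
  have z1: "0 \<le> z1" "z1 < 1" "b \<le> z1" using b by (auto simp: z1_def)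
  have E1: "\<forall>\<^sub>F \<mu> in nhds \<mu>0. \<forall>z. z1 < z \<and> z < 1 \<longrightarrow> \<sigma> * F \<mu> z * (1 - z) powr \<xi> \<mu> \<in> {A / 2<..<2 * A}"
    using Pg
  proof eventually_elim
    case (elim \<mu>)
    show ?case
    proof (intro allI impI)
      fix z assume z: "z1 < z \<and> z < 1"
      have "Pf z" using z z1 by (intro b) auto
      from P[OF this elim] show "\<sigma> * F \<mu> z * (1 - z) powr \<xi> \<mu> \<in> {A / 2<..<2 * A}" by (simp add: mult.assoc)
    qed
  qed
  have inU: "\<forall>\<^sub>F \<mu> in nhds \<mu>0. \<mu> \<in> U" using U by (rule eventually_nhds_in_open)
  have Gu: "continuous_on U (\<lambda>\<mu>. G \<mu> u)" for u
  proof -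
    have "continuous_on U (\<lambda>\<mu>. (\<lambda>(\<mu>, u). G \<mu> u) (\<mu>, u))"
      by (rule continuous_on_compose2[OF G]) (auto intro!: continuous_intros)
    then show ?thesis by simp
  qed
  have Fc: "((\<lambda>\<mu>. \<sigma> * F \<mu> z) \<longlongrightarrow> \<sigma> * F \<mu>0 z) (nhds \<mu>0)" if z: "z1 < z" "z < 1" for z
  proof -
    have z01: "z \<in> {0<..<1}" using z z1 by auto
    have "isCont (\<lambda>\<mu>. G \<mu> (z / sqrt (1 - z\<^sup>2))) \<mu>0"
      using Gu U continuous_on_eq_continuous_at by blast
    then have "((\<lambda>\<mu>. G \<mu> (z / sqrt (1 - z\<^sup>2))) \<longlongrightarrow> G \<mu>0 (z / sqrt (1 - z\<^sup>2))) (nhds \<mu>0)"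
      unfolding isCont_def by (rule tendsto_at_iff_tendsto_nhds[THEN iffD1])
    then have L: "((\<lambda>\<mu>. \<sigma> * (G \<mu> (z / sqrt (1 - z\<^sup>2)) / (1 - z\<^sup>2))) \<longlongrightarrow> \<sigma> * (G \<mu>0 (z / sqrt (1 - z\<^sup>2)) / (1 - z\<^sup>2))) (nhds \<mu>0)"
      using unit_interval_pos[OF z01] by (intro tendsto_intros) auto
    have "\<forall>\<^sub>F \<mu> in nhds \<mu>0. \<sigma> * (G \<mu> (z / sqrt (1 - z\<^sup>2)) / (1 - z\<^sup>2)) = \<sigma> * F \<mu> z"
      using inU by eventually_elim (simp add: F[OF _ z01])
    from Lim_transform_eventually[OF L this] show ?thesis unfolding F[OF U(2) z01] .
  qed
  have \<xi>c: "\<forall>\<^sub>F \<mu> in nhds \<mu>0. \<bar>\<xi> \<mu> - \<xi> \<mu>0\<bar> < e" if "0 < e" for e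
    by (rule exponent_continuous[OF A(1) z1(2) E1 Fc that])
  define X where "X = \<bar>\<xi> \<mu>0\<bar> + 1"
  \<comment> \<open>Each of the two powers that make up the conversion factor \<open>w\<close> below
    has base in [1/2, 2] and exponent at most X + 1 in modulus, so it lies between 1 / C and
    C.\<close>
  define C where "C = 2 powr (X + 1)"
  have C: "0 < C" by (simp add: C_def)
  define A1 where "A1 = A / 2 / C / C"
  define A2 where "A2 = 2 * A * C * C"
  \<comment> \<open>For u \<ge> u0 the corresponding x exceeds z1, because 1 - x \<le> 1 - x^2 < 1 /
    u.\<close>
  define u0 where "u0 = 1 / (1 - z1)"
  have u0: "1 \<le> u0" using z1 by (simp add: u0_def)
  have A12: "0 < A1" "0 \<le> A2" using A C by (auto simp: A1_def A2_def)
  obtain r where r: "0 < r" "cball \<mu>0 r \<subseteq> U" using U open_contains_cball by metis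
  have "bounded ((\<lambda>(\<mu>, u). G \<mu> u) ` (cball \<mu>0 r \<times> {0..u0}))"
    by (intro compact_imp_bounded compact_continuous_image compact_Times continuous_on_subset[OF G])
      (use r in auto)
  then obtain M0 where "\<forall>x\<in>(\<lambda>(\<mu>, u). G \<mu> u) ` (cball \<mu>0 r \<times> {0..u0}). norm x \<le> M0" unfolding bounded_iff by blast
  then have M0: "\<bar>G \<mu> u\<bar> \<le> M0" if "\<mu> \<in> cball \<mu>0 r" "u \<in> {0..u0}" for \<mu> u
    using that by (metis SigmaI case_prod_conv imageI real_norm_def)
  define M where "M = max 0 M0"
  have M: "0 \<le> M" by (simp add: M_def)
  obtain t0 \<delta> where t0: "0 < t0" "0 < \<delta>" and key:
    "\<And>g e t. \<lbrakk>continuous_on {0..} g; \<bar>e\<bar> \<le> \<delta>; t0 \<le> t;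
       \<And>u. 0 \<le> u \<Longrightarrow> u \<le> u0 \<Longrightarrow> \<bar>g u\<bar> \<le> M;
       \<And>u. u0 \<le> u \<Longrightarrow> A1 * u powr (e - 1 - 2 * real m) \<le> g u;
       \<And>u. u0 \<le> u \<Longrightarrow> g u \<le> A2 * u powr (e - 1 - 2 * real m);
       \<And>k. k < m \<Longrightarrow> ((\<lambda>t. integral {0..t} (\<lambda>u. g u * u ^ (2 * k))) \<longlongrightarrow> 0) at_top\<rbrakk>
      \<Longrightarrow> 0 < averaging g t"
    using averaging_positive[OF A12 M u0, of m] by blast
  \<comment> \<open>Since e = 2 (\<xi>(\<mu>) - \<xi>(\<mu>0)), closeness \<delta> / 2 ensures |e|
    \<le> \<delta>. Closeness 1/2 ensures \<xi>(\<mu>) < 1 - m, which makes the momenta of order k <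
    m converge.\<close>
  have "0 < min (1 / 2) (\<delta> / 2)" using t0 by simp
  note \<xi>c[OF this]
  moreover have "\<forall>\<^sub>F \<mu> in nhds \<mu>0. \<mu> \<in> ball \<mu>0 r" using r by (intro eventually_nhds_in_open) auto
  ultimately have "\<forall>\<^sub>F \<mu> in nhds \<mu>0. \<forall>t\<ge>t0. averaging (G \<mu>) t \<noteq> 0"
    using E1
  proof eventually_elim
    case (elim \<mu>)
    have \<mu>: "\<mu> \<in> cball \<mu>0 r" "\<mu> \<in> U" using elim(2) r by auto
    define e where "e = 2 * \<xi> \<mu> - 1 + 2 * real m"
    have e: "\<bar>e\<bar> \<le> \<delta>" "e - 1 - 2 * real m = 2 * (\<xi> \<mu> - 1)" using elim(1) \<xi>0 by (auto simp: e_def abs_if field_simps split: if_splits)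
    have near: "\<bar>\<xi> \<mu> - \<xi> \<mu>0\<bar> < 1 / 2" using elim(1) by simp
    then have \<xi>X: "\<bar>\<xi> \<mu>\<bar> \<le> X + 1" "\<bar>\<xi> \<mu> - 1\<bar> \<le> X + 1" unfolding X_def by linarith+
    define g where "g u = \<sigma> * G \<mu> u" for u
    have Gc: "continuous_on UNIV (G \<mu>)"
    proof -
      have "continuous_on UNIV (\<lambda>u. (\<lambda>(\<mu>, u). G \<mu> u) (\<mu>, u))"
        by (rule continuous_on_compose2[OF G]) (use \<mu> in \<open>auto intro!: continuous_intros\<close>)
      then show ?thesis by simp
    qed
    have bounds: "A1 * u powr (e - 1 - 2 * real m) \<le> g u \<and> g u \<le> A2 * u powr (e - 1 - 2 * real m)" if u: "u0 \<le> u" for u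
    proof -
      have up: "0 < u" "1 \<le> u" using u u0 by auto
      define x where "x = u / sqrt (1 + u\<^sup>2)"
      note x = chart_inverse[OF up(1), folded x_def]
      have x1: "0 < x" "x < 1" using x(1) by auto
      have uu: "u\<^sup>2 / (1 + u\<^sup>2) \<in> {1 / 2..1}" "0 < 1 + u\<^sup>2"
      proof -
        show "0 < 1 + u\<^sup>2" by (simp add: add_pos_nonneg)
        moreover have "1 \<le> u\<^sup>2" using up by simp
        ultimately show "u\<^sup>2 / (1 + u\<^sup>2) \<in> {1 / 2..1}" by (simp add: field_simps)
      qed
      have "z1 < x"
      proof -
        have "1 - x \<le> 1 - x\<^sup>2" using x1 by (simp add: power2_eq_square mult_left_le)
        also have "\<dots> < 1 / u"
        proof -
          have "1 * u \<le> u * u" using up by (intro mult_right_mono) auto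
          then have "u < 1 + u\<^sup>2" unfolding power2_eq_square by linarith
          then show ?thesis unfolding x(3) using up by (intro divide_strict_left_mono) auto
        qed
        also have "\<dots> \<le> 1 / u0" using u u0 by (intro divide_left_mono) auto
        also have "\<dots> = 1 - z1" by (simp add: u0_def)
        finally show ?thesis by simp
      qed
      then have q: "A / 2 < \<sigma> * F \<mu> x * (1 - x) powr \<xi> \<mu>" "\<sigma> * F \<mu> x * (1 - x) powr \<xi> \<mu> < 2 * A"
        using elim(3) x1 by auto
      \<comment> \<open>What remains of 1 - x^2 after (1 - x)^\<xi> and u^(2\<xi> - 2) have been
        split off; it is bounded above and away from 0.\<close>
      define w where "w = (1 + x) powr \<xi> \<mu> * (u\<^sup>2 / (1 + u\<^sup>2)) powr (1 - \<xi> \<mu>)"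
      have "g u = \<sigma> * F \<mu> x * (1 - x\<^sup>2)"
        unfolding g_def F[OF \<mu>(2) x(1)] x(2) using unit_interval_pos[OF x(1)] by simp
      also have "\<dots> = (\<sigma> * F \<mu> x * (1 - x) powr \<xi> \<mu>) * (w * u powr (2 * (\<xi> \<mu> - 1)))"
      proof -
        have f: "1 - x\<^sup>2 = (1 - x) * (1 + x)" by (simp add: power2_eq_square algebra_simps)
        have xp: "0 < 1 - x" "0 < 1 + x" using x1 by auto
        have "w * u powr (2 * (\<xi> \<mu> - 1)) = (1 + x) powr \<xi> \<mu> * (1 / (1 + u\<^sup>2)) powr (1 - \<xi> \<mu>) * ((u\<^sup>2) powr (1 - \<xi> \<mu>) * u powr (2 * (\<xi> \<mu> - 1)))"
          using up uu(2) by (simp add: w_def powr_divide)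
        also have "(u\<^sup>2) powr (1 - \<xi> \<mu>) * u powr (2 * (\<xi> \<mu> - 1)) = 1"
        proof -
          have "u\<^sup>2 = u powr 2" using up by (simp add: powr_numeral)
          then have "(u\<^sup>2) powr (1 - \<xi> \<mu>) = u powr (2 * (1 - \<xi> \<mu>))" by (simp add: powr_powr)
          then show ?thesis using up by (simp add: powr_add[symmetric] algebra_simps)
        qed
        also have "1 / (1 + u\<^sup>2) = (1 - x) * (1 + x)" using x(3) f by simp
        also have "(1 + x) powr \<xi> \<mu> * ((1 - x) * (1 + x)) powr (1 - \<xi> \<mu>) * 1 = (1 - x) powr (1 - \<xi> \<mu>) * (1 + x)"
          using xp by (simp add: powr_mult powr_diff)
        finally have "(1 - x) powr \<xi> \<mu> * (w * u powr (2 * (\<xi> \<mu> - 1))) = (1 - x) * (1 + x)"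
          using xp by (simp add: powr_diff)
        then show ?thesis unfolding f by (metis mult.assoc)
      qed
      finally have gu: "g u = (\<sigma> * F \<mu> x * (1 - x) powr \<xi> \<mu>) * w * u powr (e - 1 - 2 * real m)"
        unfolding e(2) by (simp add: mult.assoc)
      have w: "1 / C * (1 / C) \<le> w" "w \<le> C * C"
      proof -
        have pc: "2 powr (- (X + 1)) = 1 / C" unfolding C_def powr_minus_divide ..
        have p: "2 powr (- (X + 1)) \<le> (1 + x) powr \<xi> \<mu>" "(1 + x) powr \<xi> \<mu> \<le> C"
          unfolding C_def using x1 \<xi>X by (intro powr_bounds; simp)+
        have q: "2 powr (- (X + 1)) \<le> (u\<^sup>2 / (1 + u\<^sup>2)) powr (1 - \<xi> \<mu>)" "(u\<^sup>2 / (1 + u\<^sup>2)) powr (1 - \<xi> \<mu>) \<le> C"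
          unfolding C_def using uu(1) \<xi>X(2) by (intro powr_bounds; simp add: abs_minus_commute)+
        show "1 / C * (1 / C) \<le> w"
          unfolding w_def pc[symmetric] by (rule mult_mono[OF p(1) q(1)]) auto
        show "w \<le> C * C"
          unfolding w_def by (rule mult_mono[OF p(2) q(2)]) (use C in auto)
      qed
      have "A / 2 * (1 / C * (1 / C)) \<le> (\<sigma> * F \<mu> x * (1 - x) powr \<xi> \<mu>) * w"
        using q w A(1) C by (intro mult_mono) auto
      moreover have "(\<sigma> * F \<mu> x * (1 - x) powr \<xi> \<mu>) * w \<le> (2 * A) * (C * C)"
        by (rule mult_mono) (use q w A(1) C in \<open>auto intro: order_trans[of 0 "1 / C * (1 / C)"]\<close>)
      ultimately have "A1 \<le> (\<sigma> * F \<mu> x * (1 - x) powr \<xi> \<mu>) * w" "(\<sigma> * F \<mu> x * (1 - x) powr \<xi> \<mu>) * w \<le> A2"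
        by (auto simp: A1_def A2_def mult.assoc)
      then show ?thesis unfolding gu by (auto intro!: mult_right_mono)
    qed
    have momlim: "((\<lambda>t. integral {0..t} (\<lambda>u. g u * u ^ (2 * k))) \<longlongrightarrow> 0) at_top" if k: "k < m" for k
    proof -
      have "((\<lambda>t. integral {0..t} (\<lambda>u. G \<mu> u * u ^ (2 * k))) \<longlongrightarrow> 0) at_top"
      proof (rule momentum_limit[OF Gc F[OF \<mu>(2)] z1(1,2)])
        show "\<bar>F \<mu> x * (1 - x) powr \<xi> \<mu>\<bar> \<le> 2 * A" if "z1 < x" "x < 1" for x
        proof -
          have "\<bar>\<sigma> * F \<mu> x * (1 - x) powr \<xi> \<mu>\<bar> \<le> 2 * A" using elim(3) that A(1) by auto
          then show ?thesis using sg(1) by (simp add: abs_mult)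
        qed
        have "real k + 1 \<le> real m" using k by simp
        then show "\<xi> \<mu> + real k \<le> 0" using near \<xi>0 by linarith
        show "momentum_defined (Suc k) (F \<mu>) \<Longrightarrow> momentum (Suc k) (F \<mu>) = 0" using k \<mu>(2) by (intro mom) auto
      qed
      then have "((\<lambda>t. \<sigma> * integral {0..t} (\<lambda>u. G \<mu> u * u ^ (2 * k))) \<longlongrightarrow> \<sigma> * 0) at_top" by (intro tendsto_intros)
      then show ?thesis by (simp add: g_def mult.assoc)
    qed
    show ?case
    proof (intro allI impI)
      fix t assume t: "t0 \<le> t"
      have "0 < averaging g t"
      proof (rule key[OF _ e(1) t _ _ _ momlim])
        show "continuous_on {0..} g" unfolding g_def by (intro continuous_intros continuous_on_subset[OF Gc]) auto
        show "\<bar>g u\<bar> \<le> M" if "0 \<le> u" "u \<le> u0" for u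
          using M0[OF \<mu>(1), of u] that sg(1) by (simp add: g_def abs_mult M_def)
      qed (use bounds in auto)
      moreover have "averaging g t = \<sigma> * averaging (G \<mu>) t" by (simp add: averaging_def g_def)
      ultimately show "averaging (G \<mu>) t \<noteq> 0" by auto
    qed
  qed
  with t0 show ?thesis by blast
qed

section \<open>The affine chart of the projective plane\<close>

lemma rp2_of_abs: "rp2_of (x, y) = abs_rp2 (x, y, 1)"
  by (simp add: rp2_of.abs_eq)

lemma affine_nonzero: "(x, y, 1::real) \<noteq> 0"
  by (simp add: zero_prod_def)

lemma dist_rp2_abs:
  assumes "u \<noteq> 0" "v \<noteq> 0"
  shows "dist (abs_rp2 u) (abs_rp2 v) = min (dist (sgn u) (sgn v)) (dist (sgn u) (- sgn v))"
  by (rule dist_rp2.abs_eq) (use assms in \<open>auto intro: exI[of _ 1]\<close>)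

lemma rp2_cases:
  obtains v where "v \<noteq> 0" "b = abs_rp2 v"
  using Quotient3_abs_rep[OF Quotient3_rp2] Quotient3_rep_reflp[OF Quotient3_rp2] by metis

lemma abs_rp2_scaleR:
  assumes "v \<noteq> 0" "c \<noteq> 0"
  shows "abs_rp2 (c *\<^sub>R v) = abs_rp2 v"
proof -
  have "abs_rp2 v = abs_rp2 (c *\<^sub>R v)"
    by (rule Quotient3_rel_abs[OF Quotient3_rp2]) (use assms in auto)
  then show ?thesis ..
qed

text \<open>Both representatives have a positive third coordinate, which excludes antipodal unit
  vectors.\<close>

lemma inj_rp2_of: "rp2_of p = rp2_of q \<Longrightarrow> p = q"
proof -
  assume a: "rp2_of p = rp2_of q"
  obtain x y x' y' where p: "p = (x, y)" "q = (x', y')" by (cases p, cases q)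
  have "dist (rp2_of p) (rp2_of q) = 0" using a by simp
  then have m: "sgn (x, y, 1::real) = sgn (x', y', 1) \<or> sgn (x, y, 1::real) = - sgn (x', y', 1)"
    unfolding p rp2_of_abs dist_rp2_abs[OF affine_nonzero affine_nonzero] by (auto simp: min_def split: if_splits)
  define a b where "a = inverse (norm (x, y, 1::real))" and "b = inverse (norm (x', y', 1::real))"
  have ab: "0 < a" "0 < b" using affine_nonzero by (auto simp: a_def b_def)
  have s: "sgn (x, y, 1::real) = (a * x, a * y, a)" "sgn (x', y', 1::real) = (b * x', b * y', b)"
    by (simp_all add: sgn_div_norm a_def b_def)
  show "p = q" using m ab unfolding s p by auto
qed

lemma continuous_rp2_of: "continuous_on A rp2_of"
proof -
  have "isCont rp2_of p" for p
    unfolding isCont_def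
  proof (rule tendstoI)
    fix e :: real assume e: "0 < e"
    let ?s = "\<lambda>p::real \<times> real. sgn (fst p, snd p, 1::real)"
    have nz: "(fst p, snd p, 1::real) \<noteq> 0" for p :: "real \<times> real" by (rule affine_nonzero)
    have "isCont ?s p" using nz by (intro isCont_sgn continuous_intros) auto
    then have "\<forall>\<^sub>F q in at p. dist (?s q) (?s p) < e" unfolding isCont_def using e by (rule tendstoD)
    then show "\<forall>\<^sub>F q in at p. dist (rp2_of q) (rp2_of p) < e"
    proof eventually_elim
      case (elim q)
      have "dist (rp2_of q) (rp2_of p) \<le> dist (?s q) (?s p)"
        using dist_rp2_abs[OF nz nz, of q p] by (simp add: rp2_of_abs[symmetric])
      with elim show ?case by simp
    qed
  qed
  then show ?thesis by (simp add: continuous_at_imp_continuous_on)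
qed

text \<open>Division by the third coordinate is a continuous left inverse near the unit
  representative. A projective point at small distance has one of its two unit representatives
  there.\<close>

lemma open_rp2_of:
  assumes Q: "open Q" shows "open (rp2_of ` Q)"
  unfolding open_dist
proof
  fix b assume "b \<in> rp2_of ` Q"
  then obtain x y where b: "b = rp2_of (x, y)" "(x, y) \<in> Q" by auto
  define W where "W = {w::real \<times> real \<times> real. snd (snd w) \<noteq> 0}"
  define f where "f w = (fst w / snd (snd w), fst (snd w) / snd (snd w))" for w :: "real \<times> real \<times> real"
  have W: "open W" unfolding W_def by (intro open_Collect_neq continuous_intros)
  have "continuous_on W f" unfolding f_def W_def by (intro continuous_intros) auto
  then have O: "open (W \<inter> f -` Q)" using W Q by (intro continuous_open_preimage)
  define a where "a = inverse (norm (x, y, 1::real))"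
  have a: "0 < a" using affine_nonzero by (simp add: a_def)
  have s: "sgn (x, y, 1::real) = (a * x, a * y, a)" by (simp add: sgn_div_norm a_def)
  have "sgn (x, y, 1::real) \<in> W \<inter> f -` Q" using a b by (simp add: s W_def f_def)
  then obtain e where e: "e > 0" "ball (sgn (x, y, 1)) e \<subseteq> W \<inter> f -` Q" by (rule openE[OF O])
  have "c \<in> rp2_of ` Q" if c: "dist c b < e" for c
  proof -
    obtain v where v: "v \<noteq> 0" "c = abs_rp2 v" by (rule rp2_cases)
    have "dist b c < e" using c by (simp add: dist_commute)
    then have "dist (sgn (x, y, 1)) (sgn v) < e \<or> dist (sgn (x, y, 1)) (- sgn v) < e"
      unfolding b v rp2_of_abs dist_rp2_abs[OF affine_nonzero v(1)] by (auto simp: min_def split: if_splits)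
    then obtain \<epsilon> :: real where eps: "\<epsilon> \<noteq> 0" "\<epsilon> *\<^sub>R v \<in> W" "f (\<epsilon> *\<^sub>R v) \<in> Q"
    proof
      assume "dist (sgn (x, y, 1)) (sgn v) < e"
      then have "sgn v \<in> W \<inter> f -` Q" using e by auto
      moreover have "sgn v = inverse (norm v) *\<^sub>R v" by (simp add: sgn_div_norm)
      ultimately show ?thesis using that[of "inverse (norm v)"] v by auto
    next
      assume "dist (sgn (x, y, 1)) (- sgn v) < e"
      then have "- sgn v \<in> W \<inter> f -` Q" using e by auto
      moreover have "- sgn v = (- inverse (norm v)) *\<^sub>R v" by (simp add: sgn_div_norm)
      ultimately show ?thesis using that[of "- inverse (norm v)"] v by auto
    qed
    define w where "w = \<epsilon> *\<^sub>R v"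
    have w3: "snd (snd w) \<noteq> 0" using eps(2) by (simp add: w_def W_def)
    have "w = snd (snd w) *\<^sub>R (fst (f w), snd (f w), 1)" using w3 by (simp add: f_def prod_eq_iff)
    then have "abs_rp2 w = rp2_of (fst (f w), snd (f w))"
      unfolding rp2_of_abs using abs_rp2_scaleR[OF affine_nonzero w3] by metis
    moreover have "abs_rp2 w = c" unfolding w_def v(2) by (rule abs_rp2_scaleR[OF v(1) eps(1)])
    ultimately show ?thesis using eps(3) by (metis image_eqI prod.collapse w_def)
  qed
  with e show "\<exists>e>0. \<forall>c. dist c b < e \<longrightarrow> c \<in> rp2_of ` Q" by blast
qed

lemma dist_rp2_bounded: "dist (a::rp2) b \<le> 2"
proof -
  obtain u v where uv: "u \<noteq> 0" "a = abs_rp2 u" "v \<noteq> 0" "b = abs_rp2 v" by (metis rp2_cases)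
  have "dist (sgn u) (sgn v) \<le> norm (sgn u) + norm (sgn v)" by (simp add: dist_norm norm_triangle_ineq4)
  then have "dist (sgn u) (sgn v) \<le> 2" using uv by (simp add: norm_sgn)
  then show ?thesis unfolding uv dist_rp2_abs[OF uv(1,3)] by simp
qed

text \<open>The bounded metric keeps the supremum meaningful. Only this half of the Hausdorff
  distance is used: one point of the orbit close to the outer boundary suffices.\<close>

lemma infdist_le_hausdorff:
  fixes A B :: "rp2 set"
  assumes "a \<in> A"
  shows "infdist a B \<le> hausdorff_dist A B"
proof -
  have "bdd_above ((\<lambda>a. infdist a B) ` A)"
  proof (rule bdd_aboveI2)
    fix x
    show "infdist x B \<le> 2"
    proof (cases "B = {}")
      case False
      then obtain y where "y \<in> B" by blast
      then show ?thesis using infdist_le[of y B x] dist_rp2_bounded[of x y] by linarith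
    qed (simp add: infdist_def)
  qed
  then have "infdist a B \<le> (SUP a\<in>A. infdist a B)" using assms by (rule cSUP_upper2) simp
  then show ?thesis by (simp add: hausdorff_dist_def)
qed

section \<open>Criticality at the outer boundary\<close>

context annulus_coordinate
begin

lemma segment_in_annulus:
  assumes "0 \<le> h" "h < h0"
  shows "(0, sqrt (2 * h)) \<in> insert (0, 0) P"
proof (cases "h = 0")
  case False
  then have h: "0 < h" using assms by simp
  obtain p where p: "p \<in> P" "energy V p = h" using energy_attained[OF h assms(2)] by blast
  obtain u where u: "periodic_solution V J u" "p \<in> range u" "range u \<subseteq> P"
    using annulus_orbit[OF p(1)] by blast
  have "energy V (u t) = h" for t
    using u(2) p(2) energy_constant[of u] u(1) by (metis periodic_solution_def rangeE)
  from orbit_through_axis[OF u(1,3) this] u(3) show ?thesis by (metis insertI2 rangeI subsetD)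
qed simp

text \<open>The image of the annulus is open and hence disjoint from its frontier; the origin is
  removed by definition.\<close>

lemma outer_boundary_disjoint: "rp2_of ` insert (0, 0) P \<inter> outer_boundary V J = {}"
proof -
  have "P = insert (0, 0) P - {(0, 0)}" using zero_notin_annulus by blast
  then have "open P" using annulus_open open_delete by metis
  then have "open (rp2_of ` P)" by (rule open_rp2_of)
  then have "rp2_of ` P \<inter> frontier (rp2_of ` P) = {}" by (simp add: frontier_def interior_open)
  then show ?thesis by (auto simp: outer_boundary_def)
qed

text \<open>The point (0, sqrt (2 h0)) is a limit of annulus points on the y-axis, and it is not in
  the annulus because the energy h0 is not attained.\<close>

lemma outer_boundary_nonempty: "outer_boundary V J \<noteq> {}"
proof -
  let ?q = "(0, sqrt (2 * h0))"
  have nin: "rp2_of ?q \<notin> rp2_of ` P"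
  proof
    assume "rp2_of ?q \<in> rp2_of ` P"
    then have "?q \<in> P" using inj_rp2_of by auto
    from energy_less[OF this] h0_pos V0 show False by (simp add: energy_def)
  qed
  have "rp2_of ?q \<in> closure (rp2_of ` P)"
  proof (rule closure_sequential[THEN iffD2], intro exI conjI allI)
    let ?h = "\<lambda>n. h0 * (real n + 1) / (real n + 2)"
    have h: "0 < ?h n" "?h n < h0" for n
    proof -
      show "0 < ?h n" using h0_pos by (intro divide_pos_pos mult_pos_pos) auto
      show "?h n < h0" using h0_pos by (simp add: field_simps)
    qed
    show "rp2_of (0, sqrt (2 * ?h n)) \<in> rp2_of ` P" for n
    proof -
      have "(0, sqrt (2 * ?h n)) \<noteq> (0::real, 0)" using h(1)[of n] h0_pos by simp
      with segment_in_annulus[OF less_imp_le[OF h(1)] h(2), of n] show ?thesis by blast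
    qed
    have "(\<lambda>n. sqrt (2 * ?h n)) \<longlonglongrightarrow> sqrt (2 * h0)"
    proof -
      have "(\<lambda>n. (real n + 1) / (real n + 2)) \<longlonglongrightarrow> 1" by real_asymp
      then have "(\<lambda>n. sqrt (2 * (h0 * ((real n + 1) / (real n + 2))))) \<longlonglongrightarrow> sqrt (2 * (h0 * 1))"
        by (intro tendsto_intros)
      then show ?thesis by simp
    qed
    then have "(\<lambda>n. (0::real, sqrt (2 * ?h n))) \<longlonglongrightarrow> (0, sqrt (2 * h0))"
      by (rule tendsto_Pair[OF tendsto_const])
    from continuous_on_tendsto_compose[OF continuous_rp2_of[of UNIV] this]
    show "(\<lambda>n. rp2_of (0, sqrt (2 * ?h n))) \<longlonglongrightarrow> rp2_of ?q" by simp
  qed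
  moreover have "rp2_of ?q \<notin> interior (rp2_of ` P)" using nin interior_subset by blast
  moreover have "rp2_of ?q \<noteq> rp2_of (0, 0)" using inj_rp2_of h0_pos by force
  ultimately show ?thesis by (auto simp: outer_boundary_def frontier_def)
qed

text \<open>The points of energy at most h1 on the positive y-axis form a compact set inside the
  open image of the annulus with its center, hence at positive distance from the complement, which
  contains the outer boundary.\<close>

lemma segment_away_from_outer_boundary:
  assumes h1: "0 \<le> h1" "h1 < h0"
  shows "\<exists>e>0. \<forall>h. 0 \<le> h \<and> h \<le> h1 \<longrightarrow> e \<le> infdist (rp2_of (0, sqrt (2 * h))) (outer_boundary V J)"
proof -
  let ?O = "rp2_of ` insert (0, 0) P" and ?B = "outer_boundary V J"
  let ?f = "\<lambda>h. infdist (rp2_of (0, sqrt (2 * h))) (- ?O)"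
  have O: "open ?O" by (rule open_rp2_of[OF annulus_open])
  have sub: "?B \<subseteq> - ?O" using outer_boundary_disjoint by blast
  have "continuous_on {0..h1} (\<lambda>h. rp2_of (0, sqrt (2 * h)))"
    by (rule continuous_on_compose2[OF continuous_rp2_of[of UNIV]]) (auto intro!: continuous_intros)
  then have "continuous_on {0..h1} ?f" by (intro continuous_on_infdist)
  then obtain hm where hm: "hm \<in> {0..h1}" "\<And>h. h \<in> {0..h1} \<Longrightarrow> ?f hm \<le> ?f h"
    using continuous_attains_inf[of "{0..h1}" ?f] h1 by auto
  have "rp2_of (0, sqrt (2 * hm)) \<in> ?O" using segment_in_annulus[of hm] hm h1 by auto
  moreover have "- ?O \<noteq> {}" using sub outer_boundary_nonempty by blast
  moreover have "closed (- ?O)" using O by auto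
  ultimately have "0 < ?f hm" by (metis Compl_iff in_closed_iff_infdist_zero infdist_nonneg less_eq_real_def)
  moreover have "?f hm \<le> infdist (rp2_of (0, sqrt (2 * h))) ?B" if "0 \<le> h" "h \<le> h1" for h
    using hm(2)[of h] that infdist_mono[OF sub outer_boundary_nonempty, of "rp2_of (0, sqrt (2 * h))"] by force
  ultimately show ?thesis by blast
qed

lemma critical_orbit_facts:
  assumes "critical_periodic_orbit V J \<gamma>"
  obtains h where "0 < h" "h < h0" "(period_function V J has_real_derivative 0) (at h)"
    "(0, sqrt (2 * h)) \<in> \<gamma>" "\<gamma> = range (orbit_curve h)"
proof -
  obtain u h where u: "periodic_solution V J u" "\<gamma> = range u" "\<gamma> \<subseteq> P"
    and h: "\<forall>p\<in>\<gamma>. energy V p = h" "(period_function V J has_real_derivative 0) (at h)"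
    using assms unfolding critical_periodic_orbit_def periodic_orbit_def by blast
  have e: "energy V (u t) = h" for t using h(1) u(2) by simp
  have p: "u 0 \<in> P" using u by auto
  have h0: "0 < h" "h < h0" using energy_pos[OF p] energy_less[OF p] e by auto
  have r: "range u \<subseteq> P" using u by simp
  have "(0, sqrt (2 * h)) \<in> \<gamma>" using orbit_through_axis[OF u(1) r e] u(2) by (metis rangeI)
  moreover have "\<gamma> = range (orbit_curve h)" unfolding u(2) by (rule orbit_range[OF h0 u(1) r e])
  ultimately show thesis using that h0 h(2) by blast
qed

end

section \<open>Continuity in the parameter and the final count\<close>

lemma Ck_euler_op:
  fixes \<nu> :: "nat \<Rightarrow> 'p::topological_space \<Rightarrow> real"
  assumes "\<And>i. i \<in> set js \<Longrightarrow> continuous_on U (\<nu> i)"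
  shows "(\<And>k. Ck k (U \<times> UNIV) f) \<Longrightarrow> Ck k (U \<times> UNIV) (\<lambda>\<mu>. euler_op (map (\<lambda>i. \<nu> i \<mu>) js) (f \<mu>))"
  using assms
proof (induction js arbitrary: f k)
  case (Cons i js)
  have os: "open_slices (U \<times> (UNIV :: real set))" by (rule open_slices_Times) simp
  have "continuous_on (U \<times> (UNIV :: real set)) (\<lambda>p. - \<nu> i (fst p))"
    by (intro continuous_intros continuous_on_compose2[OF Cons.prems(2)]) auto
  then have n: "Ck k (U \<times> UNIV) (\<lambda>\<mu> u. - \<nu> i \<mu>)" for k by (intro Ck_param) (simp add: case_prod_beta)
  have "Ck k (U \<times> UNIV) (\<lambda>\<mu> u. u * deriv (f \<mu>) u + - \<nu> i \<mu> * f \<mu> u)" for k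
    by (intro Ck_add Ck_mult Ck_ident n Ck_deriv(1)[OF os] Cons.prems(1))
  then have "Ck k (U \<times> UNIV) (\<lambda>\<mu>. euler_shift (\<nu> i \<mu>) (f \<mu>))" for k
    by (simp add: euler_shift_def[abs_def] theta_def)
  from Cons.IH[OF this] Cons.prems(2) show ?case by simp
qed simp

lemma continuous_vandermonde:
  fixes \<nu> :: "nat \<Rightarrow> 'p::topological_space \<Rightarrow> real"
  assumes "\<And>i. i \<in> set js \<Longrightarrow> continuous_on U (\<nu> i)"
  shows "continuous_on U (\<lambda>\<mu>. vandermonde (map (\<lambda>i. \<nu> i \<mu>) js))"
proof -
  let ?n = "length js"
  have "continuous_on U (\<lambda>\<mu>. \<Sum>p | p permutes {0..<?n}. signof p * (\<Prod>i = 0..<?n. (\<nu> (js ! p i) \<mu>) ^ i))"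
  proof (intro continuous_intros)
    fix p i assume "p \<in> {p. p permutes {0..<?n}}" "i \<in> {0..<?n}"
    then have "p i < ?n" using permutes_in_image[of p "{0..<?n}" i] by auto
    then show "continuous_on U (\<nu> (js ! p i))" by (intro assms) simp
  qed
  moreover have "vandermonde (map (\<lambda>i. \<nu> i \<mu>) js) = (\<Sum>p | p permutes {0..<?n}. signof p * (\<Prod>i = 0..<?n. (\<nu> (js ! p i) \<mu>) ^ i))" for \<mu>
    unfolding vandermonde_def by (subst det_def') (auto intro!: sum.cong prod.cong)
  ultimately show ?thesis by simp
qed

lemma continuous_real_of_ereal:
  assumes "continuous_on S e" "\<And>x. x \<in> S \<Longrightarrow> \<bar>e x\<bar> \<noteq> (\<infinity>::ereal)"
  shows "continuous_on S (\<lambda>x. real_of_ereal (e x))"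
proof -
  have "continuous_on {y. \<bar>y\<bar> \<noteq> \<infinity>} real_of_ereal"
    by (intro continuous_at_imp_continuous_on ballI continuous_at_of_ereal) simp
  then show ?thesis
  proof (rule continuous_on_compose2[OF _ assms(1)])
    show "e ` S \<subseteq> {y. \<bar>y\<bar> \<noteq> \<infinity>}" using assms(2) by (intro image_subsetI CollectI)
  qed
qed

text \<open>Finiteness at one parameter excludes the alternative of constant infinite outer energy,
  and the remaining one provides finiteness and continuity throughout.\<close>

lemma potential_family_of_hypothesis:
  assumes cp: "\<And>\<mu>. \<mu> \<in> \<Lambda> \<Longrightarrow> center_potential (V \<mu>) (J \<mu>)"
    and H: "hypothesis_H \<Lambda> V J" and fin: "\<And>\<mu>. \<mu> \<in> \<Lambda> \<Longrightarrow> outer_energy (V \<mu>) (J \<mu>) < \<infinity>" and ne: "\<Lambda> \<noteq> {}"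
  shows "potential_family \<Lambda> V J (\<lambda>\<mu>. real_of_ereal (outer_energy (V \<mu>) (J \<mu>)))"
proof (rule potential_family.intro)
  have h: "(\<forall>\<mu>\<in>\<Lambda>. \<bar>outer_energy (V \<mu>) (J \<mu>)\<bar> \<noteq> \<infinity>) \<and> continuous_on \<Lambda> (\<lambda>\<mu>. outer_energy (V \<mu>) (J \<mu>))"
    using H fin ne by (auto simp: hypothesis_H_def continuous_or_const_def)
  show "annulus (V \<mu>) (J \<mu>) (real_of_ereal (outer_energy (V \<mu>) (J \<mu>)))" if "\<mu> \<in> \<Lambda>" for \<mu>
    using cp[OF that] h that
    by (intro annulus.intro annulus_axioms.intro potential.intro) (auto simp: ereal_real)
  show "continuous_on {(x, \<mu>). \<mu> \<in> \<Lambda> \<and> x \<in> J \<mu>} (\<lambda>(x, \<mu>). (deriv ^^ k) (V \<mu>) x)" for k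
    using H by (simp add: hypothesis_H_def)
  have c: "continuous_on \<Lambda> e" if "continuous_or_const \<Lambda> e c" for e c
    using that continuous_on_cong[of \<Lambda> \<Lambda> e "\<lambda>_. c"] by (auto simp: continuous_or_const_def)
  show "continuous_on \<Lambda> (\<lambda>\<mu>. x_left (V \<mu>) (J \<mu>))" "continuous_on \<Lambda> (\<lambda>\<mu>. x_right (V \<mu>) (J \<mu>))"
    using H by (auto simp: hypothesis_H_def intro: c)
  show "continuous_on \<Lambda> (\<lambda>\<mu>. real_of_ereal (outer_energy (V \<mu>) (J \<mu>)))"
    using h by (intro continuous_real_of_ereal) auto
qed

lemma enat_card_le_by_injection:
  assumes "finite T" "card T \<le> n" "inj_on f S" "f ` S \<subseteq> T"
  shows "enat_card S \<le> enat n"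
proof -
  have "finite S" using assms finite_imageD finite_subset by blast
  moreover have "card S \<le> card T" using assms card_inj_on_le by blast
  ultimately show ?thesis using assms(2) by (simp add: enat_card_def)
qed

theorem theorem6:
  fixes \<Lambda> U :: "(real ^ 'd) set"
    and V :: "real ^ 'd \<Rightarrow> real \<Rightarrow> real"
    and J :: "real ^ 'd \<Rightarrow> real set"
    and \<mu>0 :: "real ^ 'd"
    and n m :: nat
    and \<nu> :: "nat \<Rightarrow> real ^ 'd \<Rightarrow> real"
    and a \<xi> :: "real ^ 'd \<Rightarrow> real"
  defines "F \<equiv> \<lambda>\<mu>. DP_function (V \<mu>) (J \<mu>) (map (\<lambda>i. \<nu> i \<mu>) [1..<n + 1])"
  assumes "open \<Lambda>"
    and "\<And>\<mu>. \<mu> \<in> \<Lambda> \<Longrightarrow> center_potential (V \<mu>) (J \<mu>)"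
    and "hypothesis_H \<Lambda> V J"
    and "\<And>\<mu>. \<mu> \<in> \<Lambda> \<Longrightarrow> outer_energy (V \<mu>) (J \<mu>) < \<infinity>"
    and "\<mu>0 \<in> \<Lambda>"
    and "outer_boundary_continuous \<Lambda> V J \<mu>0"
    and "open U" and "\<mu>0 \<in> U" and "U \<subseteq> \<Lambda>"
    and "\<And>i. i \<in> {1..n} \<Longrightarrow> continuous_on U (\<nu> i)"
    and "quantified_at_1 U F a \<xi> \<mu>0"
    and "\<xi> \<mu>0 = 1 / 2 - real m"
    and "\<And>i \<mu>. i \<in> {1..m} \<Longrightarrow> \<mu> \<in> U \<Longrightarrow> momentum_defined i (F \<mu>) \<Longrightarrow> momentum i (F \<mu>) = 0"
  shows "Crit \<Lambda> V J \<mu>0 \<le> enat n"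
proof -
  note as = assms(2-)
  let ?h0 = "\<lambda>\<mu>. real_of_ereal (outer_energy (V \<mu>) (J \<mu>))"
  interpret fam: potential_family \<Lambda> V J ?h0
    by (rule potential_family_of_hypothesis) (use as in auto)
  note coord = fam.annulus_coordinate
  define \<nu>s where "\<nu>s \<mu> = map (\<lambda>i. \<nu> i \<mu>) [1..<n + 1]" for \<mu>
  define \<phi> where "\<phi> = fam.chart_density"
  define G where "G \<mu> u = vandermonde (\<nu>s \<mu>) * euler_op (\<nu>s \<mu>) (\<phi> \<mu>) u" for \<mu> u
  have \<nu>c: "continuous_on U (\<nu> i)" if "i \<in> set [1..<n + 1]" for i using that by (intro as) auto
  have G: "continuous_on (U \<times> UNIV) (\<lambda>(\<mu>, u). G \<mu> u)"
  proof -
    have "Ck k (U \<times> UNIV) \<phi>" for k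
      unfolding \<phi>_def by (rule Ck_subset[OF fam.Ck_chart_density]) (use as(9) in auto)
    then have "Ck 0 (U \<times> UNIV) (\<lambda>\<mu>. euler_op (\<nu>s \<mu>) (\<phi> \<mu>))"
      unfolding \<nu>s_def by (intro Ck_euler_op \<nu>c)
    moreover have "continuous_on (U \<times> UNIV) (\<lambda>p. vandermonde (\<nu>s (fst p)))"
      unfolding \<nu>s_def
      by (rule continuous_on_compose2[OF continuous_vandermonde[OF \<nu>c]]) (auto intro!: continuous_intros)
    ultimately show ?thesis unfolding G_def case_prod_beta by (intro continuous_intros) (auto simp: case_prod_beta)
  qed
  have FG: "F \<mu> x = G \<mu> (x / sqrt (1 - x\<^sup>2)) / (1 - x\<^sup>2)" if "\<mu> \<in> U" "x \<in> {0<..<1}" for \<mu> x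
    using fam.DP_function_eq[of \<mu> x "\<nu>s \<mu>"] that as(9) by (auto simp: F_def G_def \<phi>_def \<nu>s_def)
  obtain t0 where t0: "0 < t0" and ev: "\<forall>\<^sub>F \<mu> in nhds \<mu>0. \<forall>t\<ge>t0. averaging (G \<mu>) t \<noteq> 0"
    using averaging_eventually_nonzero[OF as(7,8) G FG as(11,12,13)] by blast
  \<comment> \<open>For a family member with outer energy h0, the bound t > t0 is equivalent to h >
    \<kappa> h0.\<close>
  define \<kappa> where "\<kappa> = t0\<^sup>2 / (1 + t0\<^sup>2)"
  have \<kappa>: "0 < \<kappa>" "\<kappa> < 1" using t0 by (auto simp: \<kappa>_def field_simps add_pos_pos)
  have h00: "0 < ?h0 \<mu>0" using annulus.h0_pos[OF fam.ann[OF as(5)]] .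
  \<comment> \<open>Halfway between \<kappa> h0 and h0 at the base parameter, so that \<kappa>
    h0(\<mu>) < h1 persists nearby. Energies up to h1 are kept off by \<epsilon>.\<close>
  define h1 where "h1 = (1 + \<kappa>) / 2 * ?h0 \<mu>0"
  have h1: "0 \<le> h1" "h1 < ?h0 \<mu>0" "\<kappa> * ?h0 \<mu>0 < h1" using \<kappa> h00 by (auto simp: h1_def field_simps)
  obtain \<epsilon> where \<epsilon>: "0 < \<epsilon>"
    "\<And>h. 0 \<le> h \<Longrightarrow> h \<le> h1 \<Longrightarrow> \<epsilon> \<le> infdist (rp2_of (0, sqrt (2 * h))) (outer_boundary (V \<mu>0) (J \<mu>0))"
    using annulus_coordinate.segment_away_from_outer_boundary[OF coord[OF as(5)] h1(1,2)] by blast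
  have "isCont ?h0 \<mu>0" using fam.h0_cont as(1,5) continuous_on_eq_continuous_at by blast
  then have "(?h0 \<longlongrightarrow> ?h0 \<mu>0) (nhds \<mu>0)" unfolding isCont_def by (rule tendsto_at_iff_tendsto_nhds[THEN iffD1])
  then have "((\<lambda>\<mu>. \<kappa> * ?h0 \<mu>) \<longlongrightarrow> \<kappa> * ?h0 \<mu>0) (nhds \<mu>0)" by (rule tendsto_mult_left)
  from order_tendstoD(2)[OF this h1(3)] ev
  have "\<forall>\<^sub>F \<mu> in nhds \<mu>0. \<kappa> * ?h0 \<mu> < h1 \<and> (\<forall>t\<ge>t0. averaging (G \<mu>) t \<noteq> 0)" by (rule eventually_conj)
  then obtain \<delta> where \<delta>: "0 < \<delta>"
    "\<And>\<mu>. dist \<mu> \<mu>0 < \<delta> \<Longrightarrow> \<kappa> * ?h0 \<mu> < h1 \<and> (\<forall>t\<ge>t0. averaging (G \<mu>) t \<noteq> 0)"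
    unfolding eventually_nhds_metric by blast
  \<comment> \<open>Halving turns the closed conditions of the definition into the strict ones
    needed: distance below \<delta>, and below the gap \<epsilon>.\<close>
  have "criticality_bound \<Lambda> V J \<mu>0 (\<delta> / 2) (\<epsilon> / 2) \<le> enat n"
    unfolding criticality_bound_def
  proof (rule SUP_least)
    fix \<mu> assume \<mu>: "\<mu> \<in> {\<mu> \<in> \<Lambda>. norm (\<mu> - \<mu>0) \<le> \<delta> / 2}"
    then have D: "\<mu> \<in> \<Lambda>" and "dist \<mu> \<mu>0 < \<delta>" using \<delta>(1) by (auto simp: dist_norm)
    from \<delta>(2)[OF this(2)] have near: "\<kappa> * ?h0 \<mu> < h1" and nz: "\<And>t. t0 \<le> t \<Longrightarrow> averaging (G \<mu>) t \<noteq> 0" by auto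
    let ?S = "{\<gamma>. critical_periodic_orbit (V \<mu>) (J \<mu>) \<gamma> \<and>
          hausdorff_dist (rp2_of ` \<gamma>) (outer_boundary (V \<mu>0) (J \<mu>0)) \<le> \<epsilon> / 2}"
    let ?T = "{t. t0 < t \<and> averaging (\<phi> \<mu>) t = 0}"
    have "averaging (euler_op (\<nu>s \<mu>) (\<phi> \<mu>)) t \<noteq> 0" if "t0 < t" for t
    proof -
      have "averaging (G \<mu>) t = vandermonde (\<nu>s \<mu>) * averaging (euler_op (\<nu>s \<mu>) (\<phi> \<mu>)) t"
        by (simp add: averaging_def G_def)
      then show ?thesis using nz[of t] that by auto
    qed
    moreover have "length (\<nu>s \<mu>) = n" by (simp add: \<nu>s_def del: upt_Suc)
    moreover have "smooth_line (\<phi> \<mu>)" unfolding \<phi>_def by (rule fam.smooth_chart_density[OF D])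
    ultimately have T: "finite ?T" "card ?T \<le> n"
      using zeros_averaging[OF less_imp_le[OF t0], of "\<phi> \<mu>" "\<nu>s \<mu>"] by auto
    have ex: "\<forall>\<gamma>\<in>?S. \<exists>h. 0 < h \<and> h < ?h0 \<mu> \<and> \<gamma> = range (annulus_coordinate.orbit_curve (V \<mu>) (J \<mu>) h) \<and>
        sqrt (h / (?h0 \<mu> - h)) \<in> ?T"
    proof
      fix \<gamma> assume "\<gamma> \<in> ?S"
      then have crit: "critical_periodic_orbit (V \<mu>) (J \<mu>) \<gamma>"
        and hd: "hausdorff_dist (rp2_of ` \<gamma>) (outer_boundary (V \<mu>0) (J \<mu>0)) \<le> \<epsilon> / 2" by auto
      obtain h where h: "0 < h" "h < ?h0 \<mu>" "(period_function (V \<mu>) (J \<mu>) has_real_derivative 0) (at h)"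
        "(0, sqrt (2 * h)) \<in> \<gamma>" "\<gamma> = range (annulus_coordinate.orbit_curve (V \<mu>) (J \<mu>) h)"
        by (rule annulus_coordinate.critical_orbit_facts[OF coord[OF D] crit])
      have "infdist (rp2_of (0, sqrt (2 * h))) (outer_boundary (V \<mu>0) (J \<mu>0)) \<le> \<epsilon> / 2"
        using infdist_le_hausdorff[of "rp2_of (0, sqrt (2 * h))" "rp2_of ` \<gamma>"] h(4) hd by (meson imageI order_trans)
      then have "h1 < h" using \<epsilon>(2)[of h] \<epsilon>(1) h(1) by force
      then have "\<kappa> * ?h0 \<mu> < h" using near by simp
      moreover have "0 < 1 + t0\<^sup>2" by (simp add: add_pos_nonneg)
      ultimately have "t0\<^sup>2 * ?h0 \<mu> < h * (1 + t0\<^sup>2)" unfolding \<kappa>_def by (simp add: pos_divide_less_eq)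
      then have "t0\<^sup>2 * (?h0 \<mu> - h) < h" by (simp add: algebra_simps)
      then have "t0\<^sup>2 < h / (?h0 \<mu> - h)" using h by (simp add: field_simps)
      then have "t0 < sqrt (h / (?h0 \<mu> - h))" by (rule real_less_rsqrt)
      moreover have "averaging (\<phi> \<mu>) (sqrt (h / (?h0 \<mu> - h))) = 0"
        unfolding \<phi>_def by (rule fam.critical_energy_zero[OF D h(1-3)])
      ultimately show "\<exists>h. 0 < h \<and> h < ?h0 \<mu> \<and> \<gamma> = range (annulus_coordinate.orbit_curve (V \<mu>) (J \<mu>) h) \<and>
        sqrt (h / (?h0 \<mu> - h)) \<in> ?T" using h by blast
    qed
    \<comment> \<open>One energy per critical orbit. The map from energy to t is injective, and the
      energy determines the orbit as a set, so orbits inject into zeros of the average.\<close>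
    obtain E where "\<forall>\<gamma>\<in>?S. 0 < E \<gamma> \<and> E \<gamma> < ?h0 \<mu> \<and>
        \<gamma> = range (annulus_coordinate.orbit_curve (V \<mu>) (J \<mu>) (E \<gamma>)) \<and> sqrt (E \<gamma> / (?h0 \<mu> - E \<gamma>)) \<in> ?T"
      using bchoice[OF ex] by (elim exE)
    note E = bspec[OF this]
    show "enat_card ?S \<le> enat n"
    proof (rule enat_card_le_by_injection[OF T])
      show "(\<lambda>\<gamma>. sqrt (E \<gamma> / (?h0 \<mu> - E \<gamma>))) ` ?S \<subseteq> ?T" using E by blast
      show "inj_on (\<lambda>\<gamma>. sqrt (E \<gamma> / (?h0 \<mu> - E \<gamma>))) ?S"
      proof (rule inj_onI)
        fix \<gamma> \<gamma>' assume g: "\<gamma> \<in> ?S" "\<gamma>' \<in> ?S"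
          and eq: "sqrt (E \<gamma> / (?h0 \<mu> - E \<gamma>)) = sqrt (E \<gamma>' / (?h0 \<mu> - E \<gamma>'))"
        from eq have "E \<gamma> / (?h0 \<mu> - E \<gamma>) = E \<gamma>' / (?h0 \<mu> - E \<gamma>')" by simp
        then have "E \<gamma> * (?h0 \<mu> - E \<gamma>') = E \<gamma>' * (?h0 \<mu> - E \<gamma>)"
          using E[OF g(1)] E[OF g(2)] by (simp add: frac_eq_eq)
        then have "?h0 \<mu> * (E \<gamma> - E \<gamma>') = 0" by (simp add: algebra_simps)
        then have "E \<gamma> = E \<gamma>'" using annulus.h0_pos[OF fam.ann[OF D]] by simp
        then show "\<gamma> = \<gamma>'" using E[OF g(1)] E[OF g(2)] by metis
      qed
    qed
  qed
  moreover have "Crit \<Lambda> V J \<mu>0 \<le> criticality_bound \<Lambda> V J \<mu>0 (\<delta> / 2) (\<epsilon> / 2)"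
    unfolding Crit_def using \<delta>(1) \<epsilon>(1) by (intro INF_lower2[of "\<delta> / 2"] INF_lower) auto
  ultimately show ?thesis by (rule order_trans[rotated])
qed

end
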